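(* Let $W$ be a finite Coxeter group, $c$ a standard Coxeter element, and $w\in W$. There exists a chain $\vec\pi\in\mathsf{MC}(W,c)$ such that $w\in\omega_\downarrow(\vec\pi)\vec\pi=\{\omega_\downarrow(\vec\pi)\pi:\pi\in\vec\pi\}$ if and only if $w^{-1}$ is $c^{-1}$-sortable.
   Context: $W$ is a finite Coxeter group of rank $r$ with simple reflections $S$ and reflections $T$; $\ell_S,\ell_T$ denote lengths. Bruhat order covers: $u\lessdot_{\mathrm B}v$ iff $v=ut$, $t\in T$, $\ell_S(v)=\ell_S(u)+1$. Absolute order: $u\leq_T v$ iff $\ell_T(u)+\ell_T(u^{-1}v)=\ell_T(v)$. A standard Coxeter element $c$ is a product of all elements of $S$ each once. $W_c^+=\{u:\ell_S(uc)=\ell_S(u)+r\}$. $\mathsf{MC}(W,c)$ is the set of maximal chains $\vec\pi=\{e=\pi_0\lessdot_T\cdots\lessdot_T\pi_r=c\}$ in $[e,c]_T$. $u\in W_c^+$ and $\vec\pi$ are concordant if $u\pi_0\leq_{\mathrm B}\cdots\leq_{\mathrm B}u\pi_r$. Left weak order: $u\leq_L v$ iff some reduced $S$-word of $v$ has a reduced word of $u$ as a suffix. For each $\vec\pi$, the set of $u\in W_c^+$ concordant with $\vec\pi$ is a nonempty interval of the left weak order; $\omega_\downarrow(\vec\pi)$ denotes its minimum. Sortability: for a standard Coxeter element $c'$ with a fixed reduced $S$-word $\mathsf c'$, the $c'$-sorting word of $w$ is the lexicographically first (by positions) subword of $\mathsf c'\mathsf c'\mathsf c'\cdots$ that is a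 reduced $S$-word for $w$; letting $I^{(k)}(w)$ be the set of letters of the $k$-th copy of $\mathsf c'$ used by it, $w$ is $c'$-sortable if $I^{(1)}(w)\supseteq I^{(2)}(w)\supseteq I^{(3)}(w)\supseteq\cdots$ (independent of the choice of $\mathsf c'$). *)

theory Defs
  imports "HOL-Algebra.Algebra" "HOL-Library.Sublist"
begin

section \<open>Words and Coxeter systems\<close>

definition word_prod :: "('a, 'b) monoid_scheme \<Rightarrow> 'a list \<Rightarrow> 'a" where
  "word_prod W ws = foldr (\<otimes>\<^bsub>W\<^esub>) ws \<one>\<^bsub>W\<^esub>"

text \<open>Deleting one occurrence of the relator word \<open>(s t)^m\<close>, where \<open>m\<close> is the order of the
  group element \<open>s t\<close>.  If \<open>s t\<close> has infinite order then \<^const>\<open>group.ord\<close> is 0, so the relator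
  is the empty word and imposes nothing.\<close>

inductive relator_deletion :: "('a, 'b) monoid_scheme \<Rightarrow> 'a set \<Rightarrow> 'a list \<Rightarrow> 'a list \<Rightarrow> bool"
  for W S where
  "\<lbrakk>us \<in> lists S; vs \<in> lists S; s \<in> S; t \<in> S\<rbrakk> \<Longrightarrow>
     relator_deletion W S
       (us @ concat (replicate (group.ord W (s \<otimes>\<^bsub>W\<^esub> t)) [s, t]) @ vs) (us @ vs)"

text \<open>\<open>W\<close> is generated by the set \<open>S\<close> of elements of order 2 and is presented by the relations
  \<open>(s t)^{m(s,t)} = 1\<close> (\<open>s, t\<close> in \<open>S\<close>): two words in \<open>S\<close> have the same product iff they are
  related by inserting and deleting relators.  Words without inverses suffice for a group
  presentation, since the case \<open>s = t\<close> gives the relators \<open>s s\<close>.\<close>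

definition coxeter_system :: "('a, 'b) monoid_scheme \<Rightarrow> 'a set \<Rightarrow> bool" where
  "coxeter_system W S \<longleftrightarrow>
     group W \<and> S \<subseteq> carrier W \<and> generate W S = carrier W \<and>
     (\<forall>s\<in>S. group.ord W s = 2) \<and>
     (\<forall>us\<in>lists S. \<forall>vs\<in>lists S.
        word_prod W us = word_prod W vs \<longleftrightarrow> equivclp (relator_deletion W S) us vs)"

definition reflections :: "('a, 'b) monoid_scheme \<Rightarrow> 'a set \<Rightarrow> 'a set" where
  "reflections W S = {w \<otimes>\<^bsub>W\<^esub> s \<otimes>\<^bsub>W\<^esub> inv\<^bsub>W\<^esub> w | w s. w \<in> carrier W \<and> s \<in> S}"

definition gen_length :: "('a, 'b) monoid_scheme \<Rightarrow> 'a set \<Rightarrow> 'a \<Rightarrow> nat" where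
  "gen_length W A w = (LEAST n. \<exists>ws\<in>lists A. length ws = n \<and> word_prod W ws = w)"

abbreviation length_S :: "('a, 'b) monoid_scheme \<Rightarrow> 'a set \<Rightarrow> 'a \<Rightarrow> nat" where
  "length_S W S \<equiv> gen_length W S"

abbreviation length_T :: "('a, 'b) monoid_scheme \<Rightarrow> 'a set \<Rightarrow> 'a \<Rightarrow> nat" where
  "length_T W S \<equiv> gen_length W (reflections W S)"

definition reduced_word :: "('a, 'b) monoid_scheme \<Rightarrow> 'a set \<Rightarrow> 'a \<Rightarrow> 'a list \<Rightarrow> bool" where
  "reduced_word W S w ws \<longleftrightarrow>
     ws \<in> lists S \<and> word_prod W ws = w \<and> length ws = length_S W S w"

definition standard_coxeter_element :: "('a, 'b) monoid_scheme \<Rightarrow> 'a set \<Rightarrow> 'a \<Rightarrow> bool" where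
  "standard_coxeter_element W S c \<longleftrightarrow>
     (\<exists>ws. distinct ws \<and> set ws = S \<and> word_prod W ws = c)"

section \<open>Bruhat, absolute and left weak order\<close>

definition bruhat_cover :: "('a, 'b) monoid_scheme \<Rightarrow> 'a set \<Rightarrow> 'a \<Rightarrow> 'a \<Rightarrow> bool" where
  "bruhat_cover W S u v \<longleftrightarrow>
     u \<in> carrier W \<and>
     (\<exists>t\<in>reflections W S. v = u \<otimes>\<^bsub>W\<^esub> t \<and> length_S W S v = length_S W S u + 1)"

definition bruhat_le :: "('a, 'b) monoid_scheme \<Rightarrow> 'a set \<Rightarrow> 'a \<Rightarrow> 'a \<Rightarrow> bool" where
  "bruhat_le W S = (bruhat_cover W S)\<^sup>*\<^sup>*"

definition abs_le :: "('a, 'b) monoid_scheme \<Rightarrow> 'a set \<Rightarrow> 'a \<Rightarrow> 'a \<Rightarrow> bool" where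
  "abs_le W S u v \<longleftrightarrow>
     u \<in> carrier W \<and> v \<in> carrier W \<and>
     length_T W S u + length_T W S (inv\<^bsub>W\<^esub> u \<otimes>\<^bsub>W\<^esub> v) = length_T W S v"

definition abs_cover :: "('a, 'b) monoid_scheme \<Rightarrow> 'a set \<Rightarrow> 'a \<Rightarrow> 'a \<Rightarrow> bool" where
  "abs_cover W S u v \<longleftrightarrow>
     abs_le W S u v \<and> u \<noteq> v \<and> (\<forall>x. abs_le W S u x \<and> abs_le W S x v \<longrightarrow> x = u \<or> x = v)"

definition left_weak_le :: "('a, 'b) monoid_scheme \<Rightarrow> 'a set \<Rightarrow> 'a \<Rightarrow> 'a \<Rightarrow> bool" where
  "left_weak_le W S u v \<longleftrightarrow>
     (\<exists>us vs. reduced_word W S u us \<and> reduced_word W S v vs \<and> suffix us vs)"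

section \<open>Maximal chains and concordance\<close>

definition max_chains :: "('a, 'b) monoid_scheme \<Rightarrow> 'a set \<Rightarrow> 'a \<Rightarrow> 'a list set" where
  "max_chains W S c =
     {\<pi>. length \<pi> = card S + 1 \<and> \<pi> ! 0 = \<one>\<^bsub>W\<^esub> \<and> \<pi> ! card S = c \<and>
         (\<forall>x\<in>set \<pi>. abs_le W S \<one>\<^bsub>W\<^esub> x \<and> abs_le W S x c) \<and>
         (\<forall>i<card S. abs_cover W S (\<pi> ! i) (\<pi> ! Suc i))}"

definition Wc_plus :: "('a, 'b) monoid_scheme \<Rightarrow> 'a set \<Rightarrow> 'a \<Rightarrow> 'a set" where
  "Wc_plus W S c =
     {u \<in> carrier W. length_S W S (u \<otimes>\<^bsub>W\<^esub> c) = length_S W S u + card S}"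

definition concordant :: "('a, 'b) monoid_scheme \<Rightarrow> 'a set \<Rightarrow> 'a \<Rightarrow> 'a list \<Rightarrow> bool" where
  "concordant W S u \<pi> \<longleftrightarrow>
     (\<forall>i<card S. bruhat_le W S (u \<otimes>\<^bsub>W\<^esub> (\<pi> ! i)) (u \<otimes>\<^bsub>W\<^esub> (\<pi> ! Suc i)))"

definition concordant_set :: "('a, 'b) monoid_scheme \<Rightarrow> 'a set \<Rightarrow> 'a \<Rightarrow> 'a list \<Rightarrow> 'a set" where
  "concordant_set W S c \<pi> = {u \<in> Wc_plus W S c. concordant W S u \<pi>}"

definition omega_down :: "('a, 'b) monoid_scheme \<Rightarrow> 'a set \<Rightarrow> 'a \<Rightarrow> 'a list \<Rightarrow> 'a" where
  "omega_down W S c \<pi> =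
     (THE u. u \<in> concordant_set W S c \<pi> \<and>
             (\<forall>v\<in>concordant_set W S c \<pi>. left_weak_le W S u v))"

section \<open>Sortable elements\<close>

text \<open>Position \<open>i\<close> of the infinite word \<open>cw cw cw ...\<close> (counted from 0) carries the letter
  \<open>cw ! (i mod length cw)\<close> and lies in copy \<open>i div length cw\<close>.  A finite subword is given by the
  strictly increasing list of its positions.\<close>

definition reduced_subword ::
  "('a, 'b) monoid_scheme \<Rightarrow> 'a set \<Rightarrow> 'a list \<Rightarrow> 'a \<Rightarrow> nat list \<Rightarrow> bool" where
  "reduced_subword W S cw w ps \<longleftrightarrow>
     sorted_wrt (<) ps \<and> reduced_word W S w (map (\<lambda>i. cw ! (i mod length cw)) ps)"

definition sorting_positions ::
  "('a, 'b) monoid_scheme \<Rightarrow> 'a set \<Rightarrow> 'a list \<Rightarrow> 'a \<Rightarrow> nat list" where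
  "sorting_positions W S cw w =
     (THE ps. reduced_subword W S cw w ps \<and>
              (\<forall>qs. reduced_subword W S cw w qs \<longrightarrow> ps = qs \<or> (ps, qs) \<in> lexord less_than))"

text \<open>Copies are numbered from 0, so \<open>copy_letters W S cw w k\<close> is the set \<open>I^(k+1)(w)\<close>.\<close>

definition copy_letters ::
  "('a, 'b) monoid_scheme \<Rightarrow> 'a set \<Rightarrow> 'a list \<Rightarrow> 'a \<Rightarrow> nat \<Rightarrow> 'a set" where
  "copy_letters W S cw w k =
     {cw ! (i mod length cw) | i. i \<in> set (sorting_positions W S cw w) \<and> i div length cw = k}"

text \<open>Sortability of \<open>w\<close> for the standard Coxeter element with reduced word \<open>cw\<close>.\<close>

definition sortable :: "('a, 'b) monoid_scheme \<Rightarrow> 'a set \<Rightarrow> 'a list \<Rightarrow> 'a \<Rightarrow> bool" where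
  "sortable W S cw w \<longleftrightarrow>
     (\<forall>k. copy_letters W S cw w (Suc k) \<subseteq> copy_letters W S cw w k)"

end

theory Submission
  imports Defs
begin

text \<open>A chain for the Coxeter word \<open>cs\<close> is a factorization \<open>t\<^sub>1 \<cdots> t\<^sub>r\<close> of \<open>c\<close> into \<open>r\<close> reflections, and
  \<open>u\<close> is concordant with it iff every step \<open>u t\<^sub>1 \<cdots> t\<^sub>i \<rightarrow> u t\<^sub>1 \<cdots> t\<^sub>i t\<^sub>i\<^sub>+\<^sub>1\<close> goes up (then \<open>u\<close> is
  automatically in \<open>W\<^sub>c\<^sup>+\<close>, because \<open>c\<close> has length \<open>r\<close>). Let \<open>s\<close> be the final letter of \<open>c\<close> and
  \<open>J = S - {s}\<close>. If \<open>s\<close> is not a step of the chain, conjugation by \<open>s\<close> gives a chain for \<open>s c s\<close>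
  whose concordant elements are the \<open>u s < u\<close>; if \<open>s\<close> is a step, moving it to the end gives a chain
  for \<open>c s\<close> in the parabolic subgroup \<open>W\<^sub>J\<close> with the same minimal concordant element. These two
  cases are the two cases of the Cambrian recurrence for sortable elements. The recursion ends since
  rotating \<open>c\<close> turns every reflection into the final letter at some point: otherwise the sum of a
  \<open>c\<close>-orbit of positive roots would be a nonzero vector fixed by \<open>c\<close>, hence by every simple
  reflection. This is the only use of the geometric representation. For the converse, a sortable
  \<open>w\<^sup>-\<^sup>1\<close> starts with a first block \<open>c\<^sub>I\<close>; this reduces the claim to \<open>w = u c\<close>, and it remains to
  find a chain with minimum \<open>u\<close>. Here a chain whose recursion would take the wrong case is corrected
  by a Hurwitz move.\<close>

text \<open>Two facts on factorizations carry the recursion: a product of \<open>r\<close> distinct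
  simple reflections has reflection length \<open>r\<close>, and a shortest factorization of an
  element of a parabolic subgroup stays in that subgroup, so \<open>c s\<close> has all its chains
  inside \<open>par J\<close>. Both rest on straightening: a factorization is read as a path from 1,
  and a peak (a step up, then a step down) is replaced by a lower detour until the path only
  ascends, where the exchange condition decides. The obstacle in the converse is that a Hurwitz move
  changes the chain while the minimum must remain \<open>u\<close>. Minimality is therefore tested
  locally: a concordant \<open>u\<close> is the minimum iff each of its left descents is the left
  step of some step of the chain. A move replacing two adjacent steps only has to account for the
  two left steps that it removes. The argument lives in a type class of groups, where products of
  lists are at hand; \<open>W\<close> enters through its left regular representation. The initial
  letter of a word for the inverse of \<open>c\<close> is the final letter of \<open>c\<close>,
  which links the two recursions.\<close>

class mult_group = monoid_mult + inverse +
  assumes left_inv: "inverse a * a = 1"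
begin

lemma right_inv: "a * inverse a = 1"
proof -
  have "a * inverse a = (inverse (inverse a) * inverse a) * (a * inverse a)"
    by (simp add: left_inv)
  also have "\<dots> = inverse (inverse a) * (inverse a * a) * inverse a"
    by (simp only: mult.assoc)
  finally show ?thesis by (simp add: left_inv)
qed

lemma inv_cancel_left: "inverse a * (a * b) = b"
  by (simp add: mult.assoc[symmetric] left_inv)

lemma cancel_inv_left: "a * (inverse a * b) = b"
  by (simp add: mult.assoc[symmetric] right_inv)

lemma left_cancel: "a * b = a * c \<longleftrightarrow> b = c"
  by (metis inv_cancel_left)

lemma right_cancel: "b * a = c * a \<longleftrightarrow> b = c"
  by (metis mult.assoc mult_1_right right_inv)

lemma inv_unique: "a * b = 1 \<Longrightarrow> inverse a = b"
  by (metis inv_cancel_left mult_1_right)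

lemma inv_inv: "inverse (inverse a) = a"
  by (rule inv_unique) (rule left_inv)

lemma inv_mult: "inverse (a * b) = inverse b * inverse a"
  by (rule inv_unique) (simp add: mult.assoc cancel_inv_left right_inv)

lemma inv_one: "inverse 1 = 1"
  by (rule inv_unique) simp

lemmas grp = mult.assoc left_inv right_inv inv_cancel_left cancel_inv_left
  inv_inv inv_mult inv_one left_cancel right_cancel

lemma conj_eq_iff: "a * x * inverse a = a * y * inverse a \<longleftrightarrow> x = y"
  by (simp add: left_cancel right_cancel)

lemma conj_solve: "a * y * inverse a = b \<longleftrightarrow> y = inverse a * b * a"
  by (auto simp: grp)

end

section \<open>Words and their reflections\<close>

lemma prod_list_concat_replicate:
  "prod_list (concat (replicate n xs)) = (prod_list xs :: 'a :: monoid_mult) ^ n"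
  by (induction n) simp_all

text \<open>\<open>word_refls ws\<close> lists the reflections \<open>t\<close> for which \<open>prod_list ws * t\<close> is obtained by
  deleting one letter of \<open>ws\<close>.\<close>

fun word_refls :: "'g :: mult_group list \<Rightarrow> 'g list" where
  "word_refls [] = []"
| "word_refls (a # ws) = (inverse (prod_list ws) * a * prod_list ws) # word_refls ws"

lemma length_word_refls: "length (word_refls ws) = length ws"
  by (induction ws) simp_all

lemma word_refls_append:
  "word_refls (us @ vs) =
    map (\<lambda>r. inverse (prod_list vs) * r * prod_list vs) (word_refls us) @ word_refls vs"
  by (induction us) (simp_all add: grp)

text \<open>Strong exchange on words: moving the reflection leftwards past the tail turns it into
  the letter \<open>a\<close>, and \<open>a * a = 1\<close> removes that letter.\<close>

lemma word_refls_delete: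
  assumes "t \<in> set (word_refls ws)"
    and "\<And>a. a \<in> set ws \<Longrightarrow> a * a = 1"
  obtains as a bs where "ws = as @ a # bs" "t = inverse (prod_list bs) * a * prod_list bs"
    "prod_list ws * t = prod_list (as @ bs)"
  using assms
proof (induction ws arbitrary: thesis)
  case (Cons a ws)
  show ?case
  proof (cases "t = inverse (prod_list ws) * a * prod_list ws")
    case True
    have "a * (a * x) = x" for x
      using Cons.prems(3)[of a] by (simp add: mult.assoc[symmetric])
    then show ?thesis
      using Cons.prems(1)[of "[]" a ws] True by (simp add: grp)
  next
    case False
    then have "t \<in> set (word_refls ws)"
      using Cons.prems(2) by simp
    then obtain as b bs where "ws = as @ b # bs" "t = inverse (prod_list bs) * b * prod_list bs"
      "prod_list ws * t = prod_list (as @ bs)"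
      using Cons.IH Cons.prems(3) by (metis list.set_intros(2))
    then show ?thesis
      using Cons.prems(1)[of "a # as" b bs] by (simp add: mult.assoc)
  qed
qed simp

section \<open>Parity of the multiplicity of a reflection in a word\<close>

lemma count_conj:
  fixes a :: "'g :: mult_group"
  shows "count_list (map (\<lambda>r. inverse a * r * a) rs) t = count_list rs (a * t * inverse a)"
proof (induction rs)
  case (Cons r rs)
  have "inverse a * r * a = t \<longleftrightarrow> r = a * t * inverse a"
    by (auto simp: grp)
  then show ?case using Cons by simp
qed simp

text \<open>This is the sign of the classical action of the group on signed reflections. Modulo 2
  the count is invariant under relators, so it belongs to the group element and not to the word
  (\<open>word_parity_eq\<close>); the exchange condition is drawn from it.\<close>

definition word_parity :: "'g :: mult_group list \<Rightarrow> 'g \<Rightarrow> bool" where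
  "word_parity ws t \<longleftrightarrow> odd (count_list (word_refls ws) t)"

lemma word_parity_append:
  "word_parity (us @ vs) t \<longleftrightarrow>
    (word_parity vs t \<noteq> word_parity us (prod_list vs * t * inverse (prod_list vs)))"
  by (auto simp: word_parity_def word_refls_append count_conj)

lemma mult_power_swap: "t * (s * t) ^ n = (t * s) ^ n * (t :: 'g :: monoid_mult)"
proof (induction n)
  case (Suc n)
  have "t * (s * t) ^ Suc n = (t * s) * (t * (s * t) ^ n)"
    by (simp add: mult.assoc)
  then show ?case by (simp add: Suc mult.assoc)
qed simp

lemma word_refls_alternating:
  fixes s t :: "'g :: mult_group"
  assumes "s * s = 1" "t * t = 1"
  shows "word_refls (concat (replicate n [s, t])) = map (\<lambda>i. (t * s) ^ i * t) (rev [0..<2 * n])"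
proof (induction n)
  case (Suc n)
  have inv: "inverse s = s" "inverse t = t"
    using assms by (auto intro: inv_unique)
  have ipow: "inverse ((s * t) ^ n) = (t * s) ^ n"
  proof (induction n)
    case (Suc n)
    have "inverse ((s * t) ^ Suc n) = inverse ((s * t) ^ n) * (t * s)"
      by (simp only: power_Suc inv_mult inv mult.assoc)
    then show ?case by (simp only: Suc power_Suc2)
  qed (simp add: inv_one)
  have "inverse ((s * t) ^ n) * t * (s * t) ^ n = (t * s) ^ n * ((t * s) ^ n * t)"
    by (simp only: ipow mult.assoc mult_power_swap)
  also have "\<dots> = (t * s) ^ (2 * n) * t"
    by (simp only: mult.assoc[symmetric] power_add[symmetric] mult_2)
  finally have 1: "inverse ((s * t) ^ n) * t * (s * t) ^ n = (t * s) ^ (2 * n) * t" .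
  have "inverse (t * (s * t) ^ n) = (t * s) ^ n * t"
    by (simp only: inv_mult ipow inv)
  then have "inverse (t * (s * t) ^ n) * s * (t * (s * t) ^ n) =
      (t * s) ^ n * (t * s) * ((t * s) ^ n * t)"
    by (simp only: mult_power_swap mult.assoc)
  also have "\<dots> = (t * s) ^ n * (t * s) ^ Suc n * t"
    by (simp only: mult.assoc power_Suc)
  also have "\<dots> = (t * s) ^ Suc (2 * n) * t"
    by (simp only: power_add[symmetric] add_Suc_right mult_2)
  finally have 2: "inverse (t * (s * t) ^ n) * s * (t * (s * t) ^ n) =
      (t * s) ^ Suc (2 * n) * t" .
  have "word_refls (concat (replicate (Suc n) [s, t])) =
      [inverse (t * (s * t) ^ n) * s * (t * (s * t) ^ n), inverse ((s * t) ^ n) * t * (s * t) ^ n]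
      @ word_refls (concat (replicate n [s, t]))"
    using prod_list_concat_replicate[of n "[s, t]"] by simp
  then show ?case
    unfolding Suc 1 2 by simp
qed simp

text \<open>The \<open>2 * m\<close> reflections \<open>(t * s) ^ i * t\<close> of the relator
  repeat with period \<open>m\<close>, so each of them occurs an even number of times.\<close>

lemma word_parity_relator:
  fixes s t :: "'g :: mult_group"
  assumes "s * s = 1" "t * t = 1" "(s * t) ^ m = 1"
  shows "\<not> word_parity (concat (replicate m [s, t])) r"
proof -
  have "(t * s) ^ m * (t * t) = t * (s * t) ^ m * t"
    by (simp only: mult_power_swap mult.assoc)
  then have "(t * s) ^ m = 1"
    using assms by simp
  then have per: "(t * s) ^ (i + m) = (t * s) ^ i" for i
    by (simp add: power_add assms)
  have "[0..<2 * m] = [0..<m] @ map (\<lambda>i. i + m) [0..<m]"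
    by (simp add: map_add_upt mult_2 upt_add_eq_append[of 0 m m, simplified])
  then have "map (\<lambda>i. (t * s) ^ i * t) [0..<2 * m] =
      map (\<lambda>i. (t * s) ^ i * t) [0..<m] @ map (\<lambda>i. (t * s) ^ i * t) [0..<m]"
    by (simp add: per comp_def)
  then have "even (count_list (map (\<lambda>i. (t * s) ^ i * t) [0..<2 * m]) r)"
    by simp
  then show ?thesis
    by (simp add: word_parity_def word_refls_alternating[OF assms(1,2)] rev_map[symmetric])
qed

lemma word_parity_delete_relator:
  fixes s t :: "'g :: mult_group"
  assumes "s * s = 1" "t * t = 1" "(s * t) ^ m = 1"
  shows "word_parity (us @ concat (replicate m [s, t]) @ vs) r = word_parity (us @ vs) r"
  using word_parity_relator[OF assms]
  by (simp add: word_parity_append prod_list_concat_replicate assms inv_one)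

section \<open>Auxiliary facts on lists, subsequences and the lexicographic order\<close>

lemma distinct_count_list: "distinct xs \<Longrightarrow> count_list xs x = (if x \<in> set xs then 1 else 0)"
  by (induction xs) auto

lemma subseq_set: "subseq xs ys \<Longrightarrow> set xs \<subseteq> set ys"
  by (induction rule: list_emb.induct) auto

lemma subseq_distinct: "subseq xs ys \<Longrightarrow> distinct ys \<Longrightarrow> distinct xs"
  by (induction rule: list_emb.induct) (auto dest: subseq_set)

lemma subseq_snoc:
  assumes "subseq xs (ys @ [y])"
  shows "subseq xs ys \<or> (\<exists>us. xs = us @ [y] \<and> subseq us ys)"
proof -
  obtain us vs where *: "xs = us @ vs" "subseq us ys" "subseq vs [y]"
    using assms by (rule subseq_appendE)
  show ?thesis
  proof (cases vs)
    case (Cons v vs')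
    then have "vs' = []" "v = y"
      using list_emb_length[OF *(3)] subseq_set[OF *(3)] by auto
    then show ?thesis using * Cons by blast
  qed (use * in simp)
qed

lemma lexord_map_add:
  "(us, vs) \<in> lexord less_than \<Longrightarrow> (map (\<lambda>i. i + n) us, map (\<lambda>i. i + n) vs) \<in> lexord less_than"
proof (induction us arbitrary: vs)
  case Nil
  then show ?case by (cases vs) auto
next
  case (Cons u us)
  then show ?case by (cases vs) auto
qed

section \<open>Coxeter systems in a type of group elements\<close>

text \<open>The ambient type may be larger than the group \<open>par S\<close> generated by \<open>S\<close>; the relators are
  \<open>(s t)^(m s t)\<close>.\<close>

inductive delete_relator :: "'g :: mult_group set \<Rightarrow> ('g \<Rightarrow> 'g \<Rightarrow> nat) \<Rightarrow> 'g list \<Rightarrow> 'g list \<Rightarrow> bool"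
  for S m where
  "\<lbrakk>us \<in> lists S; vs \<in> lists S; s \<in> S; t \<in> S\<rbrakk> \<Longrightarrow>
     delete_relator S m (us @ concat (replicate (m s t) [s, t]) @ vs) (us @ vs)"

text \<open>The standard parabolic subgroup of \<open>I\<close>. Words without inverses suffice,
  since for \<open>I\<close> inside \<open>S\<close> the generators are involutions
  (\<open>par_inv\<close>).\<close>

definition par :: "'g :: monoid_mult set \<Rightarrow> 'g set" where
  "par I = prod_list ` lists I"

lemma parE:
  assumes "w \<in> par I" obtains ws where "ws \<in> lists I" "w = prod_list ws"
  using assms by (auto simp: par_def)

lemma prod_list_in_par: "set ws \<subseteq> I \<Longrightarrow> prod_list ws \<in> par I"
  by (auto simp: par_def)

lemma one_in_par [simp, intro]: "1 \<in> par I"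
  using prod_list_in_par[of "[]" I] by simp

lemma par_mult [intro]: "x \<in> par I \<Longrightarrow> y \<in> par I \<Longrightarrow> x * y \<in> par I"
  by (auto elim!: parE simp flip: prod_list.append intro!: prod_list_in_par)

lemma gen_in_par [intro]: "s \<in> I \<Longrightarrow> s \<in> par I"
  using prod_list_in_par[of "[s]" I] by simp

lemma par_mono: "I \<subseteq> J \<Longrightarrow> par I \<subseteq> par J"
  unfolding par_def by (intro image_mono lists_mono)

lemma par_empty [simp]: "par {} = {1}"
  by (auto simp: par_def)

locale coxeter =
  fixes S :: "'g :: mult_group set" and m :: "'g \<Rightarrow> 'g \<Rightarrow> nat"
  assumes invol: "s \<in> S \<Longrightarrow> s * s = 1"
    and one_notin: "1 \<notin> S"
    and finite_group: "finite (par S)"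
    and relator: "s \<in> S \<Longrightarrow> t \<in> S \<Longrightarrow> (s * t) ^ m s t = 1"
    and m_diag: "s \<in> S \<Longrightarrow> m s s = 1"
    and m_pos: "s \<in> S \<Longrightarrow> t \<in> S \<Longrightarrow> m s t > 0"
    and m_sym: "s \<in> S \<Longrightarrow> t \<in> S \<Longrightarrow> m s t = m t s"
    and presentation: "us \<in> lists S \<Longrightarrow> vs \<in> lists S \<Longrightarrow> prod_list us = prod_list vs \<Longrightarrow>
      equivclp (delete_relator S m) us vs"
begin

definition len :: "'g \<Rightarrow> nat" where
  "len x = (LEAST n. \<exists>ws\<in>lists S. length ws = n \<and> prod_list ws = x)"

definition T :: "'g set" where
  "T = {x * s * inverse x | x s. x \<in> par S \<and> s \<in> S}"

text \<open>Right inversions. They are defined through length; \<open>N_iff_parity\<close> ties them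
  to the parity of words, which makes them computable for products.\<close>

definition N :: "'g \<Rightarrow> 'g set" where
  "N x = {t \<in> T. len (x * t) < len x}"

lemma finite_S: "finite S"
  by (rule finite_subset[OF _ finite_group]) auto

lemma inv_S: "s \<in> S \<Longrightarrow> inverse s = s"
  by (rule inv_unique) (rule invol)

lemma invol_left: "s \<in> S \<Longrightarrow> s * (s * x) = x"
  by (simp add: mult.assoc[symmetric] invol)

lemmas invs = inv_S invol invol_left

lemma inverse_prod_list: "ws \<in> lists S \<Longrightarrow> inverse (prod_list ws) = prod_list (rev ws)"
  by (induction ws) (auto simp: inv_one inv_mult invs)

lemma par_inv:
  assumes "I \<subseteq> S" "x \<in> par I" shows "inverse x \<in> par I"
proof -
  from assms(2) obtain ws where "ws \<in> lists I" "x = prod_list ws" by (rule parE)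
  moreover from this assms(1) have "ws \<in> lists S" by auto
  ultimately show ?thesis
    by (auto simp: inverse_prod_list intro!: prod_list_in_par)
qed

lemma equivclp_even_parity:
  assumes "equivclp (delete_relator S m) us vs"
  shows "even (length us) = even (length vs) \<and> word_parity us = word_parity vs"
  using assms
proof (induction rule: equivclp_induct)
  case (step y z)
  have "even (length us) = even (length vs) \<and> word_parity us = word_parity vs"
    if "delete_relator S m us vs" for us vs
    using that
  proof cases
    case (1 us vs s t)
    then show ?thesis
      using word_parity_delete_relator[of s t "m s t" us vs] invol relator
      by (auto simp: length_concat sum_list_replicate)
  qed
  then show ?case using step by metis
qed simp

lemma even_length_eq:
  assumes "us \<in> lists S" "vs \<in> lists S" "prod_list us = prod_list vs"
  shows "even (length us) = even (length vs)"
  using equivclp_even_parity[OF presentation[OF assms]] by blast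

lemma word_parity_eq:
  assumes "us \<in> lists S" "vs \<in> lists S" "prod_list us = prod_list vs"
  shows "word_parity us = word_parity vs"
  using equivclp_even_parity[OF presentation[OF assms]] by blast

section \<open>Length and reduced words\<close>

definition reduced :: "'g list \<Rightarrow> bool" where
  "reduced ws \<longleftrightarrow> ws \<in> lists S \<and> length ws = len (prod_list ws)"

lemma len_le: "ws \<in> lists S \<Longrightarrow> len (prod_list ws) \<le> length ws"
  unfolding len_def by (rule Least_le) auto

lemma ex_reduced:
  assumes "x \<in> par S" obtains ws where "reduced ws" "prod_list ws = x"
proof -
  have "\<exists>n. \<exists>ws\<in>lists S. length ws = n \<and> prod_list ws = x"
    using assms by (metis parE)
  from LeastI_ex[OF this] show ?thesis
    using that by (auto simp: reduced_def len_def)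
qed

lemma len_one [simp]: "len 1 = 0"
  using len_le[of "[]"] by simp

lemma len_eq_0: "x \<in> par S \<Longrightarrow> len x = 0 \<longleftrightarrow> x = 1"
  by (metis ex_reduced len_one length_0_conv prod_list.Nil reduced_def)

lemma len_mult_le:
  assumes "x \<in> par S" "y \<in> par S" shows "len (x * y) \<le> len x + len y"
proof -
  obtain us vs where "reduced us" "prod_list us = x" "reduced vs" "prod_list vs = y"
    using assms by (metis ex_reduced)
  then show ?thesis using len_le[of "us @ vs"] by (auto simp: reduced_def)
qed

lemma len_inv: "x \<in> par S \<Longrightarrow> len (inverse x) = len x"
proof -
  have "len (inverse x) \<le> len x" if "x \<in> par S" for x
  proof -
    obtain ws where "reduced ws" "prod_list ws = x" using ex_reduced[OF \<open>x \<in> par S\<close>] .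
    then show ?thesis
      using len_le[of "rev ws"] inverse_prod_list[of ws] by (auto simp: reduced_def in_lists_conv_set)
  qed
  from this[of x] this[of "inverse x"] show "x \<in> par S \<Longrightarrow> ?thesis"
    by (simp add: inv_inv par_inv)
qed

lemma even_len_word: "ws \<in> lists S \<Longrightarrow> even (len (prod_list ws)) = even (length ws)"
proof -
  assume ws: "ws \<in> lists S"
  then have "prod_list ws \<in> par S" by (simp add: par_def)
  then obtain us where "reduced us" "prod_list us = prod_list ws" by (rule ex_reduced)
  then show ?thesis
    using even_length_eq[of us ws] ws by (simp add: reduced_def)
qed

lemma even_len_mult:
  assumes "x \<in> par S" "y \<in> par S" shows "even (len (x * y)) \<longleftrightarrow> (even (len x) = even (len y))"
proof -
  obtain us vs where "us \<in> lists S" "prod_list us = x" "vs \<in> lists S" "prod_list vs = y"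
    using assms by (metis parE)
  then show ?thesis
    using even_len_word[of "us @ vs"] even_len_word[of us] even_len_word[of vs] by auto
qed

section \<open>Reflections and inversion sets\<close>

lemma T_par: "t \<in> T \<Longrightarrow> t \<in> par S"
  by (auto simp: T_def intro!: par_mult par_inv[of S])

lemma T_invol: "t \<in> T \<Longrightarrow> t * t = 1"
  by (auto simp: T_def grp invs)

lemma inv_T: "t \<in> T \<Longrightarrow> inverse t = t"
  by (rule inv_unique) (rule T_invol)

lemma T_invol_left: "t \<in> T \<Longrightarrow> t * (t * x) = x"
  by (simp add: mult.assoc[symmetric] T_invol)

lemmas invT = inv_T T_invol T_invol_left

lemma S_T: "s \<in> S \<Longrightarrow> s \<in> T"
  unfolding T_def by (rule CollectI, rule exI[of _ 1]) (auto simp: inv_one)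

lemma conj_T: assumes "t \<in> T" "x \<in> par S" shows "x * t * inverse x \<in> T"
proof -
  obtain y s where "t = y * s * inverse y" "y \<in> par S" "s \<in> S"
    using assms by (auto simp: T_def)
  then have "x * t * inverse x = (x * y) * s * inverse (x * y)" "x * y \<in> par S"
    using assms by (auto simp: grp)
  then show ?thesis using \<open>s \<in> S\<close> unfolding T_def by blast
qed

lemma conj_T': "t \<in> T \<Longrightarrow> x \<in> par S \<Longrightarrow> inverse x * t * x \<in> T"
  using conj_T[of t "inverse x"] by (simp add: par_inv inv_inv)

lemma conj_S_T: "t \<in> T \<Longrightarrow> s \<in> S \<Longrightarrow> s * t * s \<in> T"
  using conj_T[of t s] by (auto simp: invs)

text \<open>Wrapping the palindrome for \<open>?t\<close> in a letter \<open>a\<close> adds two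
  reflections to the list. Each of the two equals the new product \<open>a * ?t * a\<close> exactly
  when \<open>?t = a\<close>, so they do not affect the parity; the innermost word contributes the
  single reflection \<open>s\<close>.\<close>

lemma palindrome_parity:
  assumes "s \<in> S" "vs \<in> lists S"
  shows "word_parity (vs @ s # rev vs) (prod_list (vs @ s # rev vs))"
  using assms(2)
proof (induction vs)
  case (Cons a vs)
  let ?t = "prod_list (vs @ s # rev vs)"
  have a: "a \<in> S" "inverse a = a" using Cons by (auto simp: invs)
  have "vs \<in> lists S" using Cons by auto
  then have "?t = prod_list vs * s * inverse (prod_list vs)"
    using \<open>s \<in> S\<close> by (simp add: inverse_prod_list mult.assoc)
  then have t: "?t * ?t = 1" "inverse ?t = ?t"
    using \<open>s \<in> S\<close> by (auto simp: grp invs)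
  have p: "prod_list ((a # vs) @ s # rev (a # vs)) = a * ?t * a"
    by (simp add: mult.assoc)
  have single: "word_parity [a] x \<longleftrightarrow> x = a" for x
    by (auto simp: word_parity_def inv_one)
  have "word_parity (vs @ s # rev vs) ?t" using Cons by auto
  moreover have "a * (a * ?t * a) * inverse a = ?t"
    using a by (simp add: mult.assoc invs)
  ultimately have 1: "word_parity ((vs @ s # rev vs) @ [a]) (a * ?t * a) \<longleftrightarrow> a * ?t * a \<noteq> a"
    unfolding word_parity_append single by simp
  have "inverse (?t * a) = a * ?t"
    by (simp only: inv_mult a t)
  moreover have "(x * a) * (a * x * a) * (a * x) = x * x * x" for x
    using a by (simp add: mult.assoc invs)
  ultimately have "(?t * a) * (a * ?t * a) * inverse (?t * a) = ?t * ?t * ?t"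
    by simp
  then have "(?t * a) * (a * ?t * a) * inverse (?t * a) = ?t"
    using t by simp
  then have "word_parity ([a] @ (vs @ s # rev vs) @ [a]) (a * ?t * a) \<longleftrightarrow>
      ((a * ?t * a \<noteq> a) \<noteq> (?t = a))"
    unfolding word_parity_append[of "[a]"] 1 single prod_list.append[of _ "[a]"] by simp
  moreover have "a * ?t * a = a \<longleftrightarrow> ?t = a"
  proof
    assume "a * ?t * a = a"
    then have "a * (a * ?t * a) * a = a * a * a" by simp
    then show "?t = a" using a by (simp add: mult.assoc invs)
  qed (use a invol in simp)
  ultimately show ?case
    unfolding p by simp
qed (simp add: word_parity_def inv_one)

lemma reduced_suffix:
  assumes "reduced (us @ vs)" shows "reduced vs"
proof -
  have *: "us \<in> lists S" "vs \<in> lists S" using assms by (auto simp: reduced_def)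
  then obtain vs' where "reduced vs'" "prod_list vs' = prod_list vs"
    using ex_reduced[of "prod_list vs"] by (auto simp: par_def)
  then have "length us + length vs \<le> length us + len (prod_list vs)"
    using assms * len_le[of "us @ vs'"] by (auto simp: reduced_def)
  then show ?thesis using * len_le[of vs] by (simp add: reduced_def)
qed

lemma word_refls_T: "ws \<in> lists S \<Longrightarrow> set (word_refls ws) \<subseteq> T"
proof (induction ws)
  case (Cons a ws)
  then have "prod_list ws \<in> par S" "a \<in> S" by (auto simp: par_def)
  then show ?case
    using Cons conj_T'[OF S_T] by simp
qed simp

text \<open>If the reflection of the first letter occurred again, deleting the corresponding later
  letter would absorb the first one too and leave a word shorter by two.\<close>

lemma reduced_distinct_refls: "reduced ws \<Longrightarrow> distinct (word_refls ws)"
proof (induction ws)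
  case (Cons a ws)
  have red: "reduced ws" using reduced_suffix[of "[a]"] Cons by simp
  have "inverse (prod_list ws) * a * prod_list ws \<notin> set (word_refls ws)"
  proof
    let ?r = "inverse (prod_list ws) * a * prod_list ws"
    assume "?r \<in> set (word_refls ws)"
    then obtain as b bs where *: "ws = as @ b # bs" "prod_list ws * ?r = prod_list (as @ bs)"
      using word_refls_delete[of ?r ws] invol red unfolding reduced_def by (metis in_lists_conv_set)
    then have "prod_list (a # ws) = prod_list (as @ bs)"
      by (simp add: grp)
    moreover have "as @ bs \<in> lists S" using red * by (auto simp: reduced_def)
    ultimately have "len (prod_list (a # ws)) \<le> length (as @ bs)"
      using len_le[of "as @ bs"] by simp
    then show False using Cons.prems * by (simp add: reduced_def)
  qed
  then show ?case using Cons.IH red by simp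
qed simp

lemma parity_len_less:
  assumes "x \<in> par S" "ws \<in> lists S" "prod_list ws = x" "word_parity ws t"
  shows "len (x * t) < len x"
proof -
  obtain vs where vs: "reduced vs" "prod_list vs = x" using ex_reduced[OF assms(1)] .
  then have "word_parity vs t"
    using word_parity_eq[of vs ws] assms by (auto simp: reduced_def)
  then have "t \<in> set (word_refls vs)"
    unfolding word_parity_def by (metis count_notin even_zero)
  then obtain as b bs where *: "vs = as @ b # bs" "prod_list vs * t = prod_list (as @ bs)"
    using word_refls_delete[of t vs] invol vs unfolding reduced_def by (metis in_lists_conv_set)
  then have "as @ bs \<in> lists S" using vs by (auto simp: reduced_def)
  then show ?thesis using len_le[of "as @ bs"] * vs by (auto simp: reduced_def)
qed

lemma word_parity_self:
  assumes "t \<in> T" "ts \<in> lists S" "prod_list ts = t" shows "word_parity ts t"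
proof -
  obtain x s where x: "t = x * s * inverse x" "x \<in> par S" "s \<in> S"
    using assms by (auto simp: T_def)
  then obtain vs where vs: "vs \<in> lists S" "x = prod_list vs" by (metis parE)
  then have "prod_list (vs @ s # rev vs) = t"
    using x by (simp add: inverse_prod_list mult.assoc)
  then show ?thesis
    using palindrome_parity[OF x(3) vs(1)] word_parity_eq[of ts "vs @ s # rev vs"] assms vs x
    by (simp add: in_lists_conv_set)
qed

text \<open>Odd parity shortens by exchange. Conversely, \<open>t\<close> has odd parity in a word
  \<open>ts\<close> for \<open>t\<close> itself, so appending \<open>ts\<close> flips the parity of
  \<open>t\<close>. If it were even in \<open>ws\<close>, it would be odd in \<open>ws @ ts\<close>,
  and \<open>t\<close> would shorten \<open>prod_list ws * t\<close> as well.\<close>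

lemma N_iff_parity:
  assumes "t \<in> T" "ws \<in> lists S"
  shows "t \<in> N (prod_list ws) \<longleftrightarrow> word_parity ws t"
proof
  assume "word_parity ws t"
  then show "t \<in> N (prod_list ws)"
    using parity_len_less[of "prod_list ws" ws t] assms by (auto simp: N_def par_def)
next
  obtain ts where ts: "ts \<in> lists S" "prod_list ts = t" by (metis T_par assms(1) parE)
  assume "t \<in> N (prod_list ws)"
  then have less: "len (prod_list ws * t) < len (prod_list ws)" by (simp add: N_def)
  have "prod_list ws * t \<in> par S"
    using assms T_par by (auto intro: par_mult prod_list_in_par)
  have "\<not> word_parity (ws @ ts) t"
  proof
    assume "word_parity (ws @ ts) t"
    then have "len (prod_list ws * t * t) < len (prod_list ws * t)"
      using parity_len_less[of "prod_list (ws @ ts)" "ws @ ts" t] ts assms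
        \<open>prod_list ws * t \<in> par S\<close> by (simp add: in_lists_conv_set ball_Un)
    then show False using less assms by (simp add: mult.assoc invT)
  qed
  then show "word_parity ws t"
    using word_parity_self[OF assms(1) ts] assms(1)
    by (simp add: word_parity_append ts invT mult.assoc)
qed

lemma N_T: "N x \<subseteq> T" by (auto simp: N_def)

text \<open>The cocycle identity: \<open>N (x * y)\<close> is the symmetric difference of
  \<open>N y\<close> and a conjugate of \<open>N x\<close>. It asks for no additivity of lengths and
  replaces most length computations below.\<close>

lemma N_mult:
  assumes "t \<in> T" "x \<in> par S" "y \<in> par S"
  shows "t \<in> N (x * y) \<longleftrightarrow> ((t \<in> N y) \<noteq> (y * t * inverse y \<in> N x))"
proof -
  obtain us vs where "us \<in> lists S" "prod_list us = x" "vs \<in> lists S" "prod_list vs = y"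
    using assms by (metis parE)
  then show ?thesis
    using N_iff_parity[OF assms(1), of "us @ vs"] N_iff_parity[OF assms(1), of vs]
      N_iff_parity[of "y * t * inverse y" us] assms conj_T[of t y]
    by (simp add: word_parity_append)
qed

lemma N_reduced: assumes "reduced ws" shows "N (prod_list ws) = set (word_refls ws)"
proof -
  have ws: "ws \<in> lists S" using assms by (simp add: reduced_def)
  have "t \<in> N (prod_list ws) \<longleftrightarrow> t \<in> set (word_refls ws)" if "t \<in> T" for t
    using N_iff_parity[OF that ws] reduced_distinct_refls[OF assms]
    by (auto simp: word_parity_def distinct_count_list)
  then show ?thesis using N_T word_refls_T[OF ws] by blast
qed

lemma finite_N: "x \<in> par S \<Longrightarrow> finite (N x)"
  by (metis N_reduced ex_reduced finite_set)

lemma card_N: assumes "x \<in> par S" shows "card (N x) = len x"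
proof -
  obtain ws where ws: "reduced ws" "prod_list ws = x" using ex_reduced[OF assms] .
  have "card (N (prod_list ws)) = length (word_refls ws)"
    using distinct_card[OF reduced_distinct_refls[OF ws(1)]] by (simp add: N_reduced[OF ws(1)])
  then show ?thesis using ws by (simp add: length_word_refls reduced_def)
qed

lemma N_one [simp]: "N 1 = {}"
  using card_N[of 1] finite_N[of 1] by simp

lemma len_refl_neq: assumes "t \<in> T" "x \<in> par S" shows "len (x * t) \<noteq> len x"
proof -
  obtain ts where ts: "ts \<in> lists S" "prod_list ts = t" by (metis T_par assms(1) parE)
  have "odd (len t)"
  proof -
    obtain y s where x: "t = y * s * inverse y" "y \<in> par S" "s \<in> S"
      using assms by (auto simp: T_def)
    then have "s \<in> par S" "inverse y \<in> par S" "y * s \<in> par S"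
      using par_inv[of S y] by auto
    moreover have "odd (len s)"
      using even_len_word[of "[s]"] x by simp
    ultimately show ?thesis using x by (simp add: even_len_mult len_inv)
  qed
  then show ?thesis using even_len_mult[of x t] assms T_par by metis
qed

lemma len_S: "s \<in> S \<Longrightarrow> len s = 1"
  using len_le[of "[s]"] len_eq_0[of s] one_notin by fastforce

lemma N_S: assumes "s \<in> S" shows "N s = {s}"
proof -
  have "reduced [s]" using assms len_S by (simp add: reduced_def)
  from N_reduced[OF this] show ?thesis by (simp add: inv_one)
qed

lemma not_N_iff: "t \<in> T \<Longrightarrow> x \<in> par S \<Longrightarrow> t \<notin> N x \<longleftrightarrow> len x < len (x * t)"
  using len_refl_neq by (force simp: N_def)

lemma in_N_iff: "t \<in> T \<Longrightarrow> t \<in> N x \<longleftrightarrow> len (x * t) < len x"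
  by (simp add: N_def)

lemma len_mult_S:
  assumes "x \<in> par S" "s \<in> S"
  shows "len (x * s) = (if s \<in> N x then len x - 1 else len x + 1)"
proof -
  have "len (x * s) \<le> len x + 1" using len_mult_le[of x s] assms len_S by auto
  moreover have "len x \<le> len (x * s) + 1"
    using len_mult_le[of "x * s" s] assms len_S by (auto simp: mult.assoc invs)
  ultimately show ?thesis
    using assms not_N_iff[OF S_T, of s x] in_N_iff[OF S_T, of s x] by auto
qed

section \<open>Left descents\<close>

definition ldesc :: "'g \<Rightarrow> 'g set" where
  "ldesc x = {s \<in> S. len (s * x) < len x}"

lemma ldesc_inverse: assumes "x \<in> par S" shows "ldesc x = N (inverse x) \<inter> S"
proof -
  have "len (s * x) = len (inverse x * s)" if "s \<in> S" for s
    using len_inv[of "s * x"] assms that by (simp add: inv_mult invs par_mult gen_in_par)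
  then show ?thesis
    using assms len_inv by (auto simp: ldesc_def N_def S_T)
qed

lemma len_S_mult:
  assumes "x \<in> par S" "s \<in> S"
  shows "len (s * x) = (if s \<in> ldesc x then len x - 1 else len x + 1)"
proof -
  have "len (s * x) = len (inverse x * s)"
    using len_inv[of "s * x"] assms by (simp add: inv_mult invs par_mult gen_in_par)
  then show ?thesis
    using len_mult_S[of "inverse x" s] assms by (simp add: par_inv ldesc_inverse len_inv)
qed

lemma ldesc_len_pos: "s \<in> ldesc x \<Longrightarrow> len x > 0" by (auto simp: ldesc_def)

lemma N_S_mult:
  assumes "t \<in> T" "x \<in> par S" "s \<in> S"
  shows "t \<in> N (s * x) \<longleftrightarrow> ((t \<in> N x) \<noteq> (x * t * inverse x = s))"
  using N_mult[of t s x] assms N_S by auto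

lemma N_mult_S:
  assumes "t \<in> T" "x \<in> par S" "s \<in> S"
  shows "t \<in> N (x * s) \<longleftrightarrow> ((t = s) \<noteq> (s * t * s \<in> N x))"
  using N_mult[of t x s] assms N_S by (auto simp: invs)

lemma ldesc_conj_N:
  assumes "x \<in> par S" "s \<in> S"
  shows "s \<in> ldesc x \<longleftrightarrow> inverse x * s * x \<in> N x"
proof -
  have "inverse x * s * x \<in> T" using assms by (simp add: conj_T' S_T)
  then show ?thesis
    using assms by (simp add: N_def ldesc_def S_T grp)
qed

lemma not_ldesc_mult: "x \<in> par S \<Longrightarrow> s \<in> S \<Longrightarrow> s \<in> ldesc (s * x) \<longleftrightarrow> s \<notin> ldesc x"
  using len_S_mult[of x s] by (auto simp: ldesc_def invs)

lemma ex_ldesc: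
  assumes "x \<in> par S" "x \<noteq> 1" obtains s where "s \<in> ldesc x"
proof -
  obtain ws where ws: "reduced ws" "prod_list ws = x" using ex_reduced[OF assms(1)] .
  with assms obtain s vs where v: "ws = s # vs" by (cases ws) auto
  have vs: "vs \<in> lists S" "s \<in> S" using ws v by (auto simp: reduced_def)
  have "s * x = prod_list vs" using ws v vs by (auto simp: invs)
  then have "len (s * x) < len x" using len_le[OF vs(1)] ws v by (auto simp: reduced_def)
  then show ?thesis using that vs by (auto simp: ldesc_def)
qed

text \<open>If \<open>x * t\<close> differed from \<open>s * x\<close>, left multiplication of
  \<open>x\<close> by \<open>s\<close> would not create the inversion \<open>t\<close>, so
  \<open>s * x * t\<close> would be longer than \<open>len x + 1\<close>; but the descent
  \<open>s\<close> brings \<open>x * t\<close> down to length \<open>len x\<close>.\<close>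

lemma lifting:
  assumes "x \<in> par S" "t \<in> T" "len (x * t) = len x + 1" "s \<in> ldesc (x * t)" "s \<notin> ldesc x"
  shows "x * t = s * x"
proof (rule ccontr)
  have s: "s \<in> S" using assms by (simp add: ldesc_def)
  assume "x * t \<noteq> s * x"
  then have "x * t * inverse x \<noteq> s"
    by (auto simp: grp)
  then have "t \<notin> N (s * x)"
    using assms s by (simp add: N_S_mult not_N_iff)
  then have "len (s * x) < len (s * x * t)"
    using assms s by (subst not_N_iff[symmetric]) auto
  then show False
    using assms len_S_mult[of x s] len_S_mult[of "x * t" s] s T_par by (simp add: par_mult mult.assoc)
qed

declare par_mult [simp] T_par [simp]

lemma S_par [simp]: "s \<in> S \<Longrightarrow> s \<in> par S"
  by (rule gen_in_par)

lemma par_subset_S: "I \<subseteq> S \<Longrightarrow> x \<in> par I \<Longrightarrow> x \<in> par S"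
  using par_mono by blast

section \<open>Parabolic subgroups and minimal coset representatives\<close>

lemma par_cancel_right:
  assumes "I \<subseteq> S" "y \<in> par I" shows "x * y \<in> par I \<longleftrightarrow> x \<in> par I"
proof
  assume "x * y \<in> par I"
  then have "x * y * inverse y \<in> par I" using par_inv[OF assms] by (rule par_mult)
  then show "x \<in> par I" by (simp add: mult.assoc right_inv)
qed (use assms in simp)

lemma par_cancel_left:
  assumes "I \<subseteq> S" "y \<in> par I" shows "y * x \<in> par I \<longleftrightarrow> x \<in> par I"
proof
  assume "y * x \<in> par I"
  with par_inv[OF assms] have "inverse y * (y * x) \<in> par I" by (rule par_mult)
  then show "x \<in> par I" by (simp add: inv_cancel_left)
qed (use assms in simp)

text \<open>The reduced word grows by prepending letters. When a letter shortens the element,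
  exchange deletes a letter of the word already built, which keeps the word inside
  \<open>I\<close>.\<close>

lemma ex_reduced_par:
  assumes "I \<subseteq> S" "w \<in> par I" obtains ws where "reduced ws" "set ws \<subseteq> I" "prod_list ws = w"
proof -
  have "\<exists>vs. reduced vs \<and> set vs \<subseteq> I \<and> prod_list vs = prod_list ws" if "set ws \<subseteq> I" for ws
    using that
  proof (induction ws)
    case Nil
    show ?case by (rule exI[of _ "[]"]) (simp add: reduced_def)
  next
    case (Cons a ws)
    then obtain vs where vs: "reduced vs" "set vs \<subseteq> I" "prod_list vs = prod_list ws" by auto
    have a: "a \<in> S" using Cons assms by auto
    have vp: "prod_list vs \<in> par S" using vs(1) by (simp add: reduced_def par_def)
    show ?case
    proof (cases "a \<in> ldesc (prod_list vs)")
      case True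
      let ?r = "inverse (prod_list vs) * a * prod_list vs"
      have "?r \<in> set (word_refls vs)"
        using True a vp N_reduced[OF vs(1)] by (simp add: ldesc_conj_N)
      then obtain as b bs where *: "vs = as @ b # bs" "prod_list vs * ?r = prod_list (as @ bs)"
        using word_refls_delete[of ?r vs] invol vs unfolding reduced_def by (metis in_lists_conv_set)
      then have eq: "a * prod_list vs = prod_list (as @ bs)" by (simp add: grp)
      have "length (as @ bs) = len (a * prod_list vs)"
        using *(1) vs(1) True a vp len_S_mult[of "prod_list vs" a] unfolding reduced_def
        by (metis add_diff_cancel_left' add_Suc_right length_Cons length_append plus_1_eq_Suc)
      then have "reduced (as @ bs)"
        using * vs eq by (auto simp: reduced_def)
      then show ?thesis using * vs eq by (intro exI[of _ "as @ bs"]) auto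
    next
      case False
      then have "reduced (a # vs)"
        using vs a vp by (simp add: reduced_def len_S_mult)
      then show ?thesis using vs Cons.prems by (intro exI[of _ "a # vs"]) auto
    qed
  qed
  then show ?thesis using assms that by (metis in_listsD parE subsetI)
qed

lemma word_refls_par: "I \<subseteq> S \<Longrightarrow> set ws \<subseteq> I \<Longrightarrow> set (word_refls ws) \<subseteq> par I"
proof (induction ws)
  case (Cons a ws)
  then have "prod_list ws \<in> par I" "a \<in> par I" by (auto intro: prod_list_in_par)
  then show ?case using Cons par_inv[of I "prod_list ws"] by auto
qed simp

lemma N_par: assumes "I \<subseteq> S" "w \<in> par I" shows "N w \<subseteq> par I"
proof -
  obtain ws where "reduced ws" "set ws \<subseteq> I" "prod_list ws = w" using ex_reduced_par[OF assms] .
  then show ?thesis using N_reduced[of ws] word_refls_par[OF assms(1), of ws] by simp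
qed

lemma par_Int_S: assumes "I \<subseteq> S" "s \<in> S" "s \<in> par I" shows "s \<in> I"
proof -
  obtain ws where ws: "reduced ws" "set ws \<subseteq> I" "prod_list ws = s"
    using ex_reduced_par[OF assms(1,3)] .
  then have "length ws = 1" using assms len_S by (simp add: reduced_def)
  then obtain a where "ws = [a]" by (auto simp: length_Suc_conv)
  then show ?thesis using ws by simp
qed

lemma notin_N_par: "I \<subseteq> S \<Longrightarrow> s \<in> S \<Longrightarrow> s \<notin> I \<Longrightarrow> w \<in> par I \<Longrightarrow> s \<notin> N w"
  using N_par par_Int_S by blast

lemma notin_ldesc_par: "I \<subseteq> S \<Longrightarrow> s \<in> S \<Longrightarrow> s \<notin> I \<Longrightarrow> w \<in> par I \<Longrightarrow> s \<notin> ldesc w"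
  using notin_N_par[of I s "inverse w"] par_inv par_subset_S by (auto simp: ldesc_inverse)

lemma refl_mem_self_N: "t \<in> T \<Longrightarrow> t \<in> N t"
  using len_eq_0[of t] len_refl_neq[of t 1] by (simp add: N_def T_invol)

lemma N_mult_refl: "t \<in> T \<Longrightarrow> x \<in> par S \<Longrightarrow> t \<in> N (x * t) \<longleftrightarrow> t \<notin> N x"
  using not_N_iff[of t x] by (simp add: N_def mult.assoc invT)

text \<open>A shortest element \<open>a\<close> of the coset has no inversion in
  \<open>par I\<close>, while all inversions of \<open>z\<close> lie there. Hence in the cocycle
  identity for \<open>a * z\<close> the two sets are disjoint and their cardinalities, the lengths,
  add.\<close>

lemma coset_min:
  assumes "I \<subseteq> S" "u \<in> par S"
  obtains a z where "u = a * z" "a \<in> par S" "z \<in> par I"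
    "\<And>y. y \<in> par I \<Longrightarrow> len (a * y) = len a + len y"
proof -
  obtain y where y: "y \<in> par I" "\<And>y'. y' \<in> par I \<Longrightarrow> len (u * y) \<le> len (u * y')"
    using ex_has_least_nat[of "\<lambda>y. y \<in> par I" 1 "\<lambda>y. len (u * y)"] by auto
  let ?a = "u * y"
  have a: "?a \<in> par S" using y assms par_subset_S by auto
  have disj: "t \<notin> N ?a" if "t \<in> par I" for t
    using y(2)[OF par_mult[OF y(1) that]] by (auto simp: N_def mult.assoc)
  have "len (?a * z) = len ?a + len z" if z: "z \<in> par I" for z
  proof -
    have zS: "z \<in> par S" using z assms par_subset_S by blast
    let ?f = "\<lambda>t. inverse z * t * z"
    have inj: "inj_on ?f (N ?a)" by (auto simp: inj_on_def grp)
    have conv: "z * ?f t * inverse z = t" for t by (simp add: grp)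
    have dis: "?f ` N ?a \<inter> N z = {}"
    proof (safe, simp)
      fix t assume t: "t \<in> N ?a" "?f t \<in> N z"
      then have "z * ?f t * inverse z \<in> par I"
        using z N_par[OF assms(1) z] par_inv[OF assms(1) z] by blast
      then show False using t disj conv by simp
    qed
    have "N (?a * z) = ?f ` N ?a \<union> N z"
    proof (rule Set.set_eqI)
      fix t
      show "t \<in> N (?a * z) \<longleftrightarrow> t \<in> ?f ` N ?a \<union> N z"
      proof (cases "t \<in> T")
        case True
        have "z * t * inverse z \<in> N ?a \<longleftrightarrow> t \<in> ?f ` N ?a"
          by (auto simp: grp image_iff) (metis grp)
        then show ?thesis using N_mult[OF True a zS] dis by blast
      next
        case False
        then show ?thesis using N_T conj_T' zS by blast
      qed
    qed
    then have "card (N (?a * z)) = card (N ?a) + card (N z)"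
      using dis inj a zS by (simp add: card_Un_disjoint finite_N card_image)
    then show ?thesis using a zS by (simp add: card_N par_mult)
  qed
  then show ?thesis
    using that[of ?a "inverse y"] a y par_inv[OF assms(1)] by (simp add: grp)
qed

section \<open>Factorizations into reflections\<close>

text \<open>Ascents are recorded by inversion sets instead of lengths, so that \<open>N_mult\<close>
  governs how they behave under conjugation and translation.\<close>

fun ups :: "'g \<Rightarrow> 'g list \<Rightarrow> bool" where
  "ups x [] \<longleftrightarrow> True"
| "ups x (t # ts) \<longleftrightarrow> t \<notin> N x \<and> ups (x * t) ts"

text \<open>Termination measure of the straightening: it decreases whenever a peak of the path is
  replaced by a lower element.\<close>

fun path_sum :: "'g \<Rightarrow> 'g list \<Rightarrow> nat" where
  "path_sum x [] = 0"
| "path_sum x (t # ts) = len (x * t) + path_sum (x * t) ts"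

lemma ups_append: "ups x (us @ vs) \<longleftrightarrow> ups x us \<and> ups (x * prod_list us) vs"
  by (induction us arbitrary: x) (simp_all add: mult.assoc)

lemma path_sum_append: "path_sum x (us @ vs) = path_sum x us + path_sum (x * prod_list us) vs"
  by (induction us arbitrary: x) (simp_all add: mult.assoc)

lemma prod_refls_par: "set ts \<subseteq> T \<Longrightarrow> prod_list ts \<in> par S"
  by (induction ts) (auto intro: T_par)

lemma ups_len:
  "x \<in> par S \<Longrightarrow> set ts \<subseteq> T \<Longrightarrow> ups x ts \<Longrightarrow> len x + length ts \<le> len (x * prod_list ts)"
proof (induction ts arbitrary: x)
  case (Cons t ts)
  then have "len x < len (x * t)" by (simp add: not_N_iff)
  moreover have "len (x * t) + length ts \<le> len (x * t * prod_list ts)"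
    using Cons T_par by auto
  ultimately show ?case by (simp add: mult.assoc)
qed simp

text \<open>The path from \<open>y * t1\<close> up to \<open>y\<close> and down to
  \<open>y * t2\<close> gets a detour through \<open>y * t1 * t3\<close>, which lies below
  \<open>y\<close>. A left descent \<open>s\<close> of \<open>y\<close> removes from
  \<open>N y\<close> only the inversion conjugate to \<open>s\<close>. If this is \<open>t1\<close>
  or \<open>t2\<close>, a Hurwitz move of the pair does it; otherwise both survive in
  \<open>N (s * y)\<close> and the detour found there is lifted back by \<open>s\<close>.\<close>

lemma peak_lemma:
  assumes "y \<in> par S" "t1 \<in> N y" "t2 \<in> N y" "t1 \<noteq> t2"
  shows "\<exists>t3\<in>T. \<exists>t4\<in>T. t3 * t4 = t1 * t2 \<and> len (y * t1 * t3) < len y"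
  using assms
proof (induction "len y" arbitrary: y rule: less_induct)
  case less
  have t: "t1 \<in> T" "t2 \<in> T" using less.prems N_T by auto
  have "y \<noteq> 1" using less.prems by auto
  then obtain s where s: "s \<in> ldesc y" using ex_ldesc less.prems by blast
  then have sS: "s \<in> S" and sy: "len (s * y) = len y - 1" "len y > 0"
    using len_S_mult[of y s] less.prems by (auto simp: ldesc_def)
  have lower: "r \<in> N (s * y)" if "r \<in> N y" "y * r * inverse y \<noteq> s" for r
    using that less.prems sS N_T N_S_mult[of r y s] by auto
  consider "y * t1 * inverse y = s" | "y * t2 * inverse y = s"
    | "y * t1 * inverse y \<noteq> s" "y * t2 * inverse y \<noteq> s" by blast
  then show ?case
  proof cases
    case 1
    then have eq: "s * y = y * t1" by (auto simp: grp)
    have "y * t2 * inverse y \<noteq> s" using 1 less.prems by (auto simp: conj_eq_iff)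
    then have "t2 \<in> N (s * y)" using lower less.prems by blast
    then have "len (s * y * t2) < len (s * y)" by (simp add: N_def)
    then have "len (y * t1 * t2) < len y" using sy eq by simp
    then show ?thesis
      using t conj_T[of t1 t2] T_par by (intro bexI[of _ t2] bexI[of _ "t2 * t1 * t2"])
        (auto simp: invT mult.assoc)
  next
    case 2
    then have eq: "s * y = y * t2" by (auto simp: grp)
    have "y * t1 * inverse y \<noteq> s" using 2 less.prems by (auto simp: conj_eq_iff)
    then have "t1 \<in> N (s * y)" using lower less.prems by blast
    then have "len (s * y * t1) < len (s * y)" by (simp add: N_def)
    then have "len (s * y * t1) < len y" using sy by simp
    then show ?thesis
      using t conj_T[of t2 t1] T_par eq by (intro bexI[of _ t1] bexI[of _ "t1 * t2 * t1"])
        (auto simp: invT mult.assoc)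
  next
    case 3
    then have "t1 \<in> N (s * y)" "t2 \<in> N (s * y)" using lower less.prems by auto
    then obtain t3 t4 where *: "t3 \<in> T" "t4 \<in> T" "t3 * t4 = t1 * t2"
      "len (s * y * t1 * t3) < len (s * y)"
      using less.hyps[of "s * y"] less.prems sy sS by (auto simp: par_mult gen_in_par)
    have "len (y * t1 * t3) = len (s * (s * y * t1 * t3))"
      using sS by (simp add: mult.assoc invs)
    also have "\<dots> \<le> len (s * y * t1 * t3) + 1"
    proof -
      have "s * y * t1 * t3 \<in> par S" using * t T_par less.prems sS by auto
      then show ?thesis using len_S_mult[of "s * y * t1 * t3" s] sS by auto
    qed
    finally show ?thesis using * sy by auto
  qed
qed

section \<open>Shortest factorizations into reflections\<close>

definition tmin :: "'g list \<Rightarrow> bool" where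
  "tmin ts \<longleftrightarrow> set ts \<subseteq> T \<and>
    (\<forall>us. set us \<subseteq> T \<and> prod_list us = prod_list ts \<longrightarrow> length ts \<le> length us)"

lemma ex_tmin:
  assumes "set ts \<subseteq> T" obtains us where "tmin us" "prod_list us = prod_list ts" "length us \<le> length ts"
proof -
  obtain us where "set us \<subseteq> T \<and> prod_list us = prod_list ts"
    "\<And>vs. set vs \<subseteq> T \<and> prod_list vs = prod_list ts \<Longrightarrow> length us \<le> length vs"
    using ex_has_least_nat[of "\<lambda>us. set us \<subseteq> T \<and> prod_list us = prod_list ts" ts length] assms
    by auto
  then show ?thesis using assms by (intro that[of us]) (auto simp: tmin_def)
qed

lemma not_ups_peak:
  "\<not> ups (x * t) ts \<Longrightarrow> t \<notin> N x \<Longrightarrow>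
    \<exists>as t1 t2 bs. t # ts = as @ t1 # t2 # bs \<and> t1 \<notin> N (x * prod_list as) \<and>
      t2 \<in> N (x * prod_list as * t1)"
proof (induction ts arbitrary: x t)
  case (Cons t2 ts)
  show ?case
  proof (cases "t2 \<in> N (x * t)")
    case True
    then show ?thesis using Cons.prems by (intro exI[of _ "[]"] exI) auto
  next
    case False
    then obtain as t1 t2' bs where "t2 # ts = as @ t1 # t2' # bs"
      "t1 \<notin> N (x * t * prod_list as)" "t2' \<in> N (x * t * prod_list as * t1)"
      using Cons.IH[of "x * t" t2] Cons.prems by auto
    then show ?thesis by (intro exI[of _ "t # as"] exI) (auto simp: mult.assoc)
  qed
qed simp

text \<open>At 1 every step goes up, so a path that is not increasing has a peak. The two
  reflections at the peak differ, since equal neighbours would cancel and contradict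
  minimality.\<close>

lemma peak_exchange:
  assumes "tmin ts" "\<not> ups 1 ts"
  obtains as t1 t2 bs t3 t4 where "ts = as @ t1 # t2 # bs" "t1 \<noteq> t2" "t3 * t4 = t1 * t2"
    "tmin (as @ t3 # t4 # bs)" "path_sum 1 (as @ t3 # t4 # bs) < path_sum 1 ts"
proof -
  obtain t0 ts0 where "ts = t0 # ts0" using assms by (cases ts) auto
  with assms obtain as t1 t2 bs where p: "ts = as @ t1 # t2 # bs" "t1 \<notin> N (prod_list as)"
    "t2 \<in> N (prod_list as * t1)"
    using not_ups_peak[of 1 t0 ts0] by auto
  let ?x = "prod_list as"
  have T: "set as \<subseteq> T" "t1 \<in> T" "t2 \<in> T" "set bs \<subseteq> T" using assms p by (auto simp: tmin_def)
  have x: "?x \<in> par S" using T by (simp add: prod_refls_par)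
  have ne: "t1 \<noteq> t2"
  proof
    assume "t1 = t2"
    then have "prod_list (as @ bs) = prod_list ts" using p T by (simp add: invT)
    then have "length ts \<le> length (as @ bs)"
      using assms(1) T unfolding tmin_def by (metis set_append le_sup_iff)
    then show False using p by simp
  qed
  have y: "?x * t1 \<in> par S" "t1 \<in> N (?x * t1)" using p x T T_par by (auto simp: N_mult_refl)
  obtain t3 t4 where *: "t3 \<in> T" "t4 \<in> T" "t3 * t4 = t1 * t2" "len (?x * t3) < len (?x * t1)"
    using peak_lemma[OF y p(3) ne] T by (auto simp: mult.assoc invT)
  have eq: "prod_list (as @ t3 # t4 # bs) = prod_list ts"
    using * p by (simp add: mult.assoc[of t3, symmetric] mult.assoc[of t1, symmetric])
  have "tmin (as @ t3 # t4 # bs)"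
    using assms(1) T * p eq unfolding tmin_def by simp
  moreover have "path_sum 1 (as @ t3 # t4 # bs) < path_sum 1 ts"
    using * p by (simp add: path_sum_append mult.assoc[of _ t3] mult.assoc[of _ t1] del: mult.assoc)
  ultimately show ?thesis using that p ne * by blast
qed

lemma ex_ups:
  assumes "tmin ts" shows "\<exists>us. tmin us \<and> prod_list us = prod_list ts \<and> ups 1 us"
  using assms
proof (induction "path_sum 1 ts" arbitrary: ts rule: less_induct)
  case less
  show ?case
  proof (cases "ups 1 ts")
    case False
    with less.prems obtain as t1 t2 bs t3 t4 where *: "ts = as @ t1 # t2 # bs"
      "t3 * t4 = t1 * t2" "tmin (as @ t3 # t4 # bs)" "path_sum 1 (as @ t3 # t4 # bs) < path_sum 1 ts"
      using peak_exchange by metis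
    then have "prod_list (as @ t3 # t4 # bs) = prod_list ts"
      by (simp add: mult.assoc[of t3, symmetric] mult.assoc[of t1, symmetric])
    then show ?thesis using less.hyps[OF *(4,3)] by simp
  qed (use less in blast)
qed

lemma distinct_word_ne_one:
  assumes "distinct ws" "set ws \<subseteq> S" "prod_list ws = 1" shows "ws = []"
proof (cases ws)
  case (Cons a vs)
  then have "inverse a = prod_list vs"
    using assms by (intro inv_unique) simp
  then have "inverse (prod_list vs) = a"
    using inv_inv[of a] by simp
  moreover have "inverse (prod_list vs) \<in> par (set vs)"
    using Cons assms by (intro par_inv prod_list_in_par) auto
  ultimately have "a \<in> set vs" using Cons assms par_Int_S[of "set vs" a] by auto
  then show ?thesis using Cons assms by simp
qed

text \<open>The last step of an increasing path is an inversion of the end point, so by exchange it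
  deletes one letter of \<open>ws\<close>, and the remaining word is again distinct. Thus each step
  accounts for at most one letter.\<close>

lemma ups_distinct_word:
  "ups 1 ts \<Longrightarrow> set ts \<subseteq> T \<Longrightarrow> distinct ws \<Longrightarrow> set ws \<subseteq> S \<Longrightarrow> prod_list ts = prod_list ws \<Longrightarrow>
    length ws \<le> length ts"
proof (induction ts arbitrary: ws rule: rev_induct)
  case Nil
  then show ?case using distinct_word_ne_one[of ws] by simp
next
  case (snoc t ts)
  have t: "t \<in> T" "prod_list ts \<in> par S" using snoc by (auto simp: prod_refls_par)
  have ws: "ws \<in> lists S" using snoc by auto
  have "t \<notin> N (prod_list ts)" using snoc by (simp add: ups_append)
  then have "t \<in> N (prod_list ws)"
    using snoc.prems(5) t by (simp flip: snoc.prems(5) add: N_mult_refl)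
  then have "t \<in> set (word_refls ws)"
    using N_iff_parity[OF t(1) ws] by (metis count_notin even_zero word_parity_def)
  then obtain as b bs where *: "ws = as @ b # bs" "prod_list ws * t = prod_list (as @ bs)"
    using word_refls_delete[of t ws] invol ws by (metis in_lists_conv_set)
  have "prod_list ts = prod_list (as @ bs)"
    using *(2) snoc.prems(5) t by (simp flip: snoc.prems(5) *(2) add: mult.assoc invT)
  then have "length (as @ bs) \<le> length ts"
    using snoc * by (intro snoc.IH) (auto simp: ups_append)
  then show ?case using * by simp
qed

text \<open>Straightening makes any factorization increasing without making it longer. This
  combinatorial argument takes the place of counting the codimension of the fixed space.\<close>

theorem distinct_word_tlength:
  assumes "distinct ws" "set ws \<subseteq> S" "set ts \<subseteq> T" "prod_list ts = prod_list ws"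
  shows "length ws \<le> length ts"
proof -
  obtain us where us: "tmin us" "prod_list us = prod_list ts" "length us \<le> length ts"
    using ex_tmin[OF assms(3)] .
  then obtain vs where vs: "tmin vs" "prod_list vs = prod_list us" "ups 1 vs"
    using ex_ups by blast
  then have "length ws \<le> length vs"
    using ups_distinct_word[of vs ws] assms us by (auto simp: tmin_def)
  moreover have "length vs \<le> length us"
    using vs us by (auto simp: tmin_def)
  ultimately show ?thesis using us by simp
qed

lemma distinct_word_tmin:
  assumes "distinct ws" "set ws \<subseteq> S" "set ts \<subseteq> T" "prod_list ts = prod_list ws"
    "length ts = length ws"
  shows "tmin ts"
  using assms distinct_word_tlength[OF assms(1,2)] by (auto simp: tmin_def)

lemma distinct_word_reduced:
  assumes "distinct ws" "set ws \<subseteq> S" shows "len (prod_list ws) = length ws"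
proof -
  have "prod_list ws \<in> par S" using assms by (auto intro: prod_list_in_par)
  then obtain us where us: "reduced us" "prod_list us = prod_list ws" by (rule ex_reduced)
  then have "length ws \<le> length us"
    using assms S_T by (intro distinct_word_tlength) (auto simp: reduced_def)
  then show ?thesis using us len_le[of ws] assms by (auto simp: reduced_def)
qed

text \<open>The point is that an \<open>s \<noteq> t\<close> commuting with \<open>t\<close> cannot be an inversion of \<open>t\<close>.\<close>

lemma refl_shorten:
  assumes "t \<in> T" "s \<in> ldesc t" "t \<noteq> s"
  shows "len (s * t * s) + 2 = len t"
proof -
  have s: "s \<in> S" using assms by (simp add: ldesc_def)
  have tS: "t \<in> par S" using assms T_par by blast
  have sN: "s \<in> N t" using assms tS by (simp add: ldesc_inverse inv_T)
  have nc: "t * s * inverse t \<noteq> s"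
  proof
    assume c: "t * s * inverse t = s"
    obtain x p where x: "t = x * p * inverse x" "x \<in> par S" "p \<in> S"
      using assms(1) unfolding T_def by blast
    have xi: "inverse x \<in> par S" using x(2) by (rule par_inv[OF order_refl])
    let ?q = "inverse x * s * x"
    have qT: "?q \<in> T" using x s by (simp add: conj_T' S_T)
    have "?q = p * ?q * p"
    proof -
      have "inverse t = x * p * inverse x" using assms x(1) by (simp add: inv_T)
      then have "x * (p * ?q * p) * inverse x = t * s * inverse t"
        unfolding x(1) by (simp only: mult.assoc)
      then have "p * ?q * p = ?q" unfolding c conj_solve .
      then show ?thesis by (rule sym)
    qed
    moreover have "?q \<noteq> p"
    proof
      assume "?q = p"
      then have "x * p * inverse x = s" by (auto simp: grp)
      then show False using assms x by simp
    qed
    \<comment> \<open>\<open>p\<close> commutes with \<open>?q\<close>, so \<open>?q\<close> is an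
      inversion of \<open>x * p\<close> exactly if it is one of \<open>x\<close>. Comparing the
      cocycle identities for \<open>x * p * inverse x\<close> and for
      \<open>x * inverse x = 1\<close> then shows that \<open>s\<close> is no inversion of
      \<open>t\<close>.\<close>
    ultimately have 1: "?q \<in> N (x * p) \<longleftrightarrow> ?q \<in> N x"
      using N_mult_S[OF qT x(2,3)] by simp
    have "s \<in> N (x * p * inverse x) \<longleftrightarrow> ((s \<in> N (inverse x)) \<noteq> (?q \<in> N (x * p)))"
      using N_mult[of s "x * p" "inverse x"] s x xi by (auto simp: S_T inv_inv)
    moreover have "\<not> ((s \<in> N (inverse x)) \<noteq> (?q \<in> N x))"
      using N_mult[of s x "inverse x"] s x xi by (simp add: S_T inv_inv right_inv)
    ultimately show False using 1 sN x by simp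
  qed
  have "s \<in> N (s * t)" using N_S_mult[of s t s] sN nc s tS by (simp add: S_T)
  moreover have "s * t \<in> par S" using s tS by auto
  ultimately have "len (s * t * s) = len (s * t) - 1" "0 < len (s * t)"
    using len_mult_S[of "s * t" s] s by (auto simp: N_def)
  then show ?thesis
    using len_S_mult[of t s] assms s tS by simp
qed

lemma len_conj_S: assumes "x \<in> par S" "s \<in> S" shows "len (s * x * s) \<le> len x + 2"
  using len_mult_S[of "s * x" s] len_S_mult[of x s] assms by (auto split: if_splits)

text \<open>Conjugation by a left descent \<open>s\<close> of \<open>t\<close> shortens
  \<open>t\<close> by exactly 2, whereas it changes the lengths of \<open>r\<close> and of
  \<open>t * r * t\<close> by at most 2. So the claim for \<open>s * t * s\<close> lifts to
  \<open>t\<close>.\<close>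

lemma N_refl_shorter:
  assumes "t \<in> T" "r \<in> N t" "r \<noteq> t"
  shows "len r < len t \<or> len (t * r * t) < len t"
  using assms
proof (induction "len t" arbitrary: t r rule: less_induct)
  case less
  have rT: "r \<in> T" using less N_T by blast
  have tS: "t \<in> par S" using less T_par by blast
  have "t \<noteq> 1" using less by auto
  then obtain s where s: "s \<in> ldesc t" using ex_ldesc tS by blast
  then have sS: "s \<in> S" by (simp add: ldesc_def)
  have "t \<noteq> s" using less N_S[OF sS] by auto
  then have l: "len (s * t * s) + 2 = len t" using refl_shorten less s by blast
  let ?t = "s * t * s" and ?r = "s * r * s"
  have tT: "?t \<in> T" "?t \<in> par S" "?r \<in> T" "?r \<in> par S"
    using less.prems rT sS conj_S_T T_par by auto
  have tt: "t = s * ?t * s" "r = s * ?r * s" using sS by (simp_all add: mult.assoc invs)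
  show ?case
  proof (cases "r = s \<or> ?t * ?r * ?t = s")
    \<comment> \<open>The exceptional inversions: here \<open>r\<close> or \<open>t * r * t\<close>
      is the simple reflection \<open>s\<close> itself, while \<open>t\<close> has length greater
      than 1.\<close>
    case True
    moreover have "t * r * t = s * (?t * ?r * ?t) * s" using sS by (simp add: mult.assoc invs)
    ultimately have "r = s \<or> t * r * t = s" using sS by (elim disjE) (simp_all only: invol mult_1_left simp_thms)
    then show ?thesis using l len_S[OF sS] by auto
  next
    case False
    have "r \<in> N (s * ?t * s)" using less tt by simp
    then have "?r \<in> N (s * ?t)"
      using N_mult_S[of r "s * ?t" s] False rT sS tT by (simp add: par_mult gen_in_par)
    then have "?r \<in> N ?t"
      using N_S_mult[of ?r ?t s] False tT sS by (simp add: inv_T)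
    moreover have "?r \<noteq> ?t" using less.prems sS by (metis tt)
    ultimately have "len ?r < len ?t \<or> len (?t * ?r * ?t) < len ?t"
      using less.hyps[of ?t ?r] l tT by simp
    moreover have "len r \<le> len ?r + 2" using len_conj_S[of ?r s] tt tT sS by simp
    moreover have "len (t * r * t) \<le> len (?t * ?r * ?t) + 2"
    proof -
      have "t * r * t = s * (?t * ?r * ?t) * s" using sS by (simp add: mult.assoc invs)
      then show ?thesis using len_conj_S[of "?t * ?r * ?t" s] tT sS by (simp add: par_mult)
    qed
    ultimately show ?thesis using l by auto
  qed
qed

text \<open>Let \<open>t\<close> be a shortest reflection in the coset \<open>t1 * par I\<close> and \<open>r\<close> another one. As \<open>r * t\<close> lies
  in \<open>par I\<close>, its inversions avoid the coset, so \<open>r\<close> is an inversion of \<open>t\<close>; then \<open>r\<close> or \<open>t * r * t\<close>,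
  both in the coset, is shorter than \<open>t\<close>.\<close>

lemma refl_coset_unique:
  assumes "I \<subseteq> S" "t1 \<in> T" "t2 \<in> T" "t1 * t2 \<in> par I" "t1 \<notin> par I"
  shows "t1 = t2"
proof (rule ccontr)
  assume ne: "t1 \<noteq> t2"
  define A where "A = {t \<in> T. t1 * t \<in> par I}"
  have "t1 \<in> A" "t2 \<in> A" using assms by (auto simp: A_def T_invol)
  then obtain t where t: "t \<in> A" "\<And>r. r \<in> A \<Longrightarrow> len t \<le> len r"
    using ex_has_least_nat[of "\<lambda>t. t \<in> A" t1 len] by auto
  obtain r where r: "r \<in> A" "r \<noteq> t" using ne \<open>t1 \<in> A\<close> \<open>t2 \<in> A\<close> by metis
  have T: "t \<in> T" "r \<in> T" "t \<in> par S" "r \<in> par S" using t r T_par by (auto simp: A_def)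
  have coset: "p * q \<in> par I" if "p \<in> A" "q \<in> A" for p q
  proof -
    have "inverse (t1 * p) * (t1 * q) \<in> par I"
      using that assms(1) par_inv by (auto simp: A_def)
    then show ?thesis using that assms by (simp add: A_def inv_mult inv_T mult.assoc T_invol_left)
  qed
  have out: "p \<notin> par I" if "p \<in> A" for p
    using that assms par_cancel_right[of I p t1] by (auto simp: A_def)
  have tr: "t * r \<in> par I" "r * t \<in> par I" using coset t r by auto
  have trt: "t * r * t \<in> A"
  proof -
    have "t1 * t * (r * t) \<in> par I" using t tr by (auto simp: A_def)
    then show ?thesis using T conj_T[of r t] by (simp add: A_def mult.assoc inv_T)
  qed
  have "r \<in> N t"
  proof -
    have "r = (r * t) * t" using T by (simp add: mult.assoc T_invol)
    then have "r \<in> N ((r * t) * t)" using refl_mem_self_N[of r] T by simp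
    moreover have "t * r * inverse t \<notin> N (r * t)"
      using N_par[OF assms(1) tr(2)] out[OF trt] T by (auto simp: inv_T)
    ultimately show ?thesis using N_mult[of r "r * t" t] T by (simp add: par_mult)
  qed
  then show False using N_refl_shorter[of t r] T r t trt by force
qed

text \<open>The last step is an inversion of the end point and therefore lies in
  \<open>par I\<close> by \<open>N_par\<close>; without it the path again ends in
  \<open>par I\<close>.\<close>

lemma ups_par:
  assumes "I \<subseteq> S"
  shows "set ts \<subseteq> T \<Longrightarrow> x \<in> par S \<Longrightarrow> ups x ts \<Longrightarrow> x * prod_list ts \<in> par I \<Longrightarrow> set ts \<subseteq> par I"
proof (induction ts rule: rev_induct)
  case (snoc t ts)
  have "prod_list ts \<in> par S" using snoc by (simp add: prod_refls_par)
  then have "t \<in> N (x * prod_list ts * t)"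
    using snoc by (simp add: ups_append N_mult_refl par_mult)
  then have t: "t \<in> par I" using N_par[OF assms] snoc by (auto simp: mult.assoc)
  then have "x * prod_list ts \<in> par I"
    using snoc.prems par_cancel_right[OF assms t, of "x * prod_list ts"] by (simp add: mult.assoc)
  then show ?case using snoc t by (auto simp: ups_append)
qed simp

text \<open>An increasing path is covered by \<open>ups_par\<close>. At a peak, the lower detour
  lies in \<open>par I\<close> by induction, hence so does \<open>t1 * t2\<close>; two different
  reflections with product in \<open>par I\<close> lie there themselves by
  \<open>refl_coset_unique\<close>.\<close>

theorem tmin_par:
  assumes "I \<subseteq> S" "tmin ts" "prod_list ts \<in> par I" shows "set ts \<subseteq> par I"
  using assms(2,3)
proof (induction "path_sum 1 ts" arbitrary: ts rule: less_induct)
  case less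
  show ?case
  proof (cases "ups 1 ts")
    case True
    then show ?thesis using ups_par[OF assms(1), of ts 1] less by (simp add: tmin_def)
  next
    case False
    with less.prems obtain as t1 t2 bs t3 t4 where *: "ts = as @ t1 # t2 # bs" "t1 \<noteq> t2"
      "t3 * t4 = t1 * t2" "tmin (as @ t3 # t4 # bs)" "path_sum 1 (as @ t3 # t4 # bs) < path_sum 1 ts"
      using peak_exchange by metis
    then have "prod_list (as @ t3 # t4 # bs) = prod_list ts"
      by (simp add: mult.assoc[of t3, symmetric] mult.assoc[of t1, symmetric])
    then have sub: "set (as @ t3 # t4 # bs) \<subseteq> par I" using less.hyps[OF *(5,4)] less.prems by simp
    then have "t1 * t2 \<in> par I" using *(3)[symmetric] by auto
    moreover have "t1 \<in> T" "t2 \<in> T" using less.prems * by (auto simp: tmin_def)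
    ultimately have "t1 \<in> par I" using refl_coset_unique[OF assms(1)] * by blast
    moreover from this have "t2 \<in> par I"
      using \<open>t1 * t2 \<in> par I\<close> par_cancel_left[OF assms(1)] by blast
    ultimately show ?thesis using sub * by auto
  qed
qed

text \<open>A Bruhat interval of length two has a second middle element \<open>z * x\<close>. Let
  \<open>s\<close> be a left descent of the top. If \<open>s\<close> is a descent of
  \<open>z\<close> too, the problem is moved down by \<open>s\<close>; otherwise
  \<open>lifting\<close> forces one of the two edges to be left multiplication by \<open>s\<close>,
  and the other middle element can be written down.\<close>

lemma diamond:
  assumes "z \<in> par S" "t1 \<in> T" "t2 \<in> T" "len (z * t1) = len z + 1" "len (z * t1 * t2) = len z + 2"
  shows "\<exists>x\<in>T. \<exists>y\<in>T. x * y = t1 * t2 \<and> x \<noteq> t1 \<and> len (z * x) = len z + 1"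
  using assms
proof (induction "len z" arbitrary: z t1 t2 rule: less_induct)
  case less
  define m v where "m = z * t1" and "v = m * t2"
  note T = less.prems(2,3)
  have p: "z \<in> par S" "m \<in> par S" "v \<in> par S" using less.prems T_par by (auto simp: m_def v_def)
  have l: "len m = len z + 1" "len v = len z + 2" using less.prems by (auto simp: m_def v_def)
  then obtain s where s: "s \<in> ldesc v" using ex_ldesc[OF p(3)] by fastforce
  then have sS: "s \<in> S" by (simp add: ldesc_def)
  define q where "q = inverse z * s * z"
  have qT: "q \<in> T" using p sS by (simp add: q_def conj_T' S_T)
  have zq: "z * q = s * z" by (simp add: q_def grp)
  have qt: "t1 * t2 = q * t1" if "v = s * m"
  proof -
    have "z * (t1 * t2) = s * z * t1" using that by (simp only: v_def m_def mult.assoc)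
    also have "\<dots> = z * (q * t1)" by (simp only: zq[symmetric] mult.assoc)
    finally show ?thesis by (simp only: left_cancel)
  qed
  show ?case
  proof (cases "s \<in> ldesc z")
    case sz: True
    then have lz: "len (s * z) + 1 = len z" using len_S_mult[OF p(1) sS] ldesc_len_pos by fastforce
    have szp: "s * z \<in> par S" using p sS by auto
    show ?thesis
    proof (cases "s \<in> ldesc m")
      case sm: True
      have "len (s * m) + 1 = len m" "len (s * v) + 1 = len v"
        using len_S_mult[of _ s] p sS sm s ldesc_len_pos by fastforce+
      then have "len (s * z * t1) = len (s * z) + 1" "len (s * z * t1 * t2) = len (s * z) + 2"
        using l lz by (simp_all add: m_def v_def mult.assoc)
      then obtain x y where xy: "x \<in> T" "y \<in> T" "x * y = t1 * t2" "x \<noteq> t1"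
        "len (s * z * x) = len (s * z) + 1"
        using less.hyps[of "s * z" t1 t2] lz szp T by auto
      show ?thesis
      proof (cases "z * x * inverse z = s")
        case True
        \<comment> \<open>The middle element found for the lowered interval is \<open>z\<close>
          itself, as \<open>s * z * x = z\<close>. The lowered top \<open>s * v = z * y\<close>
          serves instead.\<close>
        then have "s * z = z * x" by (auto simp: grp)
        moreover have "s * v = s * z * (t1 * t2)" by (simp add: v_def m_def mult.assoc)
        ultimately have "s * v = z * x * (x * y)" by (simp only: xy(3))
        then have sv: "s * v = z * y"
          using xy(1) by (simp add: mult.assoc T_invol_left)
        have "y \<noteq> t1"
        proof
          assume "y = t1"
          then have "s * v = m" using sv by (simp add: m_def)
          then have "s \<notin> ldesc v" using sm not_ldesc_mult[of v s] p sS by auto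
          then show False using s by simp
        qed
        moreover have "len (z * y) = len z + 1"
          using sv l \<open>len (s * v) + 1 = len v\<close> by simp
        moreover have "y * (y * x * y) = t1 * t2" using xy by (simp add: mult.assoc[symmetric] T_invol)
        moreover have "y * x * y \<in> T" using xy conj_T[of x y] T_par by (simp add: inv_T)
        ultimately show ?thesis using xy by blast
      next
        case False
        have "x \<notin> N (s * z)" using xy szp by (simp add: not_N_iff)
        then have "x \<notin> N z" using N_S_mult[of x z s] False xy p sS by simp
        then have "len z < len (z * x)" using xy p by (simp add: not_N_iff)
        moreover have "len (z * x) \<le> len (s * z * x) + 1"
        proof -
          have "s * z * x \<in> par S" "s * (s * z * x) = z * x"
            using xy szp sS by (simp_all add: mult.assoc invs del: par_mult)
              (simp add: mult.assoc[symmetric])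
          then show ?thesis using len_S_mult[of "s * z * x" s] sS by auto
        qed
        ultimately show ?thesis using xy lz by (intro bexI[of _ x] bexI[of _ y]) auto
      qed
    next
      case sm: False
      have "v = s * m"
        using lifting[of m t2 s] p T l s sm by (simp add: v_def)
      then have eq: "t1 * t2 = q * t1" by (rule qt)
      have "q * q = 1" using qT by (simp add: T_invol)
      have "s * z * q = z * (q * q)" by (simp only: zq[symmetric] mult.assoc)
      then have szq: "s * z * q = z" using \<open>q * q = 1\<close> by simp
      \<comment> \<open>Induction is applied to the interval from \<open>s * z\<close> through
        \<open>z\<close> to \<open>m\<close>, whose first step is \<open>q\<close>; the second
        middle element found there is then raised by \<open>s\<close>.\<close>
      then obtain x y where xy: "x \<in> T" "y \<in> T" "x * y = q * t1" "x \<noteq> q"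
        "len (s * z * x) = len (s * z) + 1"
        using less.hyps[of "s * z" q t1] lz szp qT T l by (auto simp: m_def)
      define m' where "m' = s * z * x"
      have m': "m' \<in> par S" using szp xy T_par by (auto simp: m'_def)
      have "s \<notin> ldesc m'"
      proof
        assume "s \<in> ldesc m'"
        moreover have "s \<notin> ldesc (s * z)" using sz not_ldesc_mult p sS by blast
        ultimately have "s * z * x = s * (s * z)" using lifting[of "s * z" x s] szp xy by (simp add: m'_def)
        then have "s * z * x = s * z * q" using szq sS by (simp add: mult.assoc invs)
        then show False using xy by (simp add: grp)
      qed
      then have "len (s * m') = len z + 1" using len_S_mult[OF m' sS] xy lz by (simp add: m'_def)
      moreover have "s * m' = z * x" using sS by (simp add: m'_def mult.assoc invs)
      moreover have "x \<noteq> t1"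
      proof
        assume "x = t1"
        then have "s * m' = m" using \<open>s * m' = z * x\<close> by (simp add: m_def)
        then have "m' = v" using \<open>v = s * m\<close> sS by (metis invol_left)
        then show False using l lz xy by (simp add: m'_def)
      qed
      ultimately show ?thesis using xy eq by auto
    qed
  next
    case sz: False
    then have lz: "len (s * z) = len z + 1" using len_S_mult[OF p(1) sS] by simp
    show ?thesis
    proof (cases "m = s * z")
      case True
      then have "s * v = z * t2"
        using sS by (simp add: v_def m_def mult.assoc invs)
      moreover have "len (s * v) + 1 = len v"
        using len_S_mult[of v s] p sS s ldesc_len_pos by fastforce
      ultimately have "len (z * t2) = len z + 1" using l by simp
      moreover have "t2 \<noteq> t1" using l T by (auto simp: v_def m_def mult.assoc invT)
      moreover have "t2 * (t2 * t1 * t2) = t1 * t2" using T by (simp add: mult.assoc invT)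
      moreover have "t2 * t1 * t2 \<in> T" using T conj_T[of t1 t2] T_par by (simp add: inv_T)
      ultimately show ?thesis using T by blast
    next
      case False
      then have "s \<notin> ldesc m" using lifting[of z t1 s] p T l sz by (auto simp: m_def)
      then have "v = s * m" using lifting[of m t2 s] p T l s by (simp add: v_def)
      then have "t1 * t2 = q * t1" by (rule qt)
      moreover have "q \<noteq> t1" using False zq by (auto simp: m_def)
      ultimately show ?thesis using qT T lz zq by (intro bexI[of _ q] bexI[of _ t1]) auto
    qed
  qed
qed

section \<open>The geometric representation\<close>

text \<open>The value \<open>B(v, alpha_s)\<close> of the canonical symmetric form with
  \<open>B(alpha_t, alpha_s) = - cos (pi / m t s)\<close>. A vector is the function of its
  coordinates in the basis of simple roots, which are the \<open>sroot s\<close>.\<close>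

definition pairing :: "('g \<Rightarrow> real) \<Rightarrow> 'g \<Rightarrow> real" where
  "pairing v s = (\<Sum>t\<in>S. v t * - cos (pi / real (m t s)))"

text \<open>The reflection \<open>v - 2 B(v, alpha_s) alpha_s\<close>. It changes only the
  coordinate at \<open>s\<close>, hence the function update.\<close>

definition rho :: "'g \<Rightarrow> ('g \<Rightarrow> real) \<Rightarrow> 'g \<Rightarrow> real" where
  "rho s v = v(s := v s - 2 * pairing v s)"

definition act :: "'g list \<Rightarrow> ('g \<Rightarrow> real) \<Rightarrow> 'g \<Rightarrow> real" where
  "act ws = foldr rho ws"

definition sroot :: "'g \<Rightarrow> 'g \<Rightarrow> real" where
  "sroot s = (\<lambda>x. if x = s then 1 else 0)"

lemma act_Nil [simp]: "act [] v = v"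
  and act_Cons [simp]: "act (a # ws) v = rho a (act ws v)"
  and act_append: "act (us @ vs) v = act us (act vs v)"
  by (simp_all add: act_def)

lemma pairing_sum: "finite A \<Longrightarrow> pairing (\<lambda>x. \<Sum>i\<in>A. f i * u i x) s = (\<Sum>i\<in>A. f i * pairing (u i) s)"
  unfolding pairing_def
  by (simp add: sum_distrib_left sum_distrib_right mult.assoc sum.swap[of _ A] sum_negf)

lemma rho_sum: "finite A \<Longrightarrow> rho s (\<lambda>x. \<Sum>i\<in>A. f i * u i x) = (\<lambda>x. \<Sum>i\<in>A. f i * rho s (u i) x)"
  by (rule ext)
     (simp add: rho_def pairing_sum right_diff_distrib sum_subtractf sum_distrib_left mult.left_commute)

lemma act_sum: "finite A \<Longrightarrow> act ws (\<lambda>x. \<Sum>i\<in>A. f i * u i x) = (\<lambda>x. \<Sum>i\<in>A. f i * act ws (u i) x)"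
  by (induction ws) (simp_all add: rho_sum)

lemma act_lincomb: "act ws (\<lambda>x. a * u x + b * v x) = (\<lambda>x. a * act ws u x + b * act ws v x)"
  using act_sum[of "{True, False}" ws "\<lambda>i. if i then a else b" "\<lambda>i. if i then u else v"]
  by simp

lemma act_uminus: "act ws (\<lambda>x. - v x) = (\<lambda>x. - act ws v x)"
  using act_lincomb[of ws "-1" v 0 v] by simp

lemma pairing_upd:
  assumes "s \<in> S" shows "pairing (v(s := v s + d)) t = pairing v t - d * cos (pi / real (m s t))"
proof -
  have "pairing (v(s := v s + d)) t =
      (\<Sum>r\<in>S. v r * - cos (pi / real (m r t)) + (if r = s then d * - cos (pi / real (m s t)) else 0))"
    unfolding pairing_def by (rule sum.cong) (auto simp: algebra_simps)
  also have "\<dots> = pairing v t + d * - cos (pi / real (m s t))"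
    using assms finite_S unfolding sum.distrib by (simp add: pairing_def)
  finally show ?thesis by simp
qed

lemma pairing_rho:
  assumes "s \<in> S" shows "pairing (rho s v) t = pairing v t + 2 * pairing v s * cos (pi / real (m s t))"
  using pairing_upd[OF assms, of v "- 2 * pairing v s" t] by (simp add: rho_def)

lemma rho_rho: assumes "s \<in> S" shows "rho s (rho s v) = v"
proof -
  have "pairing (rho s v) s = - pairing v s"
    using pairing_rho[OF assms, of v s] m_diag[OF assms] by simp
  then show ?thesis by (auto simp: rho_def fun_eq_iff)
qed

lemma sin_shift: "sin (a + t) = 2 * cos t * sin a - sin (a - t)" for a t :: real
  by (simp add: sin_add sin_diff)

text \<open>On the pairings with \<open>s\<close> and \<open>t\<close>, the product of the two
  reflections acts as a rotation by \<open>2 * a\<close> with \<open>a = pi / n\<close>, so after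
  \<open>n\<close> rounds they return to their start. An invariant combination then recovers the
  coordinates at \<open>s\<close> and \<open>t\<close>.\<close>

lemma rho_relator:
  assumes st: "s \<in> S" "t \<in> S"
  shows "((\<lambda>v. rho s (rho t v)) ^^ m s t) v = v"
proof (cases "s = t")
  case True
  then show ?thesis using assms by (simp add: m_diag rho_rho)
next
  case False
  define n where "n = m s t"
  have "n \<noteq> 1"
  proof
    assume "n = 1"
    then have "s * t = 1" using relator[OF st] by (simp add: n_def)
    then show False using False inv_unique[of s t] inv_S st by simp
  qed
  then have n: "n \<ge> 2" using m_pos[OF st] by (simp add: n_def)
  define a c where "a = pi / real n" and "c = cos a"
  have a: "0 < a" "a < pi" using n by (auto simp: a_def field_simps)
  then have sa: "sin a > 0" by (rule sin_gt_zero)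
  have c2: "1 - c\<^sup>2 = (sin a)\<^sup>2" by (simp add: c_def sin_squared_eq)
  have na: "real n * a = pi" using n by (simp add: a_def)
  let ?f = "\<lambda>v. rho s (rho t v)"
  define p q where "p = pairing v s" and "q = pairing v t"
  have mst: "m s t = n" "m t s = n" "m s s = 1" "m t t = 1"
    using m_sym[OF st] m_diag st by (auto simp: n_def)
  have ps: "pairing (rho t u) s = pairing u s + 2 * c * pairing u t" for u
    using pairing_rho[OF st(2), of u s] by (simp add: mst c_def a_def mult.commute)
  have ps': "pairing (?f u) s = - pairing u s - 2 * c * pairing u t" for u
    using pairing_rho[OF st(1), of "rho t u" s] by (simp add: mst ps)
  have pt': "pairing (?f u) t = - pairing u t + 2 * c * (pairing u s + 2 * c * pairing u t)" for u
    using pairing_rho[OF st(1), of "rho t u" t] pairing_rho[OF st(2), of u t]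
    by (simp add: mst ps c_def a_def mult.commute)
  have fs: "?f u s = u s - 2 * (pairing u s + 2 * c * pairing u t)" for u
    using False by (simp add: rho_def[of s] ps) (simp add: rho_def)
  have ft: "?f u t = u t - 2 * pairing u t" for u
    using False by (simp add: rho_def)
  have fx: "?f u x = u x" if "x \<noteq> s" "x \<noteq> t" for u x
    using that by (simp add: rho_def)
  \<comment> \<open>The solution of the recursion given by \<open>ps'\<close> and
    \<open>pt'\<close>, with angle \<open>2 * a\<close> per round. The factor \<open>sin a\<close>
    avoids a division.\<close>
  have closed: "sin a * pairing ((?f ^^ k) v) s = - (p * sin (2 * k * a - a) + q * sin (2 * k * a)) \<and>
      sin a * pairing ((?f ^^ k) v) t = q * sin (2 * k * a + a) + p * sin (2 * k * a)" for k
  proof (induction k)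
    case 0
    then show ?case by (simp add: p_def q_def)
  next
    case (Suc k)
    let ?u = "(?f ^^ k) v" and ?b = "2 * real k * a"
    have sh: "sin (?b + a) = 2 * c * sin ?b - sin (?b - a)"
      "sin (?b + 2 * a) = 2 * c * sin (?b + a) - sin ?b"
      "sin (?b + 3 * a) = 2 * c * sin (?b + 2 * a) - sin (?b + a)"
    proof -
      have "?b + 2 * a = (?b + a) + a" "(?b + a) - a = ?b"
        "?b + 3 * a = (?b + 2 * a) + a" "(?b + 2 * a) - a = ?b + a"
        by simp_all
      then show "sin (?b + a) = 2 * c * sin ?b - sin (?b - a)"
        "sin (?b + 2 * a) = 2 * c * sin (?b + a) - sin ?b"
        "sin (?b + 3 * a) = 2 * c * sin (?b + 2 * a) - sin (?b + a)"
        using sin_shift[of ?b a] sin_shift[of "?b + a" a] sin_shift[of "?b + 2 * a" a]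
        unfolding c_def by metis+
    qed
    have e: "2 * real (Suc k) * a = ?b + 2 * a" "?b + 2 * a - a = ?b + a"
      "?b + 2 * a + a = ?b + 3 * a"
      by (simp_all add: algebra_simps)
    have ih: "sin a * pairing ?u s = - (p * sin (?b - a) + q * sin ?b)"
      "sin a * pairing ?u t = q * sin (?b + a) + p * sin ?b"
      using Suc by auto
    have "sin a * pairing (?f ?u) s = - (sin a * pairing ?u s) - 2 * c * (sin a * pairing ?u t)"
      by (simp add: ps' algebra_simps)
    also have "\<dots> = - (p * sin (?b + a) + q * sin (?b + 2 * a))"
      unfolding ih sh by (simp add: algebra_simps)
    finally have 1: "sin a * pairing (?f ?u) s = - (p * sin (?b + a) + q * sin (?b + 2 * a))" .
    have "sin a * pairing (?f ?u) t = - (sin a * pairing ?u t) - 2 * c * (sin a * pairing (?f ?u) s)"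
      by (simp add: pt' ps' algebra_simps)
    also have "\<dots> = q * sin (?b + 3 * a) + p * sin (?b + 2 * a)"
      unfolding 1 ih sh by (simp add: algebra_simps)
    finally show ?case using 1 unfolding e by (simp only: funpow.simps o_apply simp_thms)
  qed
  have "2 * real n * a = 2 * pi" using na by simp
  then have "sin a * pairing ((?f ^^ n) v) s = sin a * p" "sin a * pairing ((?f ^^ n) v) t = sin a * q"
    using closed[of n] unfolding \<open>2 * real n * a = 2 * pi\<close> by (simp_all add: sin_diff sin_add)
  then have pn: "pairing ((?f ^^ n) v) s = p" "pairing ((?f ^^ n) v) t = q"
    using sa by simp_all
  \<comment> \<open>The coordinates at \<open>s\<close> and \<open>t\<close> of the component
    orthogonal to both simple roots, scaled by the Gram determinant \<open>1 - c\<^sup>2\<close>,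
    which is the square of \<open>sin a\<close>.\<close>
  have inv: "(sin a)\<^sup>2 * (?f ^^ k) v s - (pairing ((?f ^^ k) v) s + c * pairing ((?f ^^ k) v) t) =
        (sin a)\<^sup>2 * v s - (p + c * q) \<and>
      (sin a)\<^sup>2 * (?f ^^ k) v t - (pairing ((?f ^^ k) v) t + c * pairing ((?f ^^ k) v) s) =
        (sin a)\<^sup>2 * v t - (q + c * p)" for k
  proof (induction k)
    case 0
    then show ?case by (simp add: p_def q_def)
  next
    case (Suc k)
    let ?u = "(?f ^^ k) v"
    have "(sin a)\<^sup>2 * ?f ?u s - (pairing (?f ?u) s + c * pairing (?f ?u) t) =
        (sin a)\<^sup>2 * ?u s - (pairing ?u s + c * pairing ?u t)"
      unfolding c2[symmetric] fs ps' pt' by (simp add: algebra_simps power2_eq_square)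
    moreover have "(sin a)\<^sup>2 * ?f ?u t - (pairing (?f ?u) t + c * pairing (?f ?u) s) =
        (sin a)\<^sup>2 * ?u t - (pairing ?u t + c * pairing ?u s)"
      unfolding c2[symmetric] ft ps' pt' by (simp add: algebra_simps power2_eq_square)
    ultimately show ?case using Suc by simp
  qed
  have "(?f ^^ n) v x = v x" for x
  proof -
    have "(?f ^^ k) v x = v x" if "x \<noteq> s" "x \<noteq> t" for k
      using that by (induction k) (simp_all add: fx)
    moreover have "(?f ^^ n) v s = v s" "(?f ^^ n) v t = v t"
      using inv[of n] sa by (auto simp: pn)
    ultimately show ?thesis by metis
  qed
  then show ?thesis by (simp add: n_def fun_eq_iff)
qed

lemma act_relator:
  assumes "s \<in> S" "t \<in> S" shows "act (concat (replicate (m s t) [s, t])) v = v"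
proof -
  have "act (concat (replicate k [s, t])) v = ((\<lambda>v. rho s (rho t v)) ^^ k) v" for k
    by (induction k) simp_all
  then show ?thesis using rho_relator[OF assms] by simp
qed

lemma act_eq:
  assumes "us \<in> lists S" "vs \<in> lists S" "prod_list us = prod_list vs" shows "act us = act vs"
  using presentation[OF assms]
proof (induction rule: equivclp_induct)
  case (step y z)
  have "act us = act vs" if "delete_relator S m us vs" for us vs
    using that by cases (auto simp: act_append act_relator fun_eq_iff)
  then show ?case using step by metis
qed simp

text \<open>Some word is chosen here; by \<open>act_eq\<close> every word for \<open>w\<close> gives
  the same map.\<close>

definition gact :: "'g \<Rightarrow> ('g \<Rightarrow> real) \<Rightarrow> 'g \<Rightarrow> real" where
  "gact w = act (SOME ws. ws \<in> lists S \<and> prod_list ws = w)"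

lemma gact_word: assumes "ws \<in> lists S" shows "gact (prod_list ws) = act ws"
proof -
  let ?P = "\<lambda>us. us \<in> lists S \<and> prod_list us = prod_list ws"
  have "?P (SOME us. ?P us)" by (rule someI[of ?P ws]) (simp add: assms)
  then show ?thesis unfolding gact_def using act_eq assms by blast
qed

lemma gact_mult: assumes "x \<in> par S" "y \<in> par S" shows "gact (x * y) v = gact x (gact y v)"
proof -
  obtain us where us: "us \<in> lists S" "x = prod_list us" using assms(1) by (rule parE)
  obtain vs where vs: "vs \<in> lists S" "y = prod_list vs" using assms(2) by (rule parE)
  have "us @ vs \<in> lists S" using us vs by simp
  from gact_word[OF this] show ?thesis
    using us vs by (simp add: gact_word act_append)
qed

lemma gact_one: "gact 1 v = v"
  using gact_word[of "[]"] by simp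

lemma gact_S: "s \<in> S \<Longrightarrow> gact s v = rho s v"
  using gact_word[of "[s]"] by simp

lemma gact_lincomb:
  "x \<in> par S \<Longrightarrow> gact x (\<lambda>y. a * u y + b * v y) = (\<lambda>y. a * gact x u y + b * gact x v y)"
  by (elim parE) (simp only: gact_word act_lincomb)

lemma gact_sum:
  "x \<in> par S \<Longrightarrow> finite A \<Longrightarrow>
    gact x (\<lambda>y. \<Sum>i\<in>A. f i * u i y) = (\<lambda>y. \<Sum>i\<in>A. f i * gact x (u i) y)"
  by (elim parE) (simp only: gact_word act_sum)

lemma gact_uminus: "x \<in> par S \<Longrightarrow> gact x (\<lambda>y. - v y) = (\<lambda>y. - gact x v y)"
  by (elim parE) (simp only: gact_word act_uminus)

lemma pairing_sroot: "s \<in> S \<Longrightarrow> pairing (sroot s) t = - cos (pi / real (m s t))"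
proof -
  assume s: "s \<in> S"
  have "pairing (sroot s) t = (\<Sum>r\<in>S. if r = s then - cos (pi / real (m s t)) else 0)"
    unfolding pairing_def sroot_def by (rule sum.cong) auto
  then show ?thesis using s finite_S by simp
qed

lemma rho_sroot_self: "s \<in> S \<Longrightarrow> rho s (sroot s) = (\<lambda>x. - sroot s x)"
  by (simp add: rho_def pairing_sroot m_diag) (auto simp: sroot_def)

section \<open>Dihedral subgroups and positivity of roots\<close>

fun alt_word :: "nat \<Rightarrow> 'g \<Rightarrow> 'g \<Rightarrow> 'g list" where
  "alt_word 0 a b = []"
| "alt_word (Suc k) a b = alt_word k b a @ [a]"

lemma alternating_reduced:
  "reduced ws \<Longrightarrow> set ws \<subseteq> {a, b} \<Longrightarrow> ws \<noteq> [] \<Longrightarrow> last ws = a \<Longrightarrow> ws = alt_word (length ws) a b"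
proof (induction ws arbitrary: a b rule: rev_induct)
  case (snoc x xs)
  show ?case
  proof (cases "xs = []")
    case False
    then obtain ys y where xs: "xs = ys @ [y]" by (metis rev_exhaust)
    have lists: "xs \<in> lists S" "x \<in> S" using snoc by (auto simp: reduced_def)
    have red: "reduced xs"
    proof -
      have "len (prod_list (xs @ [x])) \<le> len (prod_list xs) + 1"
        using len_mult_S[of "prod_list xs" x] lists by (simp add: par_def) arith
      then show ?thesis using snoc.prems lists len_le[of xs] by (simp add: reduced_def)
    qed
    have "x \<noteq> y"
    proof
      assume "x = y"
      then have "prod_list (xs @ [x]) = prod_list ys" using xs lists by (simp add: mult.assoc invs)
      then have "len (prod_list (xs @ [x])) \<le> length ys" using len_le[of ys] lists xs by simp
      then show False using snoc.prems xs by (simp add: reduced_def)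
    qed
    moreover have "x = a" using snoc.prems by simp
    moreover have "y \<in> {a, b}" using snoc.prems xs by simp
    ultimately have "xs = alt_word (length xs) b a"
      using snoc.IH[OF red, of b a] snoc.prems xs by auto
    then show ?thesis using \<open>x = a\<close> by simp
  qed (use snoc in simp)
qed simp

lemma word_refls_alt_word:
  assumes "a \<in> S" "b \<in> S"
  shows "word_refls (alt_word n a b) = map (\<lambda>i. (a * b) ^ i * a) (rev [0..<n])"
  using assms
proof (induction n arbitrary: a b)
  case (Suc n)
  have "a * ((b * a) ^ i * b) * a = (a * b) ^ Suc i * a" for i
    using mult_power_swap[of a b i] by (simp only: mult.assoc[symmetric] power_Suc2)
  then have "map (\<lambda>r. inverse a * r * a) (word_refls (alt_word n b a)) =
      map (\<lambda>i. (a * b) ^ i * a) (rev (map Suc [0..<n]))"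
    using Suc by (simp add: rev_map inv_S o_def del: map_Suc_upt)
  then show ?case
    by (simp add: word_refls_append inv_one upt_conv_Cons[of 0 "Suc n"] map_Suc_upt del: upt_Suc)
qed simp

text \<open>The reflections \<open>(a * b) ^ i * a\<close> of a reduced word are distinct for
  \<open>i < n\<close>, but those for \<open>0\<close> and \<open>m a b\<close> coincide.\<close>

lemma reduced_alt_word_le:
  assumes "a \<in> S" "b \<in> S" "reduced (alt_word n a b)" shows "n \<le> m a b"
proof (rule ccontr)
  assume "\<not> n \<le> m a b"
  then have n: "m a b < n" by simp
  let ?f = "\<lambda>i. (a * b) ^ i * a"
  have "distinct (map ?f (rev [0..<n]))"
    using reduced_distinct_refls[OF assms(3)] word_refls_alt_word[OF assms(1,2)] by simp
  then have "inj_on ?f {0..<n}" by (simp add: distinct_map)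
  moreover have "?f 0 = ?f (m a b)" using relator assms by simp
  ultimately have "0 = m a b" by (rule inj_onD) (use n in auto)
  then show False using m_pos[OF assms(1,2)] by simp
qed

text \<open>The roots of the dihedral subsystem scaled by \<open>sin t\<close>, for
  \<open>t = pi / m a b\<close>. Applying \<open>rho a\<close> raises the index \<open>j\<close> by
  one and swaps \<open>a\<close> and \<open>b\<close>.\<close>

definition rank2_vec :: "real \<Rightarrow> nat \<Rightarrow> 'g \<Rightarrow> 'g \<Rightarrow> 'g \<Rightarrow> real" where
  "rank2_vec t j a b = (\<lambda>x. sin (real j * t) * sroot a x + sin (real (Suc j) * t) * sroot b x)"

lemma act_alt_word:
  assumes "a \<in> S" "b \<in> S" "a \<noteq> b"
  shows "act (alt_word k a b) (rank2_vec (pi / real (m a b)) j a b) \<in>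
    {rank2_vec (pi / real (m a b)) (j + k) a b, rank2_vec (pi / real (m a b)) (j + k) b a}"
  using assms
proof (induction k arbitrary: a b j)
  case (Suc k)
  define t where "t = pi / real (m a b)"
  have t: "pi / real (m b a) = t" using Suc.prems by (simp add: t_def m_sym)
  have lin: "rho a (\<lambda>x. c * u x + d * v x) = (\<lambda>x. c * rho a u x + d * rho a v x)" for c d u v
    using act_lincomb[of "[a]"] by simp
  have rb: "rho a (sroot b) = (\<lambda>x. sroot b x + 2 * cos t * sroot a x)"
    using Suc.prems by (simp add: rho_def pairing_sroot t) (auto simp: sroot_def)
  have C: "sin (real (Suc (Suc j)) * t) = 2 * cos t * sin (real (Suc j) * t) - sin (real j * t)"
  proof -
    have "real (Suc (Suc j)) * t = real (Suc j) * t + t" "real (Suc j) * t - t = real j * t"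
      by (simp_all add: algebra_simps)
    then show ?thesis using sin_shift[of "real (Suc j) * t" t] by metis
  qed
  have "rho a (rank2_vec t j a b) = rank2_vec t (Suc j) b a"
    unfolding rank2_vec_def lin rb rho_sroot_self[OF Suc.prems(1)] C
    by (simp add: fun_eq_iff algebra_simps del: of_nat_Suc)
  then show ?case
    using Suc.IH[of b a "Suc j"] Suc.prems by (auto simp: act_append t_def[symmetric] t)
qed simp

text \<open>With a simple inversion \<open>t\<close> of \<open>w\<close>, write
  \<open>w = a * z\<close> with \<open>z\<close> in the dihedral subgroup of \<open>s\<close>,
  \<open>t\<close> and \<open>a\<close> minimal in its coset. The image of the root of
  \<open>s\<close> under \<open>z\<close> is a nonnegative combination of the two simple roots, and
  \<open>a\<close>, being shorter than \<open>w\<close>, keeps both of them nonnegative by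
  induction.\<close>

theorem root_nonneg:
  assumes "w \<in> par S" "s \<in> S" "s \<notin> N w" shows "gact w (sroot s) x \<ge> 0"
  using assms
proof (induction "len w" arbitrary: w s x rule: less_induct)
  case less
  show ?case
  proof (cases "w = 1")
    case True
    then show ?thesis by (simp add: gact_one sroot_def)
  next
    case False
    then have "inverse w \<noteq> 1" using inv_inv[of w] inv_one by force
    then obtain t where t: "t \<in> ldesc (inverse w)" using ex_ldesc less.prems par_inv[of S w] by blast
    then have tS: "t \<in> S" and tN: "t \<in> N w"
      using less.prems par_inv[of S w] by (auto simp: ldesc_inverse inv_inv)
    have st: "s \<noteq> t" using tN less.prems by auto
    have I: "{s, t} \<subseteq> S" using less.prems tS by simp
    obtain a z where az: "w = a * z" "a \<in> par S" "z \<in> par {s, t}"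
      "\<And>y. y \<in> par {s, t} \<Longrightarrow> len (a * y) = len a + len y"
      using coset_min[OF I less.prems(1)] by metis
    have zS: "z \<in> par S" using az par_subset_S[OF I] by blast
    have gens: "s \<in> par {s, t}" "t \<in> par {s, t}" by auto
    have "len (a * s) = len a + 1" "len (a * t) = len a + 1"
      using az(4) gens len_S less.prems tS by auto
    then have sa: "s \<notin> N a" "t \<notin> N a" by (auto simp: N_def)
    have "z \<noteq> 1" using tN sa(2) az(1) by auto
    then have "len a < len w" using az(1) az(4)[OF az(3)] len_eq_0[OF zS] by simp
    then have pos: "gact a (sroot s) x \<ge> 0" "gact a (sroot t) x \<ge> 0" for x
      using less.hyps[OF _ az(2)] sa less.prems tS by auto
    have "len (a * (z * s)) > len (a * z)"
      using less.prems az(1) not_N_iff[of s w] by (simp add: S_T mult.assoc)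
    then have "len (z * s) > len z"
      using az(4)[OF az(3)] az(4)[OF par_mult[OF az(3) gens(1)]] by simp
    then have zs: "s \<notin> N z" by (simp add: N_def)
    obtain ws where ws: "reduced ws" "set ws \<subseteq> {s, t}" "prod_list ws = z"
      using ex_reduced_par[OF I az(3)] .
    have red: "reduced (ws @ [s])"
      using ws zs len_mult_S[OF zS, of s] less.prems by (simp add: reduced_def)
    then have "ws @ [s] = alt_word (Suc (length ws)) s t"
      using alternating_reduced[OF red, of s t] ws by auto
    \<comment> \<open>The bound on the length of the alternating word keeps the multiples of the
      angle within \<open>[0, pi]\<close>, where the sines are nonnegative.\<close>
    then have alt: "ws = alt_word (length ws) t s" "Suc (length ws) \<le> m t s"
      using reduced_alt_word_le[of s t "Suc (length ws)"] red less.prems tS m_sym[of s t] by auto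
    define \<theta> where "\<theta> = pi / real (m t s)"
    have n: "m t s > 1" using alt(2) \<open>z \<noteq> 1\<close> ws by (cases ws) auto
    have \<theta>: "0 < \<theta>" "\<theta> < pi" using n by (auto simp: \<theta>_def field_simps)
    have sin: "sin \<theta> > 0" using \<theta> by (rule sin_gt_zero)
    have nn: "sin (real j * \<theta>) \<ge> 0" if "j \<le> m t s" for j
    proof (rule sin_ge_zero)
      show "real j * \<theta> \<le> pi" using that n by (simp add: \<theta>_def field_simps)
    qed (use \<theta> in simp)
    have "sroot s = (\<lambda>x. (1 / sin \<theta>) * rank2_vec \<theta> 0 t s x + 0 * sroot s x)"
      using sin by (auto simp: rank2_vec_def fun_eq_iff)
    then have "act ws (sroot s) = (\<lambda>x. (1 / sin \<theta>) * act ws (rank2_vec \<theta> 0 t s) x)"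
      using act_lincomb[of ws "1 / sin \<theta>" "rank2_vec \<theta> 0 t s" 0 "sroot s"] by simp
    moreover have "act ws (rank2_vec \<theta> 0 t s) \<in>
        {rank2_vec \<theta> (length ws) t s, rank2_vec \<theta> (length ws) s t}"
      using act_alt_word[of t s "length ws" 0] alt(1) st less.prems tS by (simp add: \<theta>_def)
    ultimately obtain p q where pq: "p \<ge> 0" "q \<ge> 0"
      "act ws (sroot s) = (\<lambda>x. p * sroot s x + q * sroot t x)"
    proof -
      assume *: "\<And>p q. 0 \<le> p \<Longrightarrow> 0 \<le> q \<Longrightarrow> act ws (sroot s) = (\<lambda>x. p * sroot s x + q * sroot t x) \<Longrightarrow> thesis"
        and 1: "act ws (sroot s) = (\<lambda>x. (1 / sin \<theta>) * act ws (rank2_vec \<theta> 0 t s) x)"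
        and 2: "act ws (rank2_vec \<theta> 0 t s) \<in>
          {rank2_vec \<theta> (length ws) t s, rank2_vec \<theta> (length ws) s t}"
      let ?p = "sin (real (length ws) * \<theta>) / sin \<theta>" and ?q = "sin (real (Suc (length ws)) * \<theta>) / sin \<theta>"
      have "?p \<ge> 0" "?q \<ge> 0"
        using nn[of "length ws"] nn[of "Suc (length ws)"] alt(2) sin by (simp_all del: of_nat_Suc)
      moreover have "act ws (sroot s) = (\<lambda>x. ?q * sroot s x + ?p * sroot t x)"
        if "act ws (rank2_vec \<theta> 0 t s) = rank2_vec \<theta> (length ws) t s"
        unfolding 1 that unfolding rank2_vec_def by (simp add: fun_eq_iff add_divide_distrib)
      moreover have "act ws (sroot s) = (\<lambda>x. ?p * sroot s x + ?q * sroot t x)"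
        if "act ws (rank2_vec \<theta> 0 t s) = rank2_vec \<theta> (length ws) s t"
        unfolding 1 that unfolding rank2_vec_def by (simp add: fun_eq_iff add_divide_distrib)
      ultimately show thesis
        using 2 *[of ?p ?q] *[of ?q ?p] by blast
    qed
    have "gact z (sroot s) = act ws (sroot s)"
      using gact_word[of ws] ws by (auto simp: reduced_def)
    then have "gact w (sroot s) x = p * gact a (sroot s) x + q * gact a (sroot t) x"
      using az zS pq(3) by (simp add: gact_mult gact_lincomb)
    then show ?thesis using pos pq by simp
  qed
qed

section \<open>Vectors fixed by a Coxeter element\<close>

lemma ex_power_one: assumes "c \<in> par S" shows "\<exists>n>0. c ^ n = 1"
proof -
  have "c ^ k \<in> par S" for k using assms by (induction k) auto
  then have "finite (range (\<lambda>k. c ^ k))"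
    using finite_subset[OF _ finite_group] by blast
  then have "\<not> inj (\<lambda>k. c ^ k)"
    using finite_imageD infinite_UNIV_nat by blast
  then obtain i j where "i \<noteq> j" "c ^ i = c ^ j" by (auto simp: inj_def)
  then obtain i j where ij: "i < j" "c ^ i = c ^ j" by (metis nat_neq_iff)
  then have "c ^ i * c ^ (j - i) = c ^ i * 1"
    using power_add[of c i "j - i"] by simp
  then have "c ^ (j - i) = 1" by (simp only: left_cancel)
  then show ?thesis using ij by (intro exI[of _ "j - i"]) simp
qed

lemma gact_support:
  assumes "I \<subseteq> S" "w \<in> par I" "x \<notin> I" shows "gact w v x = v x"
proof -
  obtain ws where ws: "ws \<in> lists I" "w = prod_list ws" using assms(2) by (rule parE)
  have "act ws v x = v x"
    using ws(1) assms(3) by (induction ws) (auto simp: rho_def)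
  moreover have "ws \<in> lists S" using ws assms by auto
  ultimately show ?thesis by (simp add: ws gact_word)
qed

text \<open>Since \<open>act cs v = rho b v\<close>, the left side may differ from \<open>v\<close>
  only at coordinates in \<open>set cs\<close> and the right side only at \<open>b\<close>. As
  \<open>b\<close> is not in \<open>set cs\<close>, both equal \<open>v\<close>.\<close>

lemma act_distinct_fixed:
  assumes "act cs v = v" "distinct cs" "set cs \<subseteq> S" "a \<in> set cs" shows "rho a v = v"
  using assms
proof (induction cs)
  case (Cons b cs)
  let ?u = "act cs v"
  have "rho b (rho b ?u) = ?u" using Cons.prems by (intro rho_rho) simp
  then have u: "?u = rho b v" using Cons.prems(1) by simp
  have "act cs v x = v x" if "x \<notin> set cs" for x
    using that by (induction cs) (auto simp: rho_def)
  moreover have "rho b v x = v x" if "x \<noteq> b" for x using that by (simp add: rho_def)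
  ultimately have "?u = v" using Cons.prems u by (metis distinct.simps(2) ext)
  then show ?case using Cons u by auto
qed simp

text \<open>The longest element of \<open>par I\<close> makes every simple root of \<open>I\<close> negative.\<close>

lemma nonneg_fixed_zero:
  assumes "I \<subseteq> S" "\<And>i. i \<in> I \<Longrightarrow> rho i v = v" "\<And>x. v x \<ge> 0" "\<And>x. x \<notin> I \<Longrightarrow> v x = 0"
  shows "v x = 0"
proof -
  have finI: "finite I" using assms finite_S finite_subset by blast
  have "finite (par I)" using par_mono[OF assms(1)] finite_group finite_subset by blast
  then have "\<forall>y. y \<in> par I \<longrightarrow> len y < Suc (Max (len ` par I))"
    by (auto simp: less_Suc_eq_le)
  then have "\<exists>w. w \<in> par I \<and> (\<forall>y. y \<in> par I \<longrightarrow> len y \<le> len w)"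
    using ex_has_greatest_nat[of "\<lambda>y. y \<in> par I" 1 len] by blast
  then obtain w where w: "w \<in> par I" "\<And>y. y \<in> par I \<Longrightarrow> len y \<le> len w" by blast
  have wS: "w \<in> par S" using w par_subset_S assms by blast
  have neg: "gact w (sroot i) y \<le> 0" if i: "i \<in> I" for i y
  proof -
    have iS: "i \<in> S" using i assms by auto
    have "len (w * i) \<le> len w" using w(2)[of "w * i"] w(1) i by auto
    then have "i \<in> N w" using not_N_iff[of i w] iS wS S_T by force
    then have "i \<notin> N (w * i)" using N_mult_refl[OF S_T[OF iS] wS] by simp
    then have "gact (w * i) (sroot i) y \<ge> 0" using root_nonneg iS wS by simp
    also have "gact (w * i) (sroot i) y = - gact w (sroot i) y"
      using iS wS by (simp add: gact_mult gact_S rho_sroot_self gact_uminus)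
    finally show ?thesis by simp
  qed
  have fixed: "gact y v = v" if "y \<in> par I" for y
  proof -
    obtain ws where ws: "ws \<in> lists I" "y = prod_list ws" using \<open>y \<in> par I\<close> by (rule parE)
    have "act ws v = v" using ws(1) assms(2) by (induction ws) auto
    moreover have "ws \<in> lists S" using ws assms by auto
    ultimately show ?thesis by (simp add: ws gact_word)
  qed
  have "v = (\<lambda>x. \<Sum>i\<in>I. v i * sroot i x)"
    using assms(4) finI by (auto simp: fun_eq_iff sroot_def if_distrib cong: if_cong)
  then have gw: "gact w v = (\<lambda>x. \<Sum>i\<in>I. v i * gact w (sroot i) x)"
    using gact_sum[OF wS finI, of v sroot] by simp
  have "(\<Sum>i\<in>I. v i * gact w (sroot i) x) \<le> 0"
    using neg assms(3) by (intro sum_nonpos mult_nonneg_nonpos) auto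
  then show ?thesis
    using fun_cong[OF gw, of x] fun_cong[OF fixed[OF w(1)], of x] assms(3)[of x] by linarith
qed

lemma no_positive_orbit:
  assumes I: "I \<subseteq> S" and cs: "distinct cs" "set cs = I" and w: "w \<in> par I" "s \<in> I"
    and pos: "\<And>k. s \<notin> N (prod_list cs ^ k * w)"
  shows False
proof -
  define c where "c = prod_list cs"
  have c: "c \<in> par I" "c \<in> par S"
    unfolding c_def using I cs by (auto intro: prod_list_in_par)
  have cs': "cs \<in> lists S" using I cs by auto
  have sS: "s \<in> S" and wS: "w \<in> par S" using I w par_subset_S by auto
  have ck: "c ^ k \<in> par I" "c ^ k \<in> par S" for k using c by (induction k) auto
  define r where "r k = gact (c ^ k * w) (sroot s)" for k
  have r_nonneg: "r k x \<ge> 0" for k x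
    unfolding r_def using root_nonneg pos ck wS sS by (simp add: c_def)
  have r_Suc: "r (Suc k) = gact c (r k)" for k
    using c ck wS by (simp add: r_def gact_mult mult.assoc)
  obtain n where n: "n > 0" "c ^ n = 1" using ex_power_one c by blast
  define v where "v = (\<lambda>x. \<Sum>k<n. 1 * r k x)"
  have "gact c v = (\<lambda>x. \<Sum>k<n. 1 * r (Suc k) x)"
    unfolding v_def using gact_sum[OF c(2), of "{..<n}" "\<lambda>_. 1" r] by (simp add: r_Suc)
  also have "\<dots> = v"
  proof
    fix x
    have "(\<Sum>k<n. r (Suc k) x) + r 0 x = (\<Sum>k<n. r k x) + r n x"
      using sum.lessThan_Suc_shift[of "\<lambda>k. r k x" n] by simp
    moreover have "r n = r 0" using n by (simp add: r_def)
    ultimately show "(\<Sum>k<n. 1 * r (Suc k) x) = v x" by (simp add: v_def)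
  qed
  finally have "act cs v = v" using gact_word[OF cs'] by (simp add: c_def)
  then have fixed: "rho i v = v" if "i \<in> I" for i
    using act_distinct_fixed cs I that by blast
  have supp: "v x = 0" if "x \<notin> I" for x
    unfolding v_def
  proof (rule sum.neutral, safe)
    fix k
    have "c ^ k * w \<in> par I" using ck w by auto
    then show "1 * r k x = 0"
      using gact_support[OF I, of "c ^ k * w" x "sroot s"] that w(2) by (auto simp: r_def sroot_def)
  qed
  have "v x = 0" for x
    using nonneg_fixed_zero[OF I fixed _ supp] r_nonneg by (auto simp: v_def intro: sum_nonneg)
  then have "r 0 x = 0" for x
    using n r_nonneg sum_nonneg_eq_0_iff[of "{..<n}" "\<lambda>k. r k x"] by (auto simp: v_def)
  then have "gact w (sroot s) = (\<lambda>x. 0)" by (auto simp: r_def)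
  then have "gact (inverse w * w) (sroot s) = gact (inverse w) (\<lambda>x. 0)"
    using gact_mult[OF par_inv[OF order_refl wS] wS] by simp
  moreover have "gact (inverse w) (\<lambda>x. 0) = (\<lambda>x. 0)"
    using gact_sum[OF par_inv[OF order_refl wS], of "{}"] by simp
  ultimately have "sroot s s = 0" by (metis gact_one left_inv)
  then show False by (simp add: sroot_def)
qed

section \<open>Rotating a Coxeter word\<close>

text \<open>Carries the inner induction of \<open>ex_min\<close>: a step \<open>t\<close> of a chain
  is followed while the word is rotated and the chain is conjugated by its final letter, until
  \<open>t\<close> is that letter.\<close>

inductive hits :: "'g list \<Rightarrow> 'g \<Rightarrow> bool" where
  hits_last: "hits (cs @ [s]) s"
| hits_rotate: "hits (s # cs) (s * t * s) \<Longrightarrow> hits (cs @ [s]) t"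

text \<open>The condition \<open>s \<notin> N w\<close> says that the root \<open>w alpha_s\<close>
  of the reflection is positive. A simple reflection makes only its own root negative, so the root
  stays positive as long as no letter rotated past equals the current reflection.\<close>

lemma not_hits_rotate:
  assumes "\<not> hits (as @ bs) (w * s * inverse w)" "set bs \<subseteq> S" "w \<in> par S" "s \<in> S" "s \<notin> N w"
  shows "\<not> hits (bs @ as) ((prod_list bs * w) * s * inverse (prod_list bs * w)) \<and>
    s \<notin> N (prod_list bs * w)"
  using assms
proof (induction bs arbitrary: as w rule: rev_induct)
  case (snoc x bs)
  let ?t = "w * s * inverse w"
  have x: "x \<in> S" using snoc by simp
  have "?t \<noteq> x" "\<not> hits (x # as @ bs) (x * ?t * x)"
    using snoc.prems(1) hits_last[of "as @ bs" x] hits_rotate[of x "as @ bs" ?t] by auto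
  moreover from this have "s \<notin> N (x * w)"
    using N_S_mult[of s w x] snoc.prems x by (simp add: S_T)
  moreover have "x * ?t * x = (x * w) * s * inverse (x * w)"
    using x by (simp add: inv_mult inv_S mult.assoc)
  ultimately show ?case
    using snoc.IH[of "x # as" "x * w"] snoc.prems x by (simp add: mult.assoc)
qed simp

theorem hits_all:
  assumes "I \<subseteq> S" "distinct cs" "set cs = I" "t \<in> T" "t \<in> par I" shows "hits cs t"
proof (rule ccontr)
  assume nh: "\<not> hits cs t"
  obtain ts where ts: "ts \<in> lists I" "t = prod_list ts" using assms(5) by (rule parE)
  have tsS: "ts \<in> lists S" using ts assms by auto
  have "word_parity ts t" using word_parity_self[OF assms(4) tsS] ts by simp
  then have "t \<in> set (word_refls ts)" unfolding word_parity_def by (metis count_notin even_zero)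
  then obtain as s bs where *: "ts = as @ s # bs" "t = inverse (prod_list bs) * s * prod_list bs"
    using word_refls_delete[of t ts] invol tsS by (metis in_lists_conv_set)
  define w where "w = inverse (prod_list bs)"
  have s: "s \<in> I" "s \<in> S" using * ts assms by auto
  have w: "w \<in> par I" "t = w * s * inverse w"
    using * ts assms(1) by (auto simp: w_def inv_inv intro!: par_inv prod_list_in_par)
  have wS: "w \<in> par S" using w par_subset_S assms by blast
  \<comment> \<open>Of the two opposite roots of \<open>t\<close> the positive one is chosen:
    replacing \<open>w\<close> by \<open>w * s\<close> changes the sign.\<close>
  have "\<exists>w\<in>par I. t = w * s * inverse w \<and> s \<notin> N w"
  proof (cases "s \<in> N w")
    case True
    then have "s \<notin> N (w * s)" using N_mult_refl[OF S_T[OF s(2)] wS] by simp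
    moreover have "t = (w * s) * s * inverse (w * s)"
      using w s by (simp add: inv_mult inv_S invol_left mult.assoc)
    ultimately show ?thesis using w s by (intro bexI[of _ "w * s"]) auto
  qed (use w in blast)
  then obtain w where w: "w \<in> par I" "t = w * s * inverse w" "s \<notin> N w" by blast
  have "\<not> hits cs ((prod_list cs ^ k * w) * s * inverse (prod_list cs ^ k * w)) \<and>
      s \<notin> N (prod_list cs ^ k * w)" for k
  proof (induction k)
    case 0
    then show ?case using nh w by simp
  next
    case (Suc k)
    have "prod_list cs ^ k * w \<in> par S"
    proof -
      have "prod_list cs \<in> par S" using assms by (auto intro: prod_list_in_par)
      then have "prod_list cs ^ k \<in> par S" by (induction k) auto
      then show ?thesis using w par_subset_S assms by auto
    qed
    then show ?case
      using not_hits_rotate[of "[]" cs "prod_list cs ^ k * w" s] Suc assms s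
      by (simp add: mult.assoc)
  qed
  then show False using no_positive_orbit[OF assms(1,2,3) w(1) s(1)] by blast
qed

section \<open>Concordance\<close>

text \<open>Only an inclusion into \<open>S\<close> is asked, because the recursion descends to
  standard parabolic subgroups. Lengths and inversion sets remain those of the ambient
  group.\<close>

definition coxeter_word :: "'g list \<Rightarrow> bool" where
  "coxeter_word cs \<longleftrightarrow> distinct cs \<and> set cs \<subseteq> S"

definition chain :: "'g list \<Rightarrow> 'g list \<Rightarrow> bool" where
  "chain cs ts \<longleftrightarrow> set ts \<subseteq> T \<and> length ts = length cs \<and> prod_list ts = prod_list cs"

definition conc :: "'g list \<Rightarrow> 'g list \<Rightarrow> 'g set" where
  "conc cs ts = {u \<in> par (set cs). ups u ts}"

text \<open>Left weak order, as additivity of lengths in \<open>v = (v * inverse u) * u\<close>;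
  \<open>left_weak_reg\<close> relates it to suffixes of reduced words.\<close>

definition wle :: "'g \<Rightarrow> 'g \<Rightarrow> bool" where
  "wle u v \<longleftrightarrow> len v = len (v * inverse u) + len u"

definition is_min :: "'g list \<Rightarrow> 'g list \<Rightarrow> 'g \<Rightarrow> bool" where
  "is_min cs ts u \<longleftrightarrow> u \<in> conc cs ts \<and> (\<forall>v\<in>conc cs ts. wle u v)"

lemma par_inv_S [simp]: "x \<in> par S \<Longrightarrow> inverse x \<in> par S"
  by (rule par_inv[OF order_refl])

lemma wle_trans:
  assumes "u \<in> par S" "v \<in> par S" "w \<in> par S" "wle u v" "wle v w" shows "wle u w"
proof -
  have "w * inverse u = (w * inverse v) * (v * inverse u)" by (simp add: grp)
  then have "len (w * inverse u) \<le> len (w * inverse v) + len (v * inverse u)"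
    using len_mult_le[of "w * inverse v" "v * inverse u"] assms by simp
  moreover have "len w \<le> len (w * inverse u) + len u"
    using len_mult_le[of "w * inverse u" u] assms by (simp add: mult.assoc left_inv)
  ultimately show ?thesis using assms(4,5) by (simp add: wle_def)
qed

lemma wle_antisym:
  assumes "u \<in> par S" "v \<in> par S" "wle u v" "wle v u" shows "u = v"
proof -
  have "len (v * inverse u) = 0" using assms(3,4) by (simp add: wle_def)
  then have "v * inverse u = 1" using len_eq_0[of "v * inverse u"] assms by simp
  then have "v * inverse u * u = u" by simp
  then show ?thesis by (simp add: mult.assoc left_inv)
qed

lemma conc_par: "coxeter_word cs \<Longrightarrow> u \<in> conc cs ts \<Longrightarrow> u \<in> par S"
  using par_subset_S by (auto simp: coxeter_word_def conc_def)

lemma is_min_unique: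
  "coxeter_word cs \<Longrightarrow> is_min cs ts u \<Longrightarrow> is_min cs ts v \<Longrightarrow> u = v"
  unfolding is_min_def using wle_antisym conc_par by blast

lemma chain_tmin: "coxeter_word cs \<Longrightarrow> chain cs ts \<Longrightarrow> tmin ts"
  using distinct_word_tmin[of cs ts] by (simp add: coxeter_word_def chain_def)

lemma chain_par: "coxeter_word cs \<Longrightarrow> chain cs ts \<Longrightarrow> set ts \<subseteq> par (set cs)"
  using tmin_par[of "set cs" ts] chain_tmin[of cs ts]
  by (simp add: coxeter_word_def chain_def prod_list_in_par)

lemma coxeter_word_par: "coxeter_word cs \<Longrightarrow> prod_list cs \<in> par S"
  by (simp add: coxeter_word_def prod_list_in_par)

lemma chain_len:
  assumes "coxeter_word cs" "chain cs ts" "u \<in> par S" "ups u ts"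
  shows "len (u * prod_list cs) = len u + length cs"
proof (rule antisym)
  show "len (u * prod_list cs) \<le> len u + length cs"
    using len_mult_le[OF assms(3) coxeter_word_par[OF assms(1)]] len_le[of cs] assms(1)
    by (fastforce simp: coxeter_word_def)
  show "len u + length cs \<le> len (u * prod_list cs)"
    using ups_len[of u ts] assms by (simp add: chain_def)
qed

text \<open>Every step raises the length by at least one, and the total rise is the number of steps.
  This is how ascents become Bruhat covers.\<close>

lemma ups_exact:
  assumes "u \<in> par S" "set (as @ t # bs) \<subseteq> T" "ups u (as @ t # bs)"
    "len (u * prod_list (as @ t # bs)) = len u + length (as @ t # bs)"
  shows "len (u * prod_list as * t) = len (u * prod_list as) + 1"
proof -
  let ?x = "u * prod_list as"
  have x: "?x \<in> par S" "?x * t \<in> par S" using assms prod_refls_par[of as] by auto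
  have "len u + length as \<le> len ?x" using ups_len[of u as] assms by (simp add: ups_append)
  moreover have "len ?x < len (?x * t)"
    using assms x by (simp add: ups_append not_N_iff)
  moreover have "len (?x * t) + length bs \<le> len (?x * t * prod_list bs)"
    using ups_len[of "?x * t" bs] assms x by (simp add: ups_append)
  ultimately show ?thesis using assms(4) by (simp add: mult.assoc)
qed

section \<open>Rotating a chain by the final letter\<close>

lemma conj_S_conj_S: "s \<in> S \<Longrightarrow> s * (s * t * s) * s = t"
  by (simp add: mult.assoc invs)

lemma conj_S_eq_S: "s \<in> S \<Longrightarrow> s * t * s = s \<longleftrightarrow> t = s"
  using conj_S_conj_S[of s t] invol[of s] by auto

lemma map_conj_conj: "s \<in> S \<Longrightarrow> map (\<lambda>t. s * t * s) (map (\<lambda>t. s * t * s) ts) = ts"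
  by (induction ts) (simp_all add: conj_S_conj_S)

lemma prod_map_conj: "s \<in> S \<Longrightarrow> prod_list (map (\<lambda>t. s * t * s) ts) = s * prod_list ts * s"
  by (induction ts) (simp_all add: mult.assoc invs)

lemma map_conj_T: "s \<in> S \<Longrightarrow> set ts \<subseteq> T \<Longrightarrow> set (map (\<lambda>t. s * t * s) ts) \<subseteq> T"
  using conj_S_T by auto

lemma notin_map_conj: "s \<in> S \<Longrightarrow> s \<in> set (map (\<lambda>t. s * t * s) ts) \<longleftrightarrow> s \<in> set ts"
  by (induction ts) (auto simp: conj_S_eq_S eq_commute[of s])

text \<open>Right multiplication by \<open>s\<close> conjugates the membership of every reflection
  other than \<open>s\<close> in the inversion set, so a path that avoids the step \<open>s\<close>
  keeps all its directions.\<close>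

lemma ups_conj:
  assumes "s \<in> S"
  shows "x \<in> par S \<Longrightarrow> set ts \<subseteq> T \<Longrightarrow> s \<notin> set ts \<Longrightarrow>
    ups (x * s) (map (\<lambda>t. s * t * s) ts) \<longleftrightarrow> ups x ts"
proof (induction ts arbitrary: x)
  case (Cons t ts)
  have "s * t * s \<in> N (x * s) \<longleftrightarrow> t \<in> N x"
    using N_mult_S[of "s * t * s" x s] Cons.prems assms
    by (auto simp: conj_S_T conj_S_eq_S conj_S_conj_S)
  moreover have "x * s * (s * t * s) = (x * t) * s"
    using assms by (simp add: mult.assoc invs)
  ultimately show ?case using Cons by simp
qed simp

lemma rotate_chain:
  assumes "coxeter_word (cs @ [s])" "chain (cs @ [s]) ts"
  shows "chain (s # cs) (map (\<lambda>t. s * t * s) ts)" "coxeter_word (s # cs)"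
  using assms map_conj_T[of s ts] prod_map_conj[of s ts]
  by (auto simp: coxeter_word_def chain_def mult.assoc invs)

lemma rotate_chain_back:
  assumes "coxeter_word (s # cs)" "chain (s # cs) ts"
  shows "chain (cs @ [s]) (map (\<lambda>t. s * t * s) ts)"
  using assms map_conj_T[of s ts] prod_map_conj[of s ts]
  by (auto simp: coxeter_word_def chain_def mult.assoc invs)

text \<open>The correspondence is \<open>ups_conj\<close>. That \<open>s\<close> is a descent of
  \<open>u\<close> is a count: the rotated chain leads from \<open>u * s\<close> to
  \<open>u * prod_list cs\<close> and rises by \<open>length cs + 1\<close>, while the end point has
  length at most \<open>len u + length cs\<close>.\<close>

lemma rotate_conc:
  assumes cs: "coxeter_word (cs @ [s])" "chain (cs @ [s]) ts" and s: "s \<notin> set ts"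
  shows "u * s \<in> conc (s # cs) (map (\<lambda>t. s * t * s) ts) \<longleftrightarrow> u \<in> conc (cs @ [s]) ts"
    and "u \<in> conc (cs @ [s]) ts \<Longrightarrow> len u = len (u * s) + 1"
proof -
  have sS: "s \<in> S" and sub: "set (s # cs) \<subseteq> S" using cs by (auto simp: coxeter_word_def)
  have T: "set ts \<subseteq> T" using cs by (simp add: chain_def)
  have "s \<in> par (set (s # cs))" by auto
  then have "u * s \<in> par (set (s # cs)) \<longleftrightarrow> u \<in> par (set (s # cs))" for u
    using par_cancel_right[OF sub] by blast
  then show iff: "u * s \<in> conc (s # cs) (map (\<lambda>t. s * t * s) ts) \<longleftrightarrow> u \<in> conc (cs @ [s]) ts" for u
    using ups_conj[OF sS _ T s, of u] par_subset_S[OF sub, of u] by (auto simp: conc_def)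
  assume u: "u \<in> conc (cs @ [s]) ts"
  have uS: "u \<in> par S" using conc_par cs u by blast
  note rot = rotate_chain[OF cs]
  have "len (u * s * prod_list (s # cs)) = len (u * s) + length (s # cs)"
    using iff u uS sS by (intro chain_len[OF rot(2,1)]) (auto simp: conc_def)
  moreover have "u * s * prod_list (s # cs) = u * prod_list cs"
    using sS by (simp add: mult.assoc invs)
  moreover have "len (u * prod_list cs) \<le> len u + length cs"
  proof -
    have "cs \<in> lists S" using sub by auto
    then show ?thesis
      using len_mult_le[OF uS, of "prod_list cs"] len_le[of cs] by (fastforce simp: par_def)
  qed
  ultimately have less: "len (u * s) < len u" by simp
  then have "s \<in> N u" using S_T[OF sS] by (simp add: N_def)
  then have "len (u * s) = len u - 1" using len_mult_S[OF uS sS] by simp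
  with less show "len u = len (u * s) + 1" by linarith
qed

lemma rotate_min:
  assumes cs: "coxeter_word (cs @ [s])" "chain (cs @ [s]) ts" and s: "s \<notin> set ts"
  shows "is_min (s # cs) (map (\<lambda>t. s * t * s) ts) (u * s) \<longleftrightarrow> is_min (cs @ [s]) ts u"
proof -
  let ?C = "conc (cs @ [s]) ts" and ?C' = "conc (s # cs) (map (\<lambda>t. s * t * s) ts)"
  note conc = rotate_conc[OF cs s]
  have sS: "s \<in> S" using cs by (auto simp: coxeter_word_def)
  have "?C' = (\<lambda>v. v * s) ` ?C"
  proof (intro Set.set_eqI iffI)
    fix v assume "v \<in> ?C'"
    then have "v * s \<in> ?C" using conc(1)[of "v * s"] sS by (simp add: mult.assoc invs)
    then show "v \<in> (\<lambda>v. v * s) ` ?C" using sS by (intro image_eqI[of _ _ "v * s"]) (auto simp: mult.assoc invs)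
  qed (use conc(1) in auto)
  moreover have "wle (u * s) (v * s) \<longleftrightarrow> wle u v" if "u \<in> ?C" "v \<in> ?C" for u v
  proof -
    have "v * s * inverse (u * s) = v * inverse u" using sS by (simp add: grp invs)
    then show ?thesis using conc(2) that by (simp add: wle_def)
  qed
  ultimately show ?thesis using conc(1) by (auto simp: is_min_def)
qed

section \<open>Passing to a parabolic subgroup\<close>

lemma ups_coset:
  assumes "I \<subseteq> S" "a \<in> par S" "\<And>y. y \<in> par I \<Longrightarrow> len (a * y) = len a + len y"
  shows "z \<in> par I \<Longrightarrow> set ts \<subseteq> T \<inter> par I \<Longrightarrow> ups (a * z) ts \<longleftrightarrow> ups z ts"
proof (induction ts arbitrary: z)
  case (Cons t ts)
  then have "z * t \<in> par I" by auto
  moreover from this have "t \<in> N (a * z) \<longleftrightarrow> t \<in> N z"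
    using assms(3) Cons.prems by (simp add: N_def mult.assoc)
  ultimately show ?case using Cons by (simp add: mult.assoc)
qed simp

text \<open>Common core of contraction and of letter insertion. A \<open>v\<close> concordant with
  \<open>ts2\<close> is split as \<open>a * z\<close> with \<open>a\<close> minimal in its coset of
  the smaller parabolic subgroup. As \<open>a\<close> has no influence on the directions of
  \<open>ts\<close>, the factor \<open>z\<close> is concordant with \<open>ts\<close>, so
  \<open>u\<close> is below \<open>z\<close>, which is below \<open>v\<close>.\<close>

lemma min_of_parabolic:
  assumes cs: "coxeter_word cs" "chain cs ts" and cs2: "coxeter_word cs2" "set cs \<subseteq> set cs2"
    and imp: "\<And>u. u \<in> par (set cs2) \<Longrightarrow> ups u ts2 \<Longrightarrow> ups u ts"
      "\<And>z. z \<in> par (set cs) \<Longrightarrow> ups z ts \<Longrightarrow> ups z ts2"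
    and min: "is_min cs ts u"
  shows "is_min cs2 ts2 u"
  unfolding is_min_def
proof (intro conjI ballI)
  have uc: "u \<in> par (set cs)" "ups u ts" using min by (auto simp: is_min_def conc_def)
  then show "u \<in> conc cs2 ts2" using imp(2) par_mono[OF cs2(2)] by (auto simp: conc_def)
  fix v assume v: "v \<in> conc cs2 ts2"
  have sub: "set cs \<subseteq> S" using cs by (simp add: coxeter_word_def)
  have vS: "v \<in> par S" using v conc_par cs2 by blast
  obtain a z where az: "v = a * z" "a \<in> par S" "z \<in> par (set cs)"
    "\<And>y. y \<in> par (set cs) \<Longrightarrow> len (a * y) = len a + len y"
    using coset_min[OF sub vS] by metis
  have zS: "z \<in> par S" using az par_subset_S[OF sub] by blast
  have "ups v ts" using v imp(1) by (simp add: conc_def)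
  moreover have "set ts \<subseteq> T \<inter> par (set cs)" using chain_par[OF cs] cs by (simp add: chain_def)
  ultimately have "ups z ts"
    using ups_coset[OF sub az(2,4,3)] az(1) by simp
  then have "wle u z" using min az by (simp add: is_min_def conc_def)
  moreover have "wle z v" using az(4)[OF az(3)] by (simp add: wle_def az(1) mult.assoc right_inv)
  ultimately show "wle u v"
    using wle_trans[of u z v] uc par_subset_S[OF sub] zS vS by blast
qed

lemma contract_chain:
  assumes cs: "coxeter_word (cs @ [s])" "chain (cs @ [s]) (as @ s # bs)"
  shows "chain cs (as @ map (\<lambda>t. s * t * s) bs)" "coxeter_word cs"
proof -
  have sS: "s \<in> S" using cs by (auto simp: coxeter_word_def)
  then have "prod_list as * (s * prod_list bs) * s = prod_list cs"
    using cs by (simp add: chain_def mult.assoc invs)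
  then show "chain cs (as @ map (\<lambda>t. s * t * s) bs)"
    using cs map_conj_T[OF sS, of bs] unfolding chain_def prod_list.append prod_map_conj[OF sS]
    by (simp add: mult.assoc)
  show "coxeter_word cs" using cs by (simp add: coxeter_word_def)
qed

text \<open>Compared with the contracted chain, the step \<open>s\<close> adds one condition: it
  ascends from \<open>v * prod_list as\<close>. On elements of \<open>par (set cs)\<close> this is
  automatic, since \<open>s\<close> lies outside that subgroup and so is never an inversion
  there.\<close>

lemma contract_min:
  assumes cs: "coxeter_word (cs @ [s])" "chain (cs @ [s]) (as @ s # bs)"
    and min: "is_min cs (as @ map (\<lambda>t. s * t * s) bs) u"
  shows "is_min (cs @ [s]) (as @ s # bs) u"
proof -
  let ?bs = "map (\<lambda>t. s * t * s) bs"
  note con = contract_chain[OF cs]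
  have sS: "s \<in> S" and sub: "set cs \<subseteq> S" and s: "s \<notin> set cs" and sub': "set (cs @ [s]) \<subseteq> S"
    using cs by (auto simp: coxeter_word_def)
  have T: "set as \<subseteq> T" "set bs \<subseteq> T" using cs by (auto simp: chain_def)
  have par: "set (as @ ?bs) \<subseteq> par (set cs)" using chain_par[OF con(2,1)] .
  have "s \<notin> set ?bs" using par par_Int_S[OF sub sS] s by auto
  then have sbs: "s \<notin> set bs" using notin_map_conj[OF sS] by blast
  have key: "ups v (as @ s # bs) \<longleftrightarrow> ups v (as @ ?bs) \<and> s \<notin> N (v * prod_list as)"
    if "v \<in> par S" for v
  proof -
    have "v * prod_list as * s \<in> par S" using that T sS by (simp add: prod_refls_par)
    then have "ups (v * prod_list as * s * s) ?bs \<longleftrightarrow> ups (v * prod_list as * s) bs"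
      using ups_conj[OF sS _ T(2) sbs] by blast
    then show ?thesis using sS by (auto simp: ups_append mult.assoc invs)
  qed
  show ?thesis
  proof (rule min_of_parabolic[OF con(2,1) cs(1) _ _ _ min])
    fix v assume "v \<in> par (set (cs @ [s]))" "ups v (as @ s # bs)"
    then show "ups v (as @ ?bs)" using key par_subset_S[OF sub'] by blast
  next
    fix z assume z: "z \<in> par (set cs)" "ups z (as @ ?bs)"
    have "prod_list as \<in> par (set cs)" using par by (induction as) auto
    then have "z * prod_list as \<in> par (set cs)" using z by auto
    then have "s \<notin> N (z * prod_list as)" using notin_N_par[OF sub sS s] by blast
    then show "ups z (as @ s # bs)" using key z par_subset_S[OF sub] by blast
  qed auto
qed

text \<open>The reflection \<open>q\<close> is what the inserted letter becomes when moved to the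
  end of the word. It lies outside the parabolic subgroup of the old letters, so as a last step it
  ascends from every element of that subgroup.\<close>

lemma insert_letter_min:
  assumes cs: "coxeter_word (as @ s # bs)" "chain (as @ bs) ts" and min: "is_min (as @ bs) ts u"
  defines "q \<equiv> inverse (prod_list bs) * s * prod_list bs"
  shows "chain (as @ s # bs) (ts @ [q])" "is_min (as @ s # bs) (ts @ [q]) u"
proof -
  have sS: "s \<in> S" and s: "s \<notin> set (as @ bs)" and sub: "set (as @ bs) \<subseteq> S"
    using cs by (auto simp: coxeter_word_def)
  have cw: "coxeter_word (as @ bs)" using cs by (auto simp: coxeter_word_def)
  have b: "prod_list bs \<in> par (set (as @ bs))" by (rule prod_list_in_par) simp
  have qT: "q \<in> T" unfolding q_def using b par_subset_S[OF sub] sS by (intro conj_T' S_T)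
  have q: "q \<notin> par (set (as @ bs))"
  proof
    assume "q \<in> par (set (as @ bs))"
    then have "prod_list bs * q * inverse (prod_list bs) \<in> par (set (as @ bs))"
      using b par_inv[OF sub b] by auto
    moreover have "prod_list bs * q * inverse (prod_list bs) = s" by (simp add: q_def grp)
    ultimately show False using par_Int_S[OF sub sS] s by auto
  qed
  have "prod_list (as @ bs) * q = prod_list (as @ s # bs)"
    by (simp add: q_def grp)
  then show "chain (as @ s # bs) (ts @ [q])" using cs(2) qT by (simp add: chain_def)
  show "is_min (as @ s # bs) (ts @ [q]) u"
  proof (rule min_of_parabolic[OF cw cs(2) cs(1) _ _ _ min])
    fix z assume z: "z \<in> par (set (as @ bs))" "ups z ts"
    have "prod_list ts \<in> par (set (as @ bs))"
      using cs(2) by (simp add: chain_def) (simp flip: prod_list.append add: prod_list_in_par del: prod_list.append)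
    then have "q \<notin> N (z * prod_list ts)" using N_par[OF sub, of "z * prod_list ts"] z q by auto
    then show "ups z (ts @ [q])" using z by (simp add: ups_append)
  qed (auto simp: ups_append)
qed

text \<open>Contraction shortens the word and is covered by the outer induction. Rotation preserves
  the length, so an inner induction along \<open>hits\<close> follows one step of the chain until a
  final letter belongs to the chain.\<close>

theorem ex_min:
  assumes "coxeter_word cs" "chain cs ts" shows "\<exists>u. is_min cs ts u"
  using assms
proof (induction "length cs" arbitrary: cs ts rule: less_induct)
  case less
  note shorter = less.hyps
  show ?case
  proof (cases "cs = []")
    case True
    then have "is_min cs ts 1"
      using less.prems by (simp add: chain_def is_min_def conc_def wle_def inv_one)
    then show ?thesis ..
  next
    case False
    have contract: "\<exists>u. is_min (ds @ [s]) us u"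
      if "coxeter_word (ds @ [s])" "chain (ds @ [s]) us" "s \<in> set us"
        "length (ds @ [s]) = length cs" for ds s us
    proof -
      obtain as bs where us: "us = as @ s # bs" using split_list[OF \<open>s \<in> set us\<close>] by blast
      have "chain ds (as @ map (\<lambda>t. s * t * s) bs)" "coxeter_word ds"
        using contract_chain[of ds s as bs] that us by auto
      moreover have "length ds < length cs" using that(4) by simp
      ultimately obtain u where "is_min ds (as @ map (\<lambda>t. s * t * s) bs) u"
        using shorter by blast
      then show ?thesis using contract_min[of ds s as bs] that us by blast
    qed
    have "\<exists>u. is_min ds us u"
      if "hits ds t" "t \<in> set us" "coxeter_word ds" "chain ds us" "length ds = length cs" for ds us t
      using that
    proof (induction arbitrary: us rule: hits.induct)
      case (hits_last ds s)
      then show ?case using contract by blast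
    next
      case (hits_rotate s ds t)
      show ?case
      proof (cases "s \<in> set us")
        case True
        then show ?thesis using contract hits_rotate by blast
      next
        case False
        note rot = rotate_chain[OF hits_rotate.prems(2,3)]
        obtain u where "is_min (s # ds) (map (\<lambda>t. s * t * s) us) u"
          using hits_rotate.IH[of "map (\<lambda>t. s * t * s) us"] rot hits_rotate.prems by auto
        moreover have "s \<in> S" using rot by (simp add: coxeter_word_def)
        ultimately have "is_min (s # ds) (map (\<lambda>t. s * t * s) us) (u * s * s)"
          by (simp add: mult.assoc invol)
        then show ?thesis using rotate_min[OF hits_rotate.prems(2,3) False] by blast
      qed
    qed
    moreover obtain t where "t \<in> set ts"
      using False less.prems by (cases ts) (auto simp: chain_def)
    moreover have "hits cs t"
      using hits_all[of "set cs" cs t] less.prems chain_par[OF less.prems] \<open>t \<in> set ts\<close>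
      by (auto simp: coxeter_word_def chain_def)
    ultimately show ?thesis using less.prems by blast
  qed
qed

section \<open>Minimal concordant elements\<close>

text \<open>The steps of a chain, as seen from the left: \<open>x * t = r * x\<close> for the left step \<open>r\<close>.\<close>

fun lsteps :: "'g \<Rightarrow> 'g list \<Rightarrow> 'g list" where
  "lsteps x [] = []"
| "lsteps x (t # ts) = (x * t * inverse x) # lsteps (x * t) ts"

lemma lsteps_append: "lsteps x (us @ vs) = lsteps x us @ lsteps (x * prod_list us) vs"
  by (induction us arbitrary: x) (simp_all add: mult.assoc)

lemma lsteps_conj: "s \<in> S \<Longrightarrow> lsteps (x * s) (map (\<lambda>t. s * t * s) ts) = lsteps x ts"
proof (induction ts arbitrary: x)
  case (Cons t ts)
  then have "x * s * (s * t * s) = x * t * s"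
    "x * s * (s * t * s) * inverse (x * s) = x * t * inverse x"
    by (simp_all add: mult.assoc invs inv_mult)
  then show ?case using Cons by simp
qed simp

lemma lsteps_split:
  "r \<in> set (lsteps x ts) \<Longrightarrow>
    \<exists>as t bs. ts = as @ t # bs \<and> r = x * prod_list as * t * inverse (x * prod_list as)"
proof (induction ts arbitrary: x)
  case (Cons t ts)
  show ?case
  proof (cases "r = x * t * inverse x")
    case True
    then show ?thesis by (intro exI[of _ "[]"] exI) auto
  next
    case False
    then obtain as t' bs where "ts = as @ t' # bs"
      "r = x * t * prod_list as * t' * inverse (x * t * prod_list as)"
      using Cons.IH[of "x * t"] Cons.prems by auto
    then show ?thesis by (intro exI[of _ "t # as"] exI) (auto simp: mult.assoc)
  qed
qed simp

lemma ups_S_mult: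
  assumes "s \<in> S"
  shows "x \<in> par S \<Longrightarrow> set ts \<subseteq> T \<Longrightarrow> s \<notin> set (lsteps x ts) \<Longrightarrow> ups (s * x) ts \<longleftrightarrow> ups x ts"
proof (induction ts arbitrary: x)
  case (Cons t ts)
  then have "t \<in> N (s * x) \<longleftrightarrow> t \<in> N x" using N_S_mult[of t x s] assms by auto
  then show ?case using Cons by (simp add: mult.assoc)
qed simp

text \<open>Left multiplication by \<open>s\<close> reverses only steps whose left step is
  \<open>s\<close>. If there were none, \<open>s * u\<close> would be concordant too and lie below
  \<open>u\<close>.\<close>

lemma min_ldesc:
  assumes "coxeter_word cs" "chain cs ts" "is_min cs ts u"
  shows "ldesc u \<subseteq> set (lsteps u ts)"
proof
  fix s assume s: "s \<in> ldesc u"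
  have sub: "set cs \<subseteq> S" and sS: "s \<in> S" using assms s by (auto simp: coxeter_word_def ldesc_def)
  have u: "u \<in> par (set cs)" "ups u ts" using assms by (auto simp: is_min_def conc_def)
  have uS: "u \<in> par S" using u par_subset_S sub by blast
  show "s \<in> set (lsteps u ts)"
  proof (rule ccontr)
    assume "s \<notin> set (lsteps u ts)"
    then have "ups (s * u) ts" using ups_S_mult[OF sS uS] u assms by (simp add: chain_def)
    moreover have "s \<in> set cs" using notin_ldesc_par[OF sub sS _ u(1)] s by blast
    ultimately have "s * u \<in> conc cs ts" using u by (auto simp: conc_def)
    then have "wle u (s * u)" using assms by (simp add: is_min_def)
    then show False using s by (simp add: wle_def ldesc_def)
  qed
qed

text \<open>Otherwise let \<open>v\<close> be the true minimum and \<open>s\<close> a left descent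
  of \<open>u * inverse v\<close>, hence of \<open>u\<close>; then \<open>s\<close> is the left step
  of some step \<open>t\<close>. The reflection \<open>inverse u * s * u\<close> is an inversion of
  \<open>u\<close> but not of \<open>v\<close>, so by \<open>N_mult\<close> the step
  \<open>t\<close> has opposite directions on the two paths, although both paths ascend.\<close>

lemma min_criterion:
  assumes cs: "coxeter_word cs" "chain cs ts" and u: "u \<in> conc cs ts"
    and desc: "ldesc u \<subseteq> set (lsteps u ts)"
  shows "is_min cs ts u"
proof -
  obtain v where v: "is_min cs ts v" using ex_min[OF cs] by blast
  have vS: "v \<in> par S" and uS: "u \<in> par S" using conc_par[OF cs(1)] v u by (auto simp: is_min_def)
  have "u = v"
  proof (rule ccontr)
    assume "u \<noteq> v"
    define x where "x = u * inverse v"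
    have xS: "x \<in> par S" and ux: "u = x * v" using uS vS by (simp_all add: x_def mult.assoc left_inv)
    have "x \<noteq> 1" using \<open>u \<noteq> v\<close> ux by auto
    then obtain s where s: "s \<in> ldesc x" using ex_ldesc xS by blast
    have sS: "s \<in> S" using s by (simp add: ldesc_def)
    have "wle v u" using v u unfolding is_min_def by blast
    then have "len u = len x + len v" unfolding wle_def x_def .
    moreover have "len (s * u) \<le> len (s * x) + len v"
      using len_mult_le[of "s * x" v] xS vS sS by (simp add: ux mult.assoc)
    ultimately have su: "s \<in> ldesc u" using s by (simp add: ldesc_def)
    define r where "r = inverse u * s * u"
    have rT: "r \<in> T" using uS sS by (simp add: r_def conj_T' S_T)
    have rN: "r \<in> N u" using su uS sS by (simp add: r_def ldesc_conj_N)
    have "v * r * inverse v = inverse x * s * x" by (simp add: r_def ux grp)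
    then have "v * r * inverse v \<in> N x" using s sS xS by (simp add: ldesc_conj_N)
    then have rv: "r \<notin> N v" using rN N_mult[OF rT xS vS] ux by blast
    obtain as t bs where *: "ts = as @ t # bs" "s = u * prod_list as * t * inverse (u * prod_list as)"
      using lsteps_split su desc by blast
    let ?p = "prod_list as"
    have p: "?p \<in> par S" "t \<in> T" using cs * prod_refls_par[of as] by (auto simp: chain_def)
    have conj: "?p * t * inverse ?p = r" by (simp add: r_def *(2) grp)
    have "t \<notin> N (u * ?p)" "t \<notin> N (v * ?p)"
      using u v * by (auto simp: is_min_def conc_def ups_append)
    then show False
      using N_mult[OF p(2) uS p(1)] N_mult[OF p(2) vS p(1)] conj rN rv by auto
  qed
  then show ?thesis using v by simp
qed

section \<open>Avoiding a letter\<close>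

text \<open>These are the Hurwitz shifts of \<open>s # \<tau>\<close>: moving \<open>s\<close> to
  the right by \<open>k\<close> places conjugates the \<open>k\<close> steps passed and preserves
  the product.\<close>

lemma rotate_chain_seq:
  assumes "s \<in> S" "set \<tau> \<subseteq> T" "length \<tau> = length cs" "prod_list \<tau> = prod_list cs"
  shows "chain (s # cs) (map (\<lambda>t. s * t * s) (take k \<tau>) @ s # drop k \<tau>)"
proof -
  have "prod_list (take k \<tau> @ drop k \<tau>) = prod_list cs" using assms by simp
  then have "s * prod_list (take k \<tau>) * s * (s * prod_list (drop k \<tau>)) = s * prod_list cs"
    unfolding prod_list.append using assms by (simp add: mult.assoc invs)
  moreover have "set (take k \<tau>) \<subseteq> T" "set (drop k \<tau>) \<subseteq> T"
    using assms set_take_subset[of k \<tau>] set_drop_subset[of k \<tau>] by auto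
  ultimately show ?thesis
    using assms map_conj_T[of s "take k \<tau>"]
    by (simp add: chain_def prod_map_conj S_T min_def)
qed

text \<open>A chain for \<open>s # cs\<close> with minimum \<open>u\<close> and \<open>s\<close> among its steps is turned into one without the
  step \<open>s\<close>. Moving \<open>s\<close> through the chain changes neither concordance nor the other left steps, as
  long as \<open>s\<close> stays a right descent of the shifted chain from \<open>u * s\<close>; then \<open>s\<close> and its successor
  are replaced by another factorization of their product. Case B keeps the left step of \<open>s\<close>, which
  is a left descent of \<open>u\<close>; in case A this left step is not needed.\<close>

theorem avoid_letter:
  assumes cs: "coxeter_word (s # cs)" "chain (s # cs) ts" and min: "is_min (s # cs) ts u'"
    and asc: "s \<notin> N u'" and long: "len (u' * s * prod_list cs * s) = len (u' * s) + length cs + 1"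
  shows "\<exists>us. chain (s # cs) us \<and> s \<notin> set us \<and> is_min (s # cs) us u'"
proof (cases "s \<in> set ts")
  case False
  then show ?thesis using cs min by blast
next
  case True
  then obtain ts1 ts2 where ts: "ts = ts1 @ s # ts2" by (metis split_list)
  \<comment> \<open>Moving \<open>s\<close> to the front of the chain conjugates the steps before
    it. What remains factors \<open>prod_list cs\<close>, hence lies in \<open>par (set cs)\<close>
    and does not contain \<open>s\<close>.\<close>
  define \<tau> where "\<tau> = map (\<lambda>t. s * t * s) ts1 @ ts2"
  define k0 where "k0 = length ts1"
  define u where "u = u' * s"
  have sS: "s \<in> S" and scs: "s \<notin> set cs" and sub: "set cs \<subseteq> S" and sub': "set (s # cs) \<subseteq> S"
    using cs by (auto simp: coxeter_word_def)
  have ccs: "coxeter_word cs" using cs by (simp add: coxeter_word_def)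
  have u': "u' \<in> par (set (s # cs))" "ups u' ts" using min by (auto simp: is_min_def conc_def)
  have u'S: "u' \<in> par S" using u' par_subset_S[OF sub'] by blast
  have uS: "u \<in> par S" and us: "u * s = u'" using u'S sS by (simp_all add: u_def mult.assoc invs)
  have tsT: "set ts1 \<subseteq> T" "set ts2 \<subseteq> T" "length ts1 + length ts2 = length cs"
    "prod_list ts1 * s * prod_list ts2 = s * prod_list cs"
    using cs ts by (auto simp: chain_def mult.assoc)
  have \<tau>T: "set \<tau> \<subseteq> T" "length \<tau> = length cs"
    using tsT map_conj_T[OF sS tsT(1)] by (auto simp: \<tau>_def)
  have "prod_list \<tau> = s * (prod_list ts1 * s * prod_list ts2)"
    unfolding \<tau>_def prod_list.append prod_map_conj[OF sS] by (simp only: mult.assoc)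
  then have \<tau>P: "prod_list \<tau> = prod_list cs" using tsT(4) sS by (simp add: invs)
  have \<tau>c: "chain cs \<tau>" using \<tau>T \<tau>P by (simp add: chain_def)
  have \<tau>par: "set \<tau> \<subseteq> par (set cs)" using chain_par[OF ccs \<tau>c] .
  have s_par: "s \<notin> par (set cs)" using par_Int_S[OF sub sS] scs by blast
  have s\<tau>: "s \<notin> set \<tau>" using \<tau>par s_par by blast
  \<comment> \<open>In \<open>sq k\<close> the step \<open>s\<close> sits at position
    \<open>k\<close> and leads from \<open>u * P k * s\<close> to \<open>u * P k\<close>. Its left
    step is \<open>lam k\<close>, and \<open>D k\<close> says that it goes up.\<close>
  define P where "P k = prod_list (take k \<tau>)" for k
  define sq where "sq k = map (\<lambda>t. s * t * s) (take k \<tau>) @ s # drop k \<tau>" for k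
  define lam where "lam k = u * P k * s * inverse (u * P k)" for k
  define D where "D k \<longleftrightarrow> s \<in> N (u * P k)" for k
  have ts_sq: "ts = sq k0"
    using map_conj_conj[OF sS, of ts1] by (simp add: sq_def k0_def \<tau>_def ts)
  have k0: "k0 \<le> length \<tau>" by (simp add: k0_def \<tau>_def)
  have chain_sq: "chain (s # cs) (sq k)" for k
    unfolding sq_def using rotate_chain_seq[OF sS \<tau>T \<tau>P] .
  have PS: "P k \<in> par S" for k
    unfolding P_def using \<tau>T set_take_subset[of k \<tau>] by (intro prod_refls_par) blast
  have uP: "u * P k \<in> par S" for k using uS PS by simp
  have PSuc: "P (Suc k) = P k * \<tau> ! k" if "k < length \<tau>" for k
    using that by (simp add: P_def take_Suc_conv_app_nth)
  have take_T: "set (take k \<tau>) \<subseteq> T" "s \<notin> set (take k \<tau>)" "set (drop k \<tau>) \<subseteq> T" for k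
    using \<tau>T s\<tau> set_take_subset[of k \<tau>] set_drop_subset[of k \<tau>] by auto
  have base: "u' * prod_list (map (\<lambda>t. s * t * s) (take k \<tau>)) = u * P k * s" for k
    unfolding prod_map_conj[OF sS] P_def u_def by (simp only: mult.assoc)
  have ups_sq: "ups u' (sq k) \<longleftrightarrow> ups u \<tau> \<and> D k" for k
  proof -
    have "ups u' (map (\<lambda>t. s * t * s) (take k \<tau>)) \<longleftrightarrow> ups u (take k \<tau>)"
      using ups_conj[OF sS uS take_T(1,2)] by (simp add: us)
    moreover have "s \<notin> N (u * P k * s) \<longleftrightarrow> D k"
      using N_mult_refl[OF S_T[OF sS] uP] by (simp add: D_def)
    moreover have "u * P k * s * s = u * prod_list (take k \<tau>)"
      using sS by (simp add: mult.assoc invs P_def)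
    moreover have "ups u \<tau> \<longleftrightarrow> ups u (take k \<tau>) \<and> ups (u * prod_list (take k \<tau>)) (drop k \<tau>)"
      using ups_append[of u "take k \<tau>" "drop k \<tau>"] by simp
    ultimately show ?thesis by (auto simp: sq_def ups_append base)
  qed
  have lsteps_sq: "set (lsteps u' (sq k)) = set (lsteps u \<tau>) \<union> {lam k}" for k
  proof -
    have "lsteps u' (map (\<lambda>t. s * t * s) (take k \<tau>)) = lsteps u (take k \<tau>)"
      using lsteps_conj[OF sS, of u] by (simp add: us)
    moreover have "u * P k * s * s = u * P k" using sS by (simp add: mult.assoc invs)
    moreover have "u * P k * s * s * inverse (u * P k * s) = lam k"
      using sS by (simp add: lam_def grp invs)
    moreover have "lsteps u \<tau> = lsteps u (take k \<tau>) @ lsteps (u * P k) (drop k \<tau>)"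
      using lsteps_append[of u "take k \<tau>" "drop k \<tau>"] by (simp add: P_def)
    ultimately show ?thesis by (auto simp: sq_def lsteps_append base)
  qed
  have ups\<tau>: "ups u \<tau>" and Dk0: "D k0" using u'(2) ups_sq ts_sq by auto
  have D0: "D 0" using asc N_mult_refl[OF S_T[OF sS] u'S] by (simp add: D_def P_def u_def)
  \<comment> \<open>Here \<open>long\<close> enters: at the far end \<open>s\<close> lengthens
    \<open>u * prod_list cs\<close>, so the step \<open>s\<close> would go down there.\<close>
  have Dlast: "\<not> D (length \<tau>)"
  proof
    have P: "P (length \<tau>) = prod_list cs" by (simp add: P_def \<tau>P)
    assume "D (length \<tau>)"
    then have "len (u * prod_list cs * s) < len (u * prod_list cs)" by (simp add: D_def P N_def)
    moreover have "len (u * prod_list cs) \<le> len u + length cs"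
      using chain_len[OF ccs \<tau>c uS ups\<tau>] by simp
    ultimately show False using long by (simp add: u_def)
  qed
  have D_Suc: "D (Suc k) \<longleftrightarrow> \<tau> ! k * s * \<tau> ! k \<in> N (u * P k)" if "k < length \<tau>" for k
  proof -
    have t: "\<tau> ! k \<in> par (set cs)" "\<tau> ! k \<in> T" using that \<tau>par \<tau>T by auto
    then have "s \<notin> N (\<tau> ! k)" using notin_N_par[OF sub sS scs] by blast
    then show ?thesis
      using N_mult[OF S_T[OF sS] uP[of k], of "\<tau> ! k"] t that
      by (simp add: D_def PSuc mult.assoc inv_T)
  qed
  have desc: "ldesc u' \<subseteq> set (lsteps u \<tau>) \<union> {lam k0}"
    using min_ldesc[OF cs min] lsteps_sq ts_sq by simp
  have up_step: "\<tau> ! k \<notin> N (u * P k)" if "k < length \<tau>" for k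
  proof -
    have "\<tau> = take k \<tau> @ \<tau> ! k # drop (Suc k) \<tau>" using that by (rule id_take_nth_drop)
    then have "ups u (take k \<tau> @ \<tau> ! k # drop (Suc k) \<tau>)" using ups\<tau> by simp
    then show ?thesis by (simp add: ups_append P_def)
  qed
  have len_steps: "len (u * P k) = len (u * P k * s) + 1" "len (u * P k * \<tau> ! k) = len (u * P k * s) + 2"
    if k: "k < length \<tau>" "D k" for k
  proof -
    define A where "A = map (\<lambda>t. s * t * s) (take k \<tau>)"
    have sqk: "sq k = A @ s # \<tau> ! k # drop (Suc k) \<tau>"
      using k(1) by (simp add: sq_def A_def Cons_nth_drop_Suc)
    have "ups u' (sq k)" using ups_sq ups\<tau> k(2) by blast
    moreover have "len (u' * prod_list (sq k)) = len u' + length (sq k)"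
      using chain_len[OF cs(1) chain_sq[of k] u'S] \<open>ups u' (sq k)\<close> chain_sq[of k]
      by (simp add: chain_def)
    ultimately have *: "len (u' * prod_list A * s) = len (u' * prod_list A) + 1"
      "len (u' * prod_list (A @ [s]) * \<tau> ! k) = len (u' * prod_list (A @ [s])) + 1"
      using ups_exact[of u' A s "\<tau> ! k # drop (Suc k) \<tau>"]
        ups_exact[of u' "A @ [s]" "\<tau> ! k" "drop (Suc k) \<tau>"] u'S chain_sq[of k] sqk
      by (simp_all add: chain_def)
    have A: "u' * prod_list A = u * P k * s" using base by (simp add: A_def)
    have "u' * prod_list (A @ [s]) = u' * prod_list A * s" by (simp add: mult.assoc)
    moreover have As': "u' * prod_list A * s = u * P k" unfolding A using sS by (simp add: mult.assoc invs)
    ultimately have As: "u' * prod_list (A @ [s]) = u * P k" by simp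
    show 1: "len (u * P k) = len (u * P k * s) + 1"
      using *(1) unfolding As' unfolding A .
    show "len (u * P k * \<tau> ! k) = len (u * P k * s) + 2" using *(2) 1 by (simp only: As)
  qed
  \<comment> \<open>The steps \<open>s\<close> and \<open>\<tau> ! k\<close> are exchanged for
    \<open>p\<close> and \<open>q\<close>. By \<open>min_criterion\<close> only two left steps are
    at stake: \<open>keep\<close> retains \<open>lam k0\<close> when it is a descent, and
    \<open>lost\<close> says that the left step of \<open>\<tau> ! k\<close> is none.\<close>
  have replace: "\<exists>us. chain (s # cs) us \<and> s \<notin> set us \<and> is_min (s # cs) us u'"
    if k: "k < length \<tau>" and pq: "p \<in> T" "q \<in> T" "p * q = s * \<tau> ! k" "p \<noteq> s" "q \<noteq> s"
      and up: "p \<notin> N (u * P k * s)" "q \<notin> N (u * P k * s * p)"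
      and keep: "lam k0 \<in> ldesc u' \<Longrightarrow>
        lam k0 \<in> {u * P k * s * p * inverse (u * P k * s), u * P k * s * p * q * inverse (u * P k * s * p)}"
      and lost: "u * P k * \<tau> ! k * inverse (u * P k) \<notin> ldesc u'"
    for k p q
  proof -
    define A where "A = map (\<lambda>t. s * t * s) (take k \<tau>)"
    define B where "B = drop (Suc k) \<tau>"
    have dropk: "drop k \<tau> = \<tau> ! k # B" using k by (simp add: B_def Cons_nth_drop_Suc)
    have sqk: "sq k = A @ [s, \<tau> ! k] @ B" by (simp add: sq_def A_def dropk)
    have \<tau>k: "\<tau> = take k \<tau> @ [\<tau> ! k] @ B" using k by (simp add: B_def id_take_nth_drop[symmetric])
    define us where "us = A @ [p, q] @ B"
    have "prod_list us = prod_list (sq k)"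
      unfolding us_def sqk prod_list.append using pq(3) by simp
    then have ch: "chain (s # cs) us"
      using chain_sq[of k] pq(1,2) by (simp add: chain_def us_def sqk)
    have "s \<notin> set A" using take_T(2)[of k] notin_map_conj[OF sS] by (simp add: A_def)
    moreover have "s \<notin> set B" using s\<tau> set_drop_subset[of "Suc k" \<tau>] by (auto simp: B_def)
    ultimately have ns: "s \<notin> set us" using pq(4,5) by (simp add: us_def)
    have baseA: "u' * prod_list A = u * P k * s" using base by (simp add: A_def)
    have upsA: "ups u' A" using ups_conj[OF sS uS take_T(1,2)[of k]] ups\<tau> ups_append[of u "take k \<tau>" "drop k \<tau>"]
      by (simp add: us A_def)
    have end_eq: "u * P k * s * p * q = u * P k * \<tau> ! k"
      using sS pq(3) by (simp add: mult.assoc invs)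
    have upsB: "ups (u * P k * \<tau> ! k) B"
      using ups\<tau> \<tau>k ups_append[of u "take k \<tau>" "[\<tau> ! k] @ B"] by (simp add: P_def)
    have "ups u' us"
      unfolding us_def using upsA upsB up end_eq by (simp add: ups_append baseA)
    then have conc: "u' \<in> conc (s # cs) us" using u'(1) by (simp add: conc_def)
    have lA: "lsteps u' A = lsteps u (take k \<tau>)"
      using lsteps_conj[OF sS, of u] by (simp add: us A_def)
    have l_us: "set (lsteps u' us) = set (lsteps u (take k \<tau>)) \<union>
        {u * P k * s * p * inverse (u * P k * s), u * P k * s * p * q * inverse (u * P k * s * p)} \<union>
        set (lsteps (u * P k * \<tau> ! k) B)"
    proof -
      have "u * P k * s * (p * q) = u * P k * \<tau> ! k" using end_eq by (simp only: mult.assoc)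
      then show ?thesis
        unfolding us_def lsteps_append baseA lA using end_eq by (simp add: baseA)
    qed
    have l_\<tau>: "set (lsteps u \<tau>) = set (lsteps u (take k \<tau>)) \<union>
        {u * P k * \<tau> ! k * inverse (u * P k)} \<union> set (lsteps (u * P k * \<tau> ! k) B)"
    proof -
      have "lsteps u \<tau> = lsteps u (take k \<tau> @ [\<tau> ! k] @ B)" using \<tau>k by simp
      then show ?thesis by (auto simp: lsteps_append P_def)
    qed
    have "ldesc u' \<subseteq> set (lsteps u' us)"
      using desc keep lost unfolding l_us l_\<tau> by blast
    then show ?thesis using min_criterion[OF cs(1) ch conc] ch ns by blast
  qed
  show ?thesis
  proof (cases "lam k0 \<in> ldesc u'")
    case B: True
    define r where "r = lam k0"
    have rS: "r \<in> S" using B by (simp add: r_def ldesc_def)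
    \<comment> \<open>If \<open>s\<close> commuted with all later steps, shifting it to the end
      would change neither \<open>lam\<close> nor \<open>D\<close>, contrary to
      \<open>Dlast\<close>.\<close>
    have "\<exists>j<length \<tau>. lam j = r \<and> D j \<and> s * \<tau> ! j \<noteq> \<tau> ! j * s"
    proof (rule ccontr)
      assume no: "\<not> ?thesis"
      have "k0 + i \<le> length \<tau> \<Longrightarrow> lam (k0 + i) = r \<and> D (k0 + i)" for i
      proof (induction i)
        case 0
        then show ?case using Dk0 by (simp add: r_def)
      next
        case (Suc i)
        let ?k = "k0 + i"
        have k: "?k < length \<tau>" and IH: "lam ?k = r" "D ?k" using Suc by auto
        then have com: "s * \<tau> ! ?k = \<tau> ! ?k * s" using no by blast
        have tT: "\<tau> ! ?k \<in> T" using \<tau>T k by auto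
        have tst: "\<tau> ! ?k * s * \<tau> ! ?k = s"
          using com tT by (simp add: mult.assoc T_invol) (simp add: mult.assoc[symmetric] T_invol)
        have "lam (Suc ?k) = u * P ?k * (\<tau> ! ?k * s * \<tau> ! ?k) * inverse (u * P ?k)"
          using tT k by (simp add: lam_def PSuc inv_mult inv_T mult.assoc)
        then have "lam (Suc ?k) = lam ?k" by (simp only: tst lam_def)
        moreover have "D (Suc ?k)" using D_Suc[OF k] tst IH(2) by (simp add: D_def)
        ultimately show ?case using IH by simp
      qed
      from this[of "length \<tau> - k0"] show False using k0 Dlast by simp
    qed
    then obtain j where j: "j < length \<tau>" "lam j = r" "D j" "s * \<tau> ! j \<noteq> \<tau> ! j * s" by blast
    define t where "t = \<tau> ! j"
    define x where "x = u * P j"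
    define z where "z = x * s"
    have tT: "t \<in> T" and tpar: "t \<in> par (set cs)" using j \<tau>T \<tau>par by (auto simp: t_def)
    have tS: "t \<in> par S" using tT by simp
    have xS: "x \<in> par S" and zS: "z \<in> par S" using uP sS by (simp_all add: x_def z_def)
    have ts_ne: "t \<noteq> s" using tpar s_par by blast
    have rx: "r * x = z" using j(2) by (simp add: lam_def x_def[symmetric] z_def grp)
        (auto simp: lam_def x_def z_def grp)
    have rz: "r * z = x" using rx rS by (simp add: rx[symmetric] invs)
    have zs: "z * s = x" using sS by (simp add: z_def mult.assoc invs)
    have sx: "s \<in> N x" using j(3) by (simp add: D_def x_def)
    have sz: "s \<notin> N z" using sx N_mult_refl[OF S_T[OF sS] xS] by (simp add: z_def)
    have tx: "t \<notin> N x" using up_step[OF j(1)] by (simp add: t_def x_def)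
    have tstT: "t * s * t \<in> T" using conj_T[OF S_T[OF sS] tS] tT by (simp add: inv_T)
    have stsT: "s * t * s \<in> T" using conj_S_T[OF tT sS] .
    have tst_par: "t * s * t \<notin> par (set cs)"
    proof
      assume "t * s * t \<in> par (set cs)"
      then have "t * (t * s * t) * t \<in> par (set cs)" using tpar by auto
      then show False using s_par tT by (simp add: mult.assoc invT)
    qed
    have tst_ne: "t * s * t \<noteq> s"
    proof
      assume "t * s * t = s"
      then have "t * s * t * t = s * t" by simp
      then show False using j(4) tT by (simp add: t_def[symmetric] mult.assoc T_invol)
    qed
    have r_conj: "x * s * inverse x = r" using j(2) by (simp add: lam_def x_def)
    have up1: "t \<notin> N z"
    proof -
      have "x * t * inverse x \<noteq> r"
        using r_conj ts_ne by (metis conj_eq_iff)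
      then show ?thesis using N_S_mult[OF tT xS rS] tx rx by simp
    qed
    have up2: "t * s * t \<notin> N (z * t)"
    proof -
      have "t * s * t \<notin> N t" using N_par[OF sub tpar] tst_par by blast
      moreover have "t * (t * s * t) * inverse t = s" using tT by (simp add: mult.assoc invT)
      ultimately show ?thesis using N_mult[OF tstT zS tS] sz by simp
    qed
    have l: "len x = len z + 1" "len (x * t) = len z + 2"
      using len_steps[OF j(1,3)] by (simp_all add: x_def z_def t_def)
    \<comment> \<open>If the left step \<open>r'\<close> of \<open>t\<close> were simple, both
      \<open>r * z\<close> and \<open>r' * z\<close> would lie above \<open>z\<close>, with
      \<open>x * t\<close> on top. In either case \<open>lifting\<close> forces an equality:
      \<open>s * t * s = s\<close>, or \<open>s\<close> and \<open>t\<close> commute.\<close>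
    have lost: "x * t * inverse x \<notin> ldesc u'"
    proof
      define r' where "r' = x * t * inverse x"
      assume "x * t * inverse x \<in> ldesc u'"
      then have r'S: "r' \<in> S" by (simp add: ldesc_def r'_def)
      have v1: "x * t = r' * x" by (simp add: r'_def grp)
      have r'z: "r' * z = z * (s * t * s)"
      proof -
        have "r' * z = r' * x * s" by (simp add: z_def mult.assoc)
        also have "\<dots> = x * t * s" by (simp only: v1)
        finally show ?thesis by (simp only: zs[symmetric] mult.assoc)
      qed
      have "s * t * s \<notin> N z"
      proof -
        have "t \<notin> N (z * s)" using tx zs by simp
        then show ?thesis using N_mult_S[OF tT zS sS] ts_ne by simp
      qed
      then have "len z < len (r' * z)" using not_N_iff[OF stsT zS] r'z by simp
      then have lr'z: "len (r' * z) = len z + 1" using len_S_mult[OF zS r'S] by (auto split: if_splits)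
      have r'zS: "r' * z \<in> par S" using r'S zS by simp
      have v2: "x * t = r' * z * s" using v1 zs by (simp add: mult.assoc)
      have v3: "x * t = r * (z * t)" using rz by (simp add: mult.assoc[symmetric])
      have "r \<in> ldesc (x * t)"
      proof -
        have "len (z * t) < len (z * t * (t * s * t))"
          using up2 not_N_iff[OF tstT, of "z * t"] zS tS by simp
        moreover have "z * t * (t * s * t) = x * t" using zs tT by (simp add: mult.assoc T_invol_left)
          (simp add: mult.assoc[symmetric])
        moreover have "r * (x * t) = z * t" using v3 rS by (simp add: invs)
        ultimately show ?thesis using rS by (simp add: ldesc_def)
      qed
      have r_z: "r \<notin> ldesc z" using rz l(1) by (simp add: ldesc_def)
      show False
      proof (cases "r \<in> ldesc (r' * z)")
        case True
        have "z * (s * t * s) = r * z"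
          using lifting[OF zS stsT _ _ r_z] True lr'z r'z by simp
        then have "z * (s * t * s) = z * s" using rz zs by simp
        then have "s * t * s = s" by (simp only: left_cancel)
        then show False using ts_ne sS conj_S_eq_S by blast
      next
        case False
        have "r' * z * s = r * (r' * z)"
          using lifting[OF r'zS S_T[OF sS] _ _ False] v2 lr'z l \<open>r \<in> ldesc (x * t)\<close> by simp
        then have "r * (z * t) = r * (r' * z)" using v2 v3 by simp
        then have "z * t = r' * z" by (simp only: left_cancel)
        then have "z * t * s = z * s * t" using v2 zs by simp
        then have "t * s = s * t" by (simp only: mult.assoc left_cancel)
        then show False using j(4) by (simp add: t_def)
      qed
    qed
    show ?thesis
    \<comment> \<open>The Hurwitz move from \<open>s\<close>, \<open>t\<close> to \<open>t\<close>,
      \<open>t * s * t\<close>: its second step has left step \<open>r = lam k0\<close>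
      again.\<close>
    proof (rule replace[OF j(1), of t "t * s * t"])
      show "t * (t * s * t) = s * \<tau> ! j" using tT by (simp add: t_def mult.assoc T_invol_left)
      have "z * t * (t * s * t) * inverse (z * t) = x * s * inverse x"
        using tT sS by (simp add: z_def grp invs invT)
      then show "lam k0 \<in> {u * P j * s * t * inverse (u * P j * s),
          u * P j * s * t * (t * s * t) * inverse (u * P j * s * t)}"
        using r_conj by (simp add: r_def x_def z_def)
    qed (use tT tstT ts_ne tst_ne up1 up2 lost in \<open>simp_all add: z_def x_def t_def\<close>)
  next
    case A: False
    \<comment> \<open>The shifted step goes up at position 0 and down at the end, so there is a
      place where it turns.\<close>
    have "\<exists>k<length \<tau>. D k \<and> \<not> D (Suc k)"
    proof (rule ccontr)
      assume no: "\<not> ?thesis"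
      have "k \<le> length \<tau> \<Longrightarrow> D k" for k
        by (induction k) (use D0 no in auto)
      then show False using Dlast by blast
    qed
    then obtain k where k: "k < length \<tau>" "D k" "\<not> D (Suc k)" by blast
    define t where "t = \<tau> ! k"
    define x where "x = u * P k"
    define z where "z = x * s"
    have tT: "t \<in> T" using k \<tau>T by (auto simp: t_def)
    have xS: "x \<in> par S" and zS: "z \<in> par S" using uP sS by (simp_all add: x_def z_def)
    have zs: "z * s = x" using sS by (simp add: z_def mult.assoc invs)
    have sx: "s \<in> N x" using k by (simp add: D_def x_def)
    have sxt: "s \<notin> N (x * t)" using k by (simp add: D_def x_def t_def PSuc mult.assoc)
    have l: "len x = len z + 1" "len (x * t) = len z + 2"
      using len_steps[OF k(1,2)] by (simp_all add: x_def z_def t_def)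
    \<comment> \<open>The path from \<open>z\<close> through \<open>z * s = x\<close> to
      \<open>x * t\<close> spans a Bruhat interval of length two; its other middle element gives the
      new factorization.\<close>
    obtain p q where pq: "p \<in> T" "q \<in> T" "p * q = s * t" "p \<noteq> s" "len (z * p) = len z + 1"
      using diamond[OF zS S_T[OF sS] tT] zs l by auto
    have zpq: "z * p * q = x * t"
    proof -
      have "z * p * q = z * (p * q)" by (simp only: mult.assoc)
      also have "\<dots> = x * t" by (simp only: pq(3) zs[symmetric] mult.assoc)
      finally show ?thesis .
    qed
    have qs: "q \<noteq> s"
    proof
      assume "q = s"
      then have "x * t * s = z * p" using zpq sS by (simp add: mult.assoc[symmetric] zpq[symmetric])
        (simp add: mult.assoc invs)
      then show False using sxt pq(5) l not_N_iff[OF S_T[OF sS], of "x * t"] xS tT by simp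
    qed
    have up: "p \<notin> N z" "q \<notin> N (z * p)"
      using pq l zpq zS by (simp_all add: N_def)
    have lost: "x * t * inverse x \<notin> ldesc u'"
    proof
      define r where "r = x * t * inverse x"
      assume "x * t * inverse x \<in> ldesc u'"
      then have rS: "r \<in> S" by (simp add: ldesc_def r_def)
      have rx: "r * x = x * t" by (simp add: r_def grp)
      have "len (x * t * s) = len (x * t) + 1"
        using len_mult_S[of "x * t" s] sxt xS tT sS by simp
      moreover have "x * t * s = r * z" by (simp add: z_def rx[symmetric] mult.assoc)
      moreover have "len (r * z) \<le> len z + 1" using len_S_mult[OF zS rS] by auto
      ultimately show False using l by simp
    qed
    show ?thesis
      by (rule replace[OF k(1), of p q])
        (use pq qs up lost A in \<open>simp_all add: z_def x_def t_def\<close>)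
  qed
qed

section \<open>The recursion for sortable elements\<close>

text \<open>The Cambrian recurrence at the initial letter \<open>s\<close>.\<close>

inductive srt :: "'g list \<Rightarrow> 'g \<Rightarrow> bool" where
  srt_Nil: "srt [] 1"
| srt_skip: "srt cw x \<Longrightarrow> s \<notin> set cw \<Longrightarrow> srt (s # cw) x"
| srt_take: "srt (cw @ [s]) x \<Longrightarrow> s \<notin> ldesc x \<Longrightarrow> srt (s # cw) (s * x)"

text \<open>The new letter travels with the rotations of the recursion and is skipped as soon as it
  becomes the initial letter.\<close>

lemma srt_insert:
  assumes "srt cw x" "cw = as @ bs" "s \<notin> set cw" shows "srt (as @ s # bs) x"
  using assms
proof (induction arbitrary: as bs rule: srt.induct)
  case (srt_skip cw x r)
  show ?case
  proof (cases as)
    case Nil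
    then show ?thesis using srt.srt_skip[of "r # cw" x s] srt.srt_skip[of cw x r] srt_skip by simp
  next
    case (Cons r' as')
    then show ?thesis using srt_skip srt.srt_skip[of "as' @ s # bs" x r] by auto
  qed
next
  case (srt_take cw r x)
  show ?case
  proof (cases as)
    case Nil
    then show ?thesis
      using srt.srt_skip[of "r # cw" "r * x" s] srt.srt_take[of cw r x] srt_take by simp
  next
    case (Cons r' as')
    then have "srt (as' @ s # bs @ [r]) x"
      using srt_take.IH[of as' "bs @ [r]"] srt_take.prems by auto
    then show ?thesis using srt.srt_take[of "as' @ s # bs" r x] srt_take Cons by auto
  qed
qed (simp add: srt.intros)

lemma srt_par: "srt cw x \<Longrightarrow> x \<in> par (set cw)"
proof (induction rule: srt.induct)
  case (srt_skip cw x s)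
  then show ?case using par_mono[of "set cw" "set (s # cw)"] by auto
next
  case (srt_take cw s x)
  then show ?case by auto
qed simp

text \<open>The word \<open>cw1\<close> consists of the letters of \<open>I\<^sup>(\<^sup>1\<^sup>)(x)\<close>.\<close>

lemma srt_split:
  assumes "srt cw x" "coxeter_word cw"
  shows "\<exists>cw1 y. subseq cw1 cw \<and> x = prod_list cw1 * y \<and> len x = length cw1 + len y \<and> srt cw1 y"
  using assms
proof (induction rule: srt.induct)
  case srt_Nil
  show ?case by (intro exI[of _ "[]"] exI[of _ 1]) (simp add: srt.srt_Nil)
next
  case (srt_skip cw x s)
  then obtain cw1 y where "subseq cw1 cw" "x = prod_list cw1 * y" "len x = length cw1 + len y" "srt cw1 y"
    by (auto simp: coxeter_word_def)
  moreover from this(1) have "subseq cw1 (s # cw)" by auto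
  ultimately show ?case by blast
next
  case (srt_take cw s x)
  have cw: "coxeter_word (cw @ [s])" and sS: "s \<in> S" and scw: "s \<notin> set cw" and sub: "set cw \<subseteq> S"
    using srt_take.prems by (auto simp: coxeter_word_def)
  obtain cw1 y where *: "subseq cw1 (cw @ [s])" "x = prod_list cw1 * y"
    "len x = length cw1 + len y" "srt cw1 y"
    using srt_take.IH[OF cw] by blast
  have sub1: "set cw1 \<subseteq> S" using subseq_set[OF *(1)] sub sS by auto
  have yS: "y \<in> par S" using srt_par[OF *(4)] par_subset_S[OF sub1] by blast
  have xS: "x \<in> par S" using *(2) yS sub1 by (auto intro: prod_list_in_par)
  have l: "len (s * x) = len x + 1" using len_S_mult[OF xS sS] srt_take by simp
  show ?case
  proof (cases "s \<in> set cw1")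
    case False
    then have "subseq cw1 cw" using subseq_snoc[OF *(1)] by auto
    then have "subseq (s # cw1) (s # cw)" by simp
    moreover have "s * x = prod_list (s # cw1) * y" by (simp add: *(2) mult.assoc)
    moreover have "len (s * x) = length (s # cw1) + len y" using *(3) l by simp
    ultimately show ?thesis using srt.srt_skip[OF *(4) False] by blast
  next
    case True
    \<comment> \<open>Seen from \<open>s # cw\<close>, the final \<open>s\<close> of the old first
      block belongs to the second copy of the word. It therefore passes to the remainder
      \<open>s * y\<close>.\<close>
    then obtain us where cw1: "cw1 = us @ [s]" "subseq us cw"
      using subseq_snoc[OF *(1)] subseq_set scw by blast
    have us: "us \<in> lists S" "prod_list us \<in> par S" using sub1 cw1 by (auto simp: prod_list_in_par)
    have syS: "s * y \<in> par S" using sS yS by simp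
    have "len x \<le> length us + len (s * y)"
      using len_mult_le[OF us(2) syS] len_le[OF us(1)] *(2) cw1 by (simp add: mult.assoc)
    then have "s \<notin> ldesc y" using *(3) cw1 by (auto simp: ldesc_def)
    then have "len (s * y) = len y + 1" "srt (s # us) (s * y)"
      using len_S_mult[OF yS sS] srt.srt_take[of us s y] *(4) cw1 by auto
    moreover have "s * x = prod_list (s # us) * (s * y)"
      using *(2) cw1 by (simp add: mult.assoc)
    moreover have "len (s * x) = length (s # us) + len (s * y)"
      using *(3) l cw1 calculation(1) by simp
    moreover have "subseq (s # us) (s # cw)" using cw1 by simp
    ultimately show ?thesis by blast
  qed
qed

text \<open>The additivity of lengths puts \<open>inverse y\<close> into the analogue of
  \<open>Wc_plus\<close> for the word \<open>rev cw\<close>, a necessary condition for concordance.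
  In the recursion it supplies the length hypothesis of \<open>avoid_letter\<close>.\<close>

lemma srt_inverse_min:
  assumes "srt cw y" "coxeter_word cw" "len (prod_list cw * y) = length cw + len y"
  shows "\<exists>ts. chain (rev cw) ts \<and> is_min (rev cw) ts (inverse y)"
  using assms
proof (induction rule: srt.induct)
  case srt_Nil
  show ?case
    by (intro exI[of _ "[]"]) (simp add: chain_def is_min_def conc_def wle_def inv_one)
next
  case (srt_skip cw y s)
  have sS: "s \<in> S" and sub: "set cw \<subseteq> S" using srt_skip.prems by (auto simp: coxeter_word_def)
  have yS: "y \<in> par S" using srt_par srt_skip par_subset_S[OF sub] by blast
  have cS: "prod_list cw \<in> par S" "cw \<in> lists S" using sub by (auto simp: prod_list_in_par)
  have "len (prod_list cw * y) = length cw + len y"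
    using srt_skip.prems(2) len_S_mult[of "prod_list cw * y" s] len_mult_le[OF cS(1) yS]
      len_le[OF cS(2)] sS yS cS by (auto simp: mult.assoc split: if_splits)
  then obtain ts where "chain (rev cw) ts" "is_min (rev cw) ts (inverse y)"
    using srt_skip by (auto simp: coxeter_word_def)
  then show ?case
    using insert_letter_min[of "rev cw" s "[]" ts "inverse y"] srt_skip.prems(1)
    by (auto simp: coxeter_word_def)
next
  case (srt_take cw s y)
  have cw: "coxeter_word (cw @ [s])" and cw': "coxeter_word (s # rev cw)" "coxeter_word (rev cw @ [s])"
    and sS: "s \<in> S" and sub: "set cw \<subseteq> S" "set (cw @ [s]) \<subseteq> S"
    using srt_take.prems by (auto simp: coxeter_word_def)
  have yS: "y \<in> par S" using srt_par srt_take par_subset_S[OF sub(2)] by blast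
  have cS: "prod_list cw \<in> par S" "cw \<in> lists S" using sub by (auto simp: prod_list_in_par)
  have sy: "len (s * y) = len y + 1" using len_S_mult[OF yS sS] srt_take by simp
  have long: "len (s * (prod_list cw * (s * y))) = length cw + 1 + (len y + 1)"
    using srt_take.prems(2) sy by (simp add: mult.assoc)
  have "len (prod_list cw * (s * y)) \<le> length cw + (len y + 1)"
    using len_mult_le[OF cS(1), of "s * y"] len_le[OF cS(2)] sy sS yS by simp
  then have "len (prod_list (cw @ [s]) * y) = length (cw @ [s]) + len y"
    using long len_S_mult[of "prod_list cw * (s * y)" s] sS yS cS
    by (auto simp: mult.assoc split: if_splits)
  then obtain ts where ts: "chain (s # rev cw) ts" "is_min (s # rev cw) ts (inverse y)"
    using srt_take.IH[OF cw] by auto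
  have inv: "inverse (prod_list cw) = prod_list (rev cw)" using inverse_prod_list[OF cS(2)] .
  have "len (inverse y * s * prod_list (rev cw) * s) = len (inverse (s * (prod_list cw * (s * y))))"
    using sS by (simp add: inv_mult inv inv_S mult.assoc)
  also have "\<dots> = length cw + 1 + (len y + 1)" using len_inv[of "s * (prod_list cw * (s * y))"] long sS cS yS by simp
  also have "\<dots> = len (inverse y * s) + length (rev cw) + 1"
  proof -
    have "inverse y * s = inverse (s * y)" using sS by (simp add: inv_mult inv_S)
    then show ?thesis using len_inv[of "s * y"] sy sS yS by simp
  qed
  finally have len: "len (inverse y * s * prod_list (rev cw) * s) =
      len (inverse y * s) + length (rev cw) + 1" .
  have asc: "s \<notin> N (inverse y)" using srt_take.hyps ldesc_inverse[OF yS] sS by simp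
  obtain us where us: "chain (s # rev cw) us" "s \<notin> set us" "is_min (s # rev cw) us (inverse y)"
    using avoid_letter[OF cw'(1) ts asc len] by blast
  let ?us = "map (\<lambda>t. s * t * s) us"
  have ch: "chain (rev cw @ [s]) ?us" using rotate_chain_back[OF cw'(1) us(1)] .
  have "s \<notin> set ?us" using us(2) notin_map_conj[OF sS] by blast
  moreover have "inverse (s * y) * s = inverse y" using sS by (simp add: inv_mult inv_S mult.assoc invol)
  ultimately have "is_min (rev cw @ [s]) ?us (inverse (s * y))"
    using rotate_min[OF cw'(2) ch, of "inverse (s * y)"] us(3) map_conj_conj[OF sS, of us] by simp
  then show ?case using ch by auto
qed

text \<open>The letters missing from \<open>cw1\<close> are inserted one at a time. Each new step
  comes last, so \<open>ts\<close> stays a prefix and the element reached after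
  \<open>length ts\<close> steps is unchanged.\<close>

lemma insert_letters_min:
  assumes "subseq cw1 cw" "coxeter_word (cw @ pre)"
    and "chain (rev cw1 @ pre) ts" "is_min (rev cw1 @ pre) ts u"
  shows "\<exists>us. chain (rev cw @ pre) (ts @ us) \<and> is_min (rev cw @ pre) (ts @ us) u"
  using assms
proof (induction arbitrary: pre rule: list_emb.induct)
  case (list_emb_Nil ys)
  then show ?case
  proof (induction ys)
    case (Cons y ys)
    then obtain us where "chain (rev ys @ pre) (ts @ us)" "is_min (rev ys @ pre) (ts @ us) u"
      by (auto simp: coxeter_word_def)
    then show ?case
      using insert_letter_min[of "rev ys" y pre "ts @ us" u] Cons.prems(1)
      by (auto simp: coxeter_word_def)
  qed (auto intro: exI[of _ "[]"])
next
  case (list_emb_Cons xs ys y)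
  have "coxeter_word (ys @ pre)" using list_emb_Cons.prems(1) by (simp add: coxeter_word_def)
  then obtain us where "chain (rev ys @ pre) (ts @ us)" "is_min (rev ys @ pre) (ts @ us) u"
    using list_emb_Cons.IH list_emb_Cons.prems(2,3) by blast
  then show ?case
    using insert_letter_min[of "rev ys" y pre "ts @ us" u] list_emb_Cons.prems(1)
    by (auto simp: coxeter_word_def)
next
  case (list_emb_Cons2 x y xs ys)
  then show ?case
    using list_emb_Cons2.IH[of "x # pre"] by (auto simp: coxeter_word_def)
qed

theorem srt_imp_min:
  assumes "srt cw x" "coxeter_word cw"
  shows "\<exists>ts u i. chain (rev cw) ts \<and> is_min (rev cw) ts u \<and> i \<le> length cw \<and>
    inverse x = u * prod_list (take i ts)"
proof -
  obtain cw1 y where *: "subseq cw1 cw" "x = prod_list cw1 * y" "len x = length cw1 + len y" "srt cw1 y"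
    using srt_split[OF assms] by blast
  have cw1: "coxeter_word cw1"
    using *(1) assms(2) subseq_distinct by (auto simp: coxeter_word_def dest: list_emb_set)
  obtain ts where ts: "chain (rev cw1) ts" "is_min (rev cw1) ts (inverse y)"
    using srt_inverse_min[OF *(4) cw1] * by auto
  obtain us where us: "chain (rev cw) (ts @ us)" "is_min (rev cw) (ts @ us) (inverse y)"
    using insert_letters_min[OF *(1), of "[]" ts "inverse y"] assms(2) ts by auto
  have "inverse x = inverse y * prod_list (rev cw1)"
    using *(2) cw1 inverse_prod_list[of cw1]
    by (simp add: inv_mult coxeter_word_def in_lists_conv_set subset_iff)
  then have "inverse x = inverse y * prod_list (take (length ts) (ts @ us))"
    using ts by (simp add: chain_def)
  then show ?thesis using us by (intro exI[of _ "ts @ us"] exI[of _ "inverse y"] exI[of _ "length ts"])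
    (auto simp: chain_def)
qed

text \<open>If the final letter \<open>s\<close> of \<open>c\<close> is a step, the elements before
  this step occur in the contracted chain, where \<open>s\<close> is skipped; each later one is
  \<open>w' * s\<close> with \<open>w'\<close> in the contracted chain, where \<open>s\<close> is
  taken. If \<open>s\<close> is no step, it is a right descent of every element of the shifted chain
  and rotation applies.\<close>

theorem min_imp_srt:
  assumes "coxeter_word cw" "chain (rev cw) ts" "is_min (rev cw) ts u"
  shows "srt cw (inverse (u * prod_list (take i ts)))"
  using assms
proof (induction "length cw + len (u * prod_list (take i ts))" arbitrary: cw ts u i rule: less_induct)
  case less
  show ?case
  proof (cases cw)
    case Nil
    then show ?thesis using less.prems srt_Nil by (auto simp: chain_def is_min_def conc_def inv_one)
  next
    case (Cons s ds)
    let ?w = "u * prod_list (take i ts)"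
    have cw: "coxeter_word (rev ds @ [s])" "chain (rev ds @ [s]) ts" "is_min (rev ds @ [s]) ts u"
      using less.prems Cons by (auto simp: coxeter_word_def)
    have sS: "s \<in> S" and ds: "set ds \<subseteq> S" "s \<notin> set ds" "coxeter_word ds" "coxeter_word (ds @ [s])"
      using less.prems(1) Cons by (auto simp: coxeter_word_def)
    have tsT: "set ts \<subseteq> T" using cw(2) by (simp add: chain_def)
    have uS: "u \<in> par S" using cw conc_par by (auto simp: is_min_def)
    have take_par: "prod_list (take j ts) \<in> par S" for j
      using tsT set_take_subset[of j ts] by (intro prod_refls_par) blast
    have take_srt: "srt cw (inverse w)" if "srt (ds @ [s]) (inverse (w * s))" "s \<in> N w" "w \<in> par S" for w
    proof -
      have eq: "s * inverse (w * s) = inverse w" using sS by (simp add: inv_mult inv_S invol_left)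
      have "s \<notin> N (w * s)" using N_mult_refl[OF S_T[OF sS] that(3)] that(2) by blast
      then have "s \<notin> ldesc (inverse (w * s))"
        using ldesc_inverse[of "inverse (w * s)"] that(3) sS by (simp add: inv_inv)
      then show ?thesis using srt_take[OF that(1)] eq Cons by simp
    qed
    show ?thesis
    proof (cases "s \<in> set ts")
      case True
      then obtain as bs where ts: "ts = as @ s # bs" by (metis split_list)
      let ?bs = "map (\<lambda>t. s * t * s) bs"
      have con: "chain (rev ds) (as @ ?bs)" "coxeter_word (rev ds)"
        using contract_chain[of "rev ds" s as bs] cw ts by auto
      obtain v where v: "is_min (rev ds) (as @ ?bs) v" using ex_min[OF con(2,1)] by blast
      then have "is_min (rev ds @ [s]) ts v" using contract_min[of "rev ds" s as bs] cw ts by simp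
      then have "v = u" using is_min_unique[OF cw(1)] cw(3) by blast
      then have min: "is_min (rev ds) (as @ ?bs) u" using v by simp
      have uds: "u \<in> par (set ds)" using min by (simp add: is_min_def conc_def)
      have small: "srt ds (inverse (u * prod_list (take j (as @ ?bs))))"
        if "len (u * prod_list (take j (as @ ?bs))) \<le> len ?w" for j
        using less.hyps[OF _ ds(3) con(1) min, of j] that Cons by simp
      have small_par: "u * prod_list (take j (as @ ?bs)) \<in> par (set ds)" for j
      proof -
        have "set (as @ ?bs) \<subseteq> par (set ds)"
          using chain_par[OF con(2,1)] by (simp only: set_rev)
        then have "set (take j (as @ ?bs)) \<subseteq> par (set ds)"
          by (rule order_trans[OF set_take_subset])
        moreover have "set us \<subseteq> par (set ds) \<Longrightarrow> prod_list us \<in> par (set ds)" for us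
          by (induction us) auto
        ultimately show ?thesis using uds by blast
      qed
      show ?thesis
      proof (cases "i \<le> length as")
        case True
        then have "take i ts = take i (as @ ?bs)" by (simp add: ts)
        then show ?thesis using small[of i] srt_skip[OF _ ds(2)] Cons by simp
      next
        case False
        \<comment> \<open>The contracted chain has one step less, so entry \<open>i\<close> behind
          the step \<open>s\<close> corresponds to its entry \<open>i - 1\<close>.\<close>
        define j where "j = i - 1"
        have i: "i = Suc j" "length as \<le> j" using False by (auto simp: j_def)
        let ?w' = "u * prod_list (take j (as @ ?bs))"
        have w'S: "?w' \<in> par S" using small_par par_subset_S[OF ds(1)] by blast
        have "take j (as @ ?bs) = as @ map (\<lambda>t. s * t * s) (take (j - length as) bs)"
          using i by (simp add: take_map)
        then have "prod_list (take j (as @ ?bs)) * s = prod_list as * (s * prod_list (take (j - length as) bs))"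
          using prod_map_conj[OF sS, of "take (j - length as) bs"] sS by (simp add: mult.assoc invs)
        moreover have "take i ts = as @ s # take (j - length as) bs"
          using i by (simp add: ts Suc_diff_le)
        ultimately have w: "?w = ?w' * s" by (simp add: mult.assoc)
        have nN: "s \<notin> N ?w'" using notin_N_par[OF ds(1) sS ds(2) small_par] .
        then have "len ?w' < len ?w" using not_N_iff[OF S_T[OF sS] w'S] w by simp
        then have "srt ds (inverse ?w')" using small[of j] by simp
        then have "srt (ds @ [s]) (inverse ?w')" using srt_insert[of ds _ ds "[]" s] ds(2) by simp
        then have "srt (ds @ [s]) (inverse (?w * s))" using w sS by (simp add: mult.assoc invol)
        moreover have "s \<in> N ?w" using N_mult_refl[OF S_T[OF sS] w'S] nN w by simp
        ultimately show ?thesis using take_srt w'S w sS by simp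
      qed
    next
      case False
      let ?ts = "map (\<lambda>t. s * t * s) ts"
      have rot: "chain (rev (ds @ [s])) ?ts" "coxeter_word (s # rev ds)"
        using rotate_chain[OF cw(1,2)] by simp_all
      have conc: "u \<in> conc (rev ds @ [s]) ts" using cw(3) by (simp add: is_min_def)
      have min: "is_min (rev (ds @ [s])) ?ts (u * s)"
        using rotate_min[OF cw(1,2) False] cw(3) by simp
      have lu: "len u = len (u * s) + 1" using rotate_conc(2)[OF cw(1,2) False conc] .
      have take_ts: "take i ?ts = map (\<lambda>t. s * t * s) (take i ts)" by (rule take_map)
      have ws: "u * s * prod_list (take i ?ts) = ?w * s"
        unfolding take_ts prod_map_conj[OF sS] using sS by (simp add: mult.assoc invs)
      have wS: "?w \<in> par S" using uS take_par by simp
      \<comment> \<open>The chain shifted by \<open>u\<close> and the rotated one shifted by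
        \<open>u * s\<close> both rise by one per step, so their entries at position
        \<open>i\<close>, namely \<open>?w\<close> and \<open>?w * s\<close>, differ in length as
        \<open>u\<close> and \<open>u * s\<close> do.\<close>
      have sw: "s \<in> N ?w"
      proof -
        have upsu: "ups u ts" and ups': "ups (u * s) ?ts"
          using conc min by (auto simp: is_min_def conc_def)
        have "len (?w * s) < len ?w"
        proof -
          have l1: "len ?w = len u + length (take i ts)"
          proof -
            have "len (u * prod_list ts) = len u + length ts"
              using chain_len[OF cw(1,2) uS upsu] cw(2) by (simp add: chain_def)
            moreover have "len (?w * prod_list (drop i ts)) \<ge> len ?w + length (drop i ts)"
              using ups_len[OF wS, of "drop i ts"] tsT set_drop_subset[of i ts] upsu
                ups_append[of u "take i ts" "drop i ts"] by simp
            moreover have "?w * prod_list (drop i ts) = u * prod_list ts"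
              using prod_list.append[of "take i ts" "drop i ts"] by (simp add: mult.assoc)
            moreover have "len ?w \<ge> len u + length (take i ts)"
              using ups_len[OF uS, of "take i ts"] tsT set_take_subset[of i ts] upsu
                ups_append[of u "take i ts" "drop i ts"] by simp
            ultimately show ?thesis by simp
          qed
          have usS: "u * s \<in> par S" and wsS: "?w * s \<in> par S" using uS wS sS by simp_all
          have T': "set ?ts \<subseteq> T" using map_conj_T[OF sS tsT] .
          have "len (u * s * prod_list ?ts) = len (u * s) + length ?ts"
            using chain_len[OF _ rot(1) usS ups'] rot cw(2) by (simp add: chain_def)
          moreover have "len (?w * s * prod_list (drop i ?ts)) \<ge> len (?w * s) + length (drop i ?ts)"
            using ups_len[OF wsS, of "drop i ?ts"] T' set_drop_subset[of i ?ts] ups'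
              ups_append[of "u * s" "take i ?ts" "drop i ?ts"] ws by simp
          moreover have "?w * s * prod_list (drop i ?ts) = u * s * prod_list ?ts"
            using prod_list.append[of "take i ?ts" "drop i ?ts"] ws by (simp add: mult.assoc[symmetric])
          ultimately have "len (?w * s) \<le> len (u * s) + length (take i ts)" by simp
          then show ?thesis using l1 lu by simp
        qed
        then show ?thesis using S_T[OF sS] by (simp add: N_def)
      qed
      have less_w: "len (?w * s) < len ?w" using sw by (simp add: N_def)
      have "srt (ds @ [s]) (inverse (u * s * prod_list (take i ?ts)))"
        using less.hyps[OF _ ds(4) rot(1) min, of i] less_w Cons unfolding ws by simp
      then show ?thesis using take_srt[OF _ sw wS] unfolding ws by simp
    qed
  qed
qed

section \<open>Sorting words\<close>

definition stream_reduced :: "(nat \<Rightarrow> 'g) \<Rightarrow> 'g \<Rightarrow> nat list \<Rightarrow> bool" where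
  "stream_reduced a x ps \<longleftrightarrow> sorted_wrt (<) ps \<and> reduced (map a ps) \<and> prod_list (map a ps) = x"

definition greedy_step :: "'g \<Rightarrow> 'g \<Rightarrow> 'g" where
  "greedy_step y b = (if b \<in> ldesc y then b * y else y)"

text \<open>The remainder of \<open>x\<close> after the letters \<open>a 0, ..., a (i - 1)\<close>
  have been offered, each being split off on the left whenever it is a left descent.\<close>

primrec greedy :: "(nat \<Rightarrow> 'g) \<Rightarrow> 'g \<Rightarrow> nat \<Rightarrow> 'g" where
  "greedy a x 0 = x"
| "greedy a x (Suc i) = greedy_step (greedy a x i) (a i)"

definition used :: "(nat \<Rightarrow> 'g) \<Rightarrow> 'g \<Rightarrow> nat \<Rightarrow> bool" where
  "used a x i \<longleftrightarrow> a i \<in> ldesc (greedy a x i)"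

lemma greedy_shift: "greedy a x (i + n) = greedy (\<lambda>i. a (i + n)) (greedy a x n) i"
  by (induction i) simp_all

lemma used_shift: "used a x (i + n) = used (\<lambda>i. a (i + n)) (greedy a x n) i"
  by (simp add: used_def greedy_shift)

lemma ldesc_one: "ldesc 1 = {}" by (auto simp: ldesc_def)

lemma greedy_one: "greedy a 1 i = 1"
  by (induction i) (simp_all add: greedy_step_def ldesc_one)

lemma ldesc_word_hd: "reduced (b # ws) \<Longrightarrow> b \<in> ldesc (prod_list (b # ws))"
  using len_le[of ws] by (auto simp: reduced_def ldesc_def invs)

text \<open>A reduced subword must begin with a left descent of \<open>x\<close>, and the greedy
  choice takes the earliest such position; the rest is the same problem for the shifted stream.
  Recurrence of the letters of \<open>J\<close> guarantees that a descent is always found.\<close>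

theorem greedy_sorting:
  assumes "J \<subseteq> S" "x \<in> par J" "\<And>i. a i \<in> S" "\<And>n s. s \<in> J \<Longrightarrow> \<exists>i\<ge>n. a i = s"
  shows "\<exists>ps. set ps = {i. used a x i} \<and> stream_reduced a x ps \<and>
    (\<forall>qs. stream_reduced a x qs \<longrightarrow> ps = qs \<or> (ps, qs) \<in> lexord less_than)"
  using assms(2-4)
proof (induction "len x" arbitrary: x a rule: less_induct)
  case less
  have xS: "x \<in> par S" using less.prems(1) par_subset_S assms(1) by blast
  show ?case
  proof (cases "x = 1")
    case True
    have "qs = []" if "stream_reduced a x qs" for qs
      using that True by (auto simp: stream_reduced_def reduced_def)
    moreover have "stream_reduced a x []" using True by (simp add: stream_reduced_def reduced_def)
    moreover have "{i. used a x i} = {}" using True by (simp add: used_def greedy_one ldesc_one)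
    ultimately show ?thesis by (intro exI[of _ "[]"]) auto
  next
    case False
    then obtain s where s: "s \<in> ldesc x" using ex_ldesc xS by blast
    then have "s \<in> J" using notin_ldesc_par[OF assms(1) _ _ less.prems(1)] by (auto simp: ldesc_def)
    then have "\<exists>i. a i \<in> ldesc x" using less.prems(3) s by metis
    define i0 where "i0 = (LEAST i. a i \<in> ldesc x)"
    have i0: "a i0 \<in> ldesc x" unfolding i0_def by (rule LeastI_ex) fact
    have least: "i0 \<le> i" if "a i \<in> ldesc x" for i unfolding i0_def by (rule Least_le) fact
    have aS: "a i0 \<in> S" using less.prems(2) .
    define y where "y = a i0 * x"
    define a' where "a' = (\<lambda>i. a (i + Suc i0))"
    have "a i0 \<in> J" using notin_ldesc_par[OF assms(1) aS _ less.prems(1)] i0 by blast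
    then have yJ: "y \<in> par J" using less.prems(1) by (auto simp: y_def)
    have xy: "x = a i0 * y" using aS by (simp add: y_def invs)
    have len_y: "len x = len y + 1"
      using len_S_mult[OF xS aS] i0 ldesc_len_pos[OF i0] by (simp add: y_def)
    have stay: "i \<le> i0 \<Longrightarrow> greedy a x i = x" for i
      by (induction i) (use least in \<open>fastforce simp: greedy_step_def\<close>)+
    have next_y: "greedy a x (Suc i0) = y" using stay[of i0] i0 by (simp add: greedy_step_def y_def)
    have used_iff: "used a x i \<longleftrightarrow> i = i0 \<or> (i > i0 \<and> used a' y (i - Suc i0))" for i
    proof -
      consider "i < i0" | "i = i0" | "i > i0" by linarith
      then show ?thesis
      proof cases
        case 1
        then show ?thesis using stay[of i] least[of i] by (auto simp: used_def)
      next
        case 2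
        then show ?thesis using stay[of i] i0 by (simp add: used_def)
      next
        case 3
        then show ?thesis
          using used_shift[of a x "i - Suc i0" "Suc i0"] next_y by (simp add: a'_def)
      qed
    qed
    have "\<exists>ps. set ps = {i. used a' y i} \<and> stream_reduced a' y ps \<and>
        (\<forall>qs. stream_reduced a' y qs \<longrightarrow> ps = qs \<or> (ps, qs) \<in> lexord less_than)"
    proof (rule less.hyps)
      show "len y < len x" using len_y by simp
      show "a' i \<in> S" for i using less.prems(2) by (simp add: a'_def)
      show "\<exists>i\<ge>n. a' i = p" if p: "p \<in> J" for n p
      proof -
        obtain i where "i \<ge> n + Suc i0" "a i = p" using less.prems(3)[OF p] by blast
        then show ?thesis by (intro exI[of _ "i - Suc i0"]) (simp add: a'_def)
      qed
    qed (rule yJ)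
    then obtain ps where ps: "set ps = {i. used a' y i}" "stream_reduced a' y ps"
      "\<And>qs. stream_reduced a' y qs \<Longrightarrow> ps = qs \<or> (ps, qs) \<in> lexord less_than" by blast
    let ?f = "\<lambda>i. i + Suc i0"
    define ps' where "ps' = i0 # map ?f ps"
    have af: "map a (map ?f us) = map a' us" for us by (simp add: a'_def)
    have 1: "set ps' = {i. used a x i}"
    proof -
      have "i \<in> ?f ` {i. used a' y i} \<longleftrightarrow> i > i0 \<and> used a' y (i - Suc i0)" for i
        by (auto simp: image_iff intro!: exI[of _ "i - Suc i0"])
      then show ?thesis by (auto simp: ps'_def ps(1) used_iff)
    qed
    have 2: "stream_reduced a x ps'"
    proof -
      have "sorted_wrt (<) ps'"
        using ps(2) by (auto simp: ps'_def stream_reduced_def sorted_wrt_map)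
      moreover have m: "map a ps' = a i0 # map a' ps" by (simp add: ps'_def af[symmetric])
      moreover have "reduced (map a ps')"
        using ps(2) aS xy len_y unfolding m by (simp add: stream_reduced_def reduced_def)
      ultimately show ?thesis using ps(2) xy by (simp add: stream_reduced_def)
    qed
    have 3: "ps' = qs \<or> (ps', qs) \<in> lexord less_than" if qs: "stream_reduced a x qs" for qs
    proof -
      have "qs \<noteq> []" using qs False by (auto simp: stream_reduced_def)
      then obtain q qs' where q: "qs = q # qs'" by (cases qs) auto
      have red: "reduced (a q # map a qs')" and prod: "a q * prod_list (map a qs') = x"
        and sorted: "sorted_wrt (<) (q # qs')"
        using qs q by (auto simp: stream_reduced_def)
      then have "a q \<in> ldesc x" using ldesc_word_hd[OF red] by simp
      then have "i0 \<le> q" by (rule least)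
      show ?thesis
      proof (cases "q = i0")
        case True
        define rs where "rs = map (\<lambda>i. i - Suc i0) qs'"
        have "\<forall>i\<in>set qs'. i > i0" using sorted True by auto
        then have qs': "qs' = map ?f rs" unfolding rs_def by (induction qs') auto
        have "prod_list (map a qs') = y" using prod True aS by (auto simp: y_def invs)
        moreover have "reduced (map a qs')" using reduced_suffix[of "[a q]"] red by simp
        moreover have "sorted_wrt (<) rs" using sorted unfolding qs' by (simp add: sorted_wrt_map)
        ultimately have "stream_reduced a' y rs"
          unfolding qs' af by (simp add: stream_reduced_def)
        then consider "ps = rs" | "(ps, rs) \<in> lexord less_than" using ps(3) by blast
        then show ?thesis
          by cases (use True q qs' lexord_map_add[of ps rs "Suc i0"] in \<open>auto simp: ps'_def\<close>)
      next
        case False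
        then show ?thesis using \<open>i0 \<le> q\<close> q by (simp add: ps'_def)
      qed
    qed
    show ?thesis using 1 2 3 by blast
  qed
qed

section \<open>The periodic word and nested letter sets\<close>

definition cyc :: "'g list \<Rightarrow> nat \<Rightarrow> 'g" where
  "cyc cw i = cw ! (i mod length cw)"

definition greedy_round :: "'g list \<Rightarrow> 'g \<Rightarrow> 'g" where
  "greedy_round cw x = foldl greedy_step x cw"

lemma greedy_foldl: "greedy a x i = foldl greedy_step x (map a [0..<i])"
  by (induction i) simp_all

lemma greedy_prefix: "j \<le> length cw \<Longrightarrow> greedy (cyc cw) x j = foldl greedy_step x (take j cw)"
proof -
  assume j: "j \<le> length cw"
  have "map (cyc cw) [0..<j] = take j cw"
    by (rule nth_equalityI) (use j in \<open>auto simp: cyc_def\<close>)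
  then show ?thesis by (simp add: greedy_foldl)
qed

lemma greedy_rounds: "greedy (cyc cw) x (k * length cw) = (greedy_round cw ^^ k) x"
proof (induction k)
  case (Suc k)
  have "(\<lambda>i. cyc cw (i + k * length cw)) = cyc cw" by (simp add: cyc_def fun_eq_iff)
  then show ?case
    using greedy_shift[of "cyc cw" x "length cw" "k * length cw"] Suc greedy_prefix[of "length cw" cw]
    by (simp add: greedy_round_def)
qed simp

lemma used_rounds:
  assumes "j < length cw"
  shows "used (cyc cw) x (j + k * length cw) \<longleftrightarrow>
    cw ! j \<in> ldesc (foldl greedy_step ((greedy_round cw ^^ k) x) (take j cw))"
proof -
  have "(\<lambda>i. cyc cw (i + k * length cw)) = cyc cw" by (simp add: cyc_def fun_eq_iff)
  then show ?thesis
    using used_shift[of "cyc cw" x j "k * length cw"] greedy_rounds[of cw x k] assms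
    by (simp add: used_def greedy_prefix) (simp add: cyc_def)
qed

text \<open>Position \<open>i + length cw\<close> carries the letter of position \<open>i\<close>
  one copy later, so this is the inclusion of consecutive letter sets. In terms of positions it
  behaves well under shifting the stream by one letter.\<close>

definition nested :: "'g list \<Rightarrow> 'g \<Rightarrow> bool" where
  "nested cw x \<longleftrightarrow> (\<forall>i. used (cyc cw) x (i + length cw) \<longrightarrow> used (cyc cw) x i)"

lemma nested_rounds:
  "nested cw x \<longleftrightarrow> (\<forall>k. \<forall>j<length cw.
    cw ! j \<in> ldesc (foldl greedy_step ((greedy_round cw ^^ Suc k) x) (take j cw)) \<longrightarrow>
    cw ! j \<in> ldesc (foldl greedy_step ((greedy_round cw ^^ k) x) (take j cw)))"
proof (cases "cw = []")
  case False
  then have pos: "length cw > 0" by simp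
  have "nested cw x \<longleftrightarrow> (\<forall>k. \<forall>j<length cw. used (cyc cw) x (j + Suc k * length cw) \<longrightarrow>
      used (cyc cw) x (j + k * length cw))"
  proof
    assume *: "nested cw x"
    have "j + Suc k * length cw = (j + k * length cw) + length cw" for j k by simp
    then show "\<forall>k. \<forall>j<length cw. used (cyc cw) x (j + Suc k * length cw) \<longrightarrow>
        used (cyc cw) x (j + k * length cw)"
      using * unfolding nested_def by presburger
  next
    assume *: "\<forall>k. \<forall>j<length cw. used (cyc cw) x (j + Suc k * length cw) \<longrightarrow>
        used (cyc cw) x (j + k * length cw)"
    show "nested cw x"
      unfolding nested_def
    proof (intro allI impI)
      fix i assume u: "used (cyc cw) x (i + length cw)"
      let ?j = "i mod length cw" and ?k = "i div length cw"
      have i: "i = ?j + ?k * length cw" by (simp add: mult.commute)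
      have "i + length cw = ?j + Suc ?k * length cw" using i by simp
      then have "used (cyc cw) x (?j + Suc ?k * length cw)" using u by simp
      then have "used (cyc cw) x (?j + ?k * length cw)" using * pos mod_less_divisor by blast
      then show "used (cyc cw) x i" using i by simp
    qed
  qed
  then show ?thesis using used_rounds by (simp del: funpow.simps mult_Suc)
qed (simp add: nested_def)

text \<open>Position 0 is used, so the one condition lost by the shift holds anyway.\<close>

lemma nested_take:
  assumes "s \<in> ldesc x" shows "nested (s # ds) x \<longleftrightarrow> nested (ds @ [s]) (s * x)"
proof -
  have sh: "(\<lambda>i. cyc (s # ds) (i + 1)) = cyc (ds @ [s])"
  proof
    fix i
    have "rotate1 (s # ds) ! (i mod Suc (length ds)) =
        (s # ds) ! (Suc (i mod Suc (length ds)) mod Suc (length ds))"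
      using nth_rotate1[of "i mod Suc (length ds)" "s # ds"] by simp
    then show "cyc (s # ds) (i + 1) = cyc (ds @ [s]) i"
      by (simp add: cyc_def mod_Suc_eq)
  qed
  have u: "used (cyc (s # ds)) x (Suc i) = used (cyc (ds @ [s])) (s * x) i" for i
    using used_shift[of "cyc (s # ds)" x i 1] sh assms by (simp add: greedy_step_def cyc_def)
  have u0: "used (cyc (s # ds)) x 0" using assms by (simp add: used_def cyc_def)
  have "nested (s # ds) x \<longleftrightarrow> (\<forall>i. used (cyc (s # ds)) x (Suc i + length (s # ds)) \<longrightarrow>
      used (cyc (s # ds)) x (Suc i))"
    unfolding nested_def using u0 by (metis not0_implies_Suc)
  then show ?thesis by (simp add: u nested_def)
qed

lemma foldl_greedy_par:
  assumes "J \<subseteq> S" "set ws \<subseteq> S" "x \<in> par J" shows "foldl greedy_step x ws \<in> par J"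
  using assms(2,3)
proof (induction ws arbitrary: x)
  case (Cons b ws)
  have "greedy_step x b \<in> par J"
    using Cons.prems notin_ldesc_par[OF assms(1), of b x] by (auto simp: greedy_step_def)
  then show ?case using Cons by simp
qed simp

lemma nested_skip:
  assumes cw: "coxeter_word (s # ds)" and x: "x \<in> par (set ds)"
  shows "nested (s # ds) x \<longleftrightarrow> nested ds x"
proof -
  have sub: "set ds \<subseteq> S" and s: "s \<in> S" "s \<notin> set ds" using cw by (auto simp: coxeter_word_def)
  have step: "greedy_step y s = y" "s \<notin> ldesc y" if "y \<in> par (set ds)" for y
    using notin_ldesc_par[OF sub s that] by (auto simp: greedy_step_def)
  have r: "greedy_round (s # ds) y = greedy_round ds y" "greedy_round ds y \<in> par (set ds)"
    if "y \<in> par (set ds)" for y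
    using that step foldl_greedy_par[OF sub sub] by (simp_all add: greedy_round_def)
  have rd: "(greedy_round (s # ds) ^^ k) x = (greedy_round ds ^^ k) x \<and>
      (greedy_round ds ^^ k) x \<in> par (set ds)" for k
    by (induction k) (use x r in simp_all)
  have key: "(s # ds) ! j \<in> ldesc (foldl greedy_step ((greedy_round (s # ds) ^^ k) x) (take j (s # ds))) \<longleftrightarrow>
      (\<exists>i. j = Suc i \<and> ds ! i \<in> ldesc (foldl greedy_step ((greedy_round ds ^^ k) x) (take i ds)))" for j k
    using rd[of k] step by (cases j) auto
  show ?thesis
    unfolding nested_rounds key by (auto simp: less_Suc_eq_0_disj)
qed

lemma cyc_eq_hd:
  assumes "distinct (s # ds)" shows "cyc (s # ds) i = s \<longleftrightarrow> length (s # ds) dvd i"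
proof -
  have "cyc (s # ds) i = (s # ds) ! 0 \<longleftrightarrow> i mod length (s # ds) = 0"
    unfolding cyc_def by (rule nth_eq_iff_index_eq[OF assms]) simp_all
  then show ?thesis by (simp add: dvd_eq_mod_eq_0)
qed

lemma cyc_in: "cw \<noteq> [] \<Longrightarrow> cyc cw i \<in> set cw"
  by (simp add: cyc_def)

lemma cyc_recurrent: assumes "s \<in> set cw" shows "\<exists>i\<ge>n. cyc cw i = s"
proof -
  obtain j where j: "j < length cw" "cw ! j = s" using assms by (auto simp: in_set_conv_nth)
  then have "n \<le> j + n * length cw" "cyc cw (j + n * length cw) = s"
    by (auto simp: cyc_def intro: trans_le_add2)
  then show ?thesis by blast
qed

lemma greedy_sorting_cyc:
  assumes "coxeter_word cw" "cw \<noteq> []" "x \<in> par (set cw)"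
  shows "\<exists>ps. set ps = {i. used (cyc cw) x i} \<and> stream_reduced (cyc cw) x ps \<and>
    (\<forall>qs. stream_reduced (cyc cw) x qs \<longrightarrow> ps = qs \<or> (ps, qs) \<in> lexord less_than)"
  by (rule greedy_sorting[of "set cw"])
    (use assms cyc_in cyc_recurrent in \<open>auto simp: coxeter_word_def\<close>)

theorem nested_iff_srt:
  assumes "coxeter_word cw" "x \<in> par (set cw)" shows "nested cw x \<longleftrightarrow> srt cw x"
  using assms
proof (induction "length cw + len x" arbitrary: cw x rule: less_induct)
  case less
  show ?case
  proof (cases cw)
    case Nil
    then show ?thesis using less.prems srt_Nil by (simp add: nested_def used_def greedy_one ldesc_one)
  next
    case (Cons s ds)
    have cw: "coxeter_word (s # ds)" and sub: "set (s # ds) \<subseteq> S" and sub': "set ds \<subseteq> S"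
      and s: "s \<in> S" "s \<notin> set ds" "coxeter_word ds" "coxeter_word (ds @ [s])"
      using less.prems Cons by (auto simp: coxeter_word_def)
    have xS: "x \<in> par S" using less.prems Cons par_subset_S[OF sub] by simp
    show ?thesis
    proof (cases "s \<in> ldesc x")
      case True
      have "s * x \<in> par (set (ds @ [s]))" using less.prems(2) Cons by auto
      moreover have "len (s * x) < len x" using True by (simp add: ldesc_def)
      ultimately have "nested (ds @ [s]) (s * x) \<longleftrightarrow> srt (ds @ [s]) (s * x)"
        using less.hyps[of "ds @ [s]" "s * x"] s Cons by simp
      moreover have "srt (s # ds) x \<longleftrightarrow> srt (ds @ [s]) (s * x)"
      proof
        assume "srt (s # ds) x"
        then show "srt (ds @ [s]) (s * x)"
        proof cases
          case srt_skip
          then show ?thesis using srt_par notin_ldesc_par[OF sub' s(1,2)] True by blast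
        next
          case (srt_take x')
          then show ?thesis using s by (simp add: invs)
        qed
      next
        assume "srt (ds @ [s]) (s * x)"
        moreover have "s \<notin> ldesc (s * x)" using not_ldesc_mult xS s True by blast
        ultimately show "srt (s # ds) x" using srt_take[of ds s "s * x"] s by (simp add: invs)
      qed
      ultimately show ?thesis using nested_take[OF True] Cons by simp
    next
      case False
      have "srt (s # ds) x \<longleftrightarrow> srt ds x"
      proof
        assume "srt (s # ds) x"
        then show "srt ds x"
        proof cases
          case (srt_take x')
          have "x' = s * x" using srt_take(1) s by (simp add: invs)
          then have "x' \<in> par S" using s xS by simp
          then show ?thesis using not_ldesc_mult s srt_take False by blast
        qed
      qed (use srt_skip s in blast)
      moreover have "nested (s # ds) x \<longleftrightarrow> srt ds x"
      proof (cases "x \<in> par (set ds)")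
        case True
        then show ?thesis using nested_skip[OF cw True] less.hyps[of ds x] s Cons by simp
      next
        case False': False
        have "\<not> nested (s # ds) x"
        proof
          assume n: "nested (s # ds) x"
          have nu: "\<not> used (cyc (s # ds)) x (k * length (s # ds))" for k
          proof (induction k)
            case 0
            then show ?case using False by (simp add: used_def cyc_def)
          next
            case (Suc k)
            then show ?case using n unfolding nested_def by (metis add.commute mult_Suc)
          qed
          obtain ps where ps: "set ps = {i. used (cyc (s # ds)) x i}" "stream_reduced (cyc (s # ds)) x ps"
            using greedy_sorting_cyc[OF cw _, of x] less.prems(2) Cons by auto
          have "set (map (cyc (s # ds)) ps) \<subseteq> set ds"
          proof
            fix b assume "b \<in> set (map (cyc (s # ds)) ps)"
            then obtain i where i: "used (cyc (s # ds)) x i" "b = cyc (s # ds) i" using ps(1) by auto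
            have "b \<noteq> s"
            proof
              assume "b = s"
              then have "length (s # ds) dvd i" using cyc_eq_hd[of s ds i] cw i by (simp add: coxeter_word_def)
              then obtain k where "i = k * length (s # ds)" by (metis dvd_def mult.commute)
              then show False using nu i by blast
            qed
            then show "b \<in> set ds" using cyc_in[of "s # ds" i] i by simp
          qed
          then have "prod_list (map (cyc (s # ds)) ps) \<in> par (set ds)" by (rule prod_list_in_par)
          then show False using ps(2) False' by (simp add: stream_reduced_def)
        qed
        then show ?thesis using False' srt_par by blast
      qed
      ultimately show ?thesis using Cons by simp
    qed
  qed
qed

section \<open>Reflection length\<close>

definition tlen :: "'g \<Rightarrow> nat" where
  "tlen x = (LEAST n. \<exists>ts\<in>lists T. length ts = n \<and> prod_list ts = x)"

lemma tlen_le: "set ts \<subseteq> T \<Longrightarrow> tlen (prod_list ts) \<le> length ts"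
  unfolding tlen_def by (rule Least_le) auto

lemma ex_tlen:
  assumes "x \<in> par S" obtains ts where "set ts \<subseteq> T" "length ts = tlen x" "prod_list ts = x"
proof -
  obtain ws where "ws \<in> lists S" "x = prod_list ws" using assms by (rule parE)
  then have "\<exists>n. \<exists>ts\<in>lists T. length ts = n \<and> prod_list ts = x"
    using S_T by (intro exI[of _ "length ws"] bexI[of _ ws]) auto
  from LeastI_ex[OF this] show ?thesis using that by (auto simp: tlen_def)
qed

lemma tlen_mult_le:
  assumes "x \<in> par S" "y \<in> par S" shows "tlen (x * y) \<le> tlen x + tlen y"
proof -
  obtain us where us: "set us \<subseteq> T" "length us = tlen x" "prod_list us = x" by (rule ex_tlen[OF assms(1)])
  obtain vs where vs: "set vs \<subseteq> T" "length vs = tlen y" "prod_list vs = y" by (rule ex_tlen[OF assms(2)])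
  show ?thesis using us vs tlen_le[of "us @ vs"] by simp
qed

lemma tlen_one: "tlen 1 = 0"
  using tlen_le[of "[]"] by simp

lemma tlen_eq_0: assumes "x \<in> par S" "tlen x = 0" shows "x = 1"
proof -
  obtain ts where "set ts \<subseteq> T" "length ts = tlen x" "prod_list ts = x" by (rule ex_tlen[OF assms(1)])
  then show ?thesis using assms by simp
qed

text \<open>The first reflection \<open>t\<close> of a shortest factorization of
  \<open>inverse u * v\<close> gives an element \<open>u * t\<close> of the interval that differs
  from \<open>u\<close>; in a cover it must be \<open>v\<close>.\<close>

lemma cover_refl:
  assumes uv: "u \<in> par S" "v \<in> par S" "u \<noteq> v" "tlen u + tlen (inverse u * v) = tlen v"
    and cov: "\<And>x. x \<in> par S \<Longrightarrow> tlen u + tlen (inverse u * x) = tlen x \<Longrightarrow>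
      tlen x + tlen (inverse x * v) = tlen v \<Longrightarrow> x = u \<or> x = v"
  shows "inverse u * v \<in> T"
proof -
  have "inverse u * v \<in> par S" using uv by simp
  then obtain ts where ts: "set ts \<subseteq> T" "length ts = tlen (inverse u * v)" "prod_list ts = inverse u * v"
    by (rule ex_tlen)
  have "inverse u * v \<noteq> 1"
    using uv(3) by (metis cancel_inv_left mult_1_right)
  then obtain t rs where t: "ts = t # rs" using ts by (cases ts) auto
  have tT: "t \<in> T" and rs: "set rs \<subseteq> T" using ts t by auto
  define x where "x = u * t"
  have xS: "x \<in> par S" using uv tT by (simp add: x_def)
  have "v = u * (inverse u * v)" by (simp add: cancel_inv_left)
  also have "\<dots> = x * prod_list rs" using ts(3) t by (simp add: x_def mult.assoc[symmetric] flip: ts(3))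
  finally have v: "v = x * prod_list rs" .
  have "inverse x * v = prod_list rs" by (simp add: v inv_cancel_left)
  then have 1: "tlen (inverse x * v) \<le> length rs" using tlen_le[OF rs] by simp
  have "inverse u * x = t" by (simp add: x_def inv_cancel_left)
  then have 2: "tlen (inverse u * x) \<le> 1" using tlen_le[of "[t]"] tT by simp
  have 3: "tlen x \<le> tlen u + tlen (inverse u * x)"
    using tlen_mult_le[of u "inverse u * x"] uv xS by (simp add: cancel_inv_left)
  have 4: "tlen v \<le> tlen x + tlen (inverse x * v)"
    using tlen_mult_le[of x "inverse x * v"] uv xS by (simp add: cancel_inv_left)
  have "tlen v = tlen u + 1 + length rs" using uv(4) ts(2) t by simp
  then have "tlen u + tlen (inverse u * x) = tlen x" "tlen x + tlen (inverse x * v) = tlen v"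
    using 1 2 3 4 by linarith+
  then have "x = u \<or> x = v" using cov xS by blast
  moreover have "x \<noteq> u"
  proof
    assume "x = u"
    then have "u * t = u * 1" by (simp add: x_def)
    then have "t = 1" by (simp only: left_cancel)
    then show False using refl_mem_self_N[OF tT] by simp
  qed
  ultimately show ?thesis using tT \<open>inverse u * x = t\<close> by simp
qed

text \<open>A shorter factorization of a segment would shorten the whole chain below the reflection
  length of the Coxeter word.\<close>

lemma chain_tlen:
  assumes "coxeter_word cs" "chain cs ts" "ts = us @ vs @ ws"
  shows "tlen (prod_list vs) = length vs"
proof (rule antisym)
  have T: "set us \<subseteq> T" "set vs \<subseteq> T" "set ws \<subseteq> T" using assms by (auto simp: chain_def)
  show "tlen (prod_list vs) \<le> length vs" using T by (intro tlen_le)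
  obtain rs where rs: "set rs \<subseteq> T" "length rs = tlen (prod_list vs)" "prod_list rs = prod_list vs"
    using ex_tlen[OF prod_refls_par[OF T(2)]] by blast
  have "prod_list (us @ rs @ ws) = prod_list cs" using assms rs by (simp add: chain_def)
  then have "length cs \<le> length (us @ rs @ ws)"
    using assms(1) T rs by (intro distinct_word_tlength) (auto simp: coxeter_word_def)
  then show "length vs \<le> tlen (prod_list vs)" using assms rs by (simp add: chain_def)
qed

lemma chain_cover:
  assumes "coxeter_word cs" "chain cs ts" "i < length ts" "x \<in> par S"
    "tlen (prod_list (take i ts)) + tlen (inverse (prod_list (take i ts)) * x) = tlen x"
    "tlen x + tlen (inverse x * prod_list (take (Suc i) ts)) = tlen (prod_list (take (Suc i) ts))"
  shows "x = prod_list (take i ts) \<or> x = prod_list (take (Suc i) ts)"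
proof -
  define p q where "p = prod_list (take i ts)" and "q = prod_list (take (Suc i) ts)"
  have l: "tlen p = i" "tlen q = Suc i"
    using chain_tlen[OF assms(1,2), of "[]" "take i ts" "drop i ts"]
      chain_tlen[OF assms(1,2), of "[]" "take (Suc i) ts" "drop (Suc i) ts"] assms(3)
    by (simp_all add: p_def q_def)
  have "set (take j ts) \<subseteq> T" for j using assms(2) set_take_subset[of j ts] by (auto simp: chain_def)
  then have S: "p \<in> par S" "q \<in> par S" by (simp_all add: p_def q_def prod_refls_par)
  have "tlen x = i \<or> tlen x = Suc i" using assms(5,6) l unfolding p_def q_def by linarith
  then show ?thesis
  proof
    assume "tlen x = i"
    then have "inverse p * x = 1" using assms(4,5) l S by (intro tlen_eq_0) (auto simp: p_def)
    then have "p * (inverse p * x) = p" by simp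
    then show ?thesis by (simp add: cancel_inv_left p_def)
  next
    assume "tlen x = Suc i"
    then have "inverse x * q = 1" using assms(4,6) l S by (intro tlen_eq_0) (auto simp: q_def)
    then have "x * (inverse x * q) = x" by simp
    then show ?thesis by (simp add: cancel_inv_left q_def)
  qed
qed

lemma ups_iff_nth: "ups x ts \<longleftrightarrow> (\<forall>i<length ts. ts ! i \<notin> N (x * prod_list (take i ts)))"
proof (induction ts arbitrary: x)
  case (Cons t ts)
  show ?case by (simp add: Cons All_less_Suc2 mult.assoc)
qed simp

end

section \<open>The left regular representation\<close>

typedef 'a bijection = "{f :: 'a \<Rightarrow> 'a. bij f}"
  by (rule exI[of _ id]) simp

setup_lifting type_definition_bijection

instantiation bijection :: (type) mult_group
begin

lift_definition one_bijection :: "'a bijection" is id by simp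
lift_definition times_bijection :: "'a bijection \<Rightarrow> 'a bijection \<Rightarrow> 'a bijection" is "(\<circ>)"
  by (rule bij_comp)
lift_definition inverse_bijection :: "'a bijection \<Rightarrow> 'a bijection" is "inv_into UNIV"
  by (rule bij_imp_bij_inv)
definition divide_bijection :: "'a bijection \<Rightarrow> 'a bijection \<Rightarrow> 'a bijection" where
  "divide_bijection f g = f * inverse g"

instance
  by standard (transfer; auto simp: fun_eq_iff bij_is_inj)+

end

text \<open>Left translation, extended by the identity outside the carrier so that it is a bijection
  of the whole type.\<close>

definition reg :: "('a, 'b) monoid_scheme \<Rightarrow> 'a \<Rightarrow> 'a bijection" where
  "reg W w = Abs_bijection (\<lambda>x. if x \<in> carrier W then w \<otimes>\<^bsub>W\<^esub> x else x)"

context group begin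

lemma bij_reg:
  assumes "w \<in> carrier G" shows "bij (\<lambda>x. if x \<in> carrier G then w \<otimes> x else x)"
proof (rule o_bij)
  let ?f = "\<lambda>w x. if x \<in> carrier G then w \<otimes> x else x"
  show "?f (inv w) \<circ> ?f w = id" "?f w \<circ> ?f (inv w) = id"
    using assms by (auto simp: fun_eq_iff m_assoc[symmetric])
qed

lemma Rep_reg:
  "w \<in> carrier G \<Longrightarrow> Rep_bijection (reg G w) = (\<lambda>x. if x \<in> carrier G then w \<otimes> x else x)"
  by (simp add: reg_def Abs_bijection_inverse bij_reg)

lemma reg_mult:
  assumes "u \<in> carrier G" "v \<in> carrier G" shows "reg G (u \<otimes> v) = reg G u * reg G v"
proof -
  have "Rep_bijection (reg G (u \<otimes> v)) = Rep_bijection (reg G u * reg G v)"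
    using assms by (auto simp: Rep_reg times_bijection.rep_eq fun_eq_iff m_assoc)
  then show ?thesis by (simp add: Rep_bijection_inject)
qed

lemma reg_one: "reg G \<one> = 1"
proof -
  have "Rep_bijection (reg G \<one>) = Rep_bijection 1"
    by (auto simp: Rep_reg one_bijection.rep_eq fun_eq_iff)
  then show ?thesis by (simp add: Rep_bijection_inject)
qed

lemma inj_reg: "inj_on (reg G) (carrier G)"
proof (rule inj_onI)
  fix u v assume *: "u \<in> carrier G" "v \<in> carrier G" "reg G u = reg G v"
  have "Rep_bijection (reg G u) \<one> = u" "Rep_bijection (reg G v) \<one> = v"
    using *(1,2) by (simp_all add: Rep_reg)
  then show "u = v" unfolding *(3) by (rule trans[OF sym])
qed

lemma reg_eq_iff: "u \<in> carrier G \<Longrightarrow> v \<in> carrier G \<Longrightarrow> reg G u = reg G v \<longleftrightarrow> u = v"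
  by (rule inj_on_eq_iff[OF inj_reg])

lemma reg_inv: "w \<in> carrier G \<Longrightarrow> reg G (inv w) = inverse (reg G w)"
proof -
  assume "w \<in> carrier G"
  then have "reg G w * reg G (inv w) = 1" using reg_mult[of w "inv w"] reg_one by simp
  then show ?thesis by (rule mult_group_class.inv_unique[symmetric])
qed

lemma reg_pow: "w \<in> carrier G \<Longrightarrow> reg G (w [^] (n::nat)) = reg G w ^ n"
  by (induction n) (simp_all add: reg_one reg_mult power_commutes)

lemma word_prod_closed: "set ws \<subseteq> carrier G \<Longrightarrow> word_prod G ws \<in> carrier G"
  by (induction ws) (simp_all add: word_prod_def)

lemma reg_word_prod:
  "set ws \<subseteq> carrier G \<Longrightarrow> reg G (word_prod G ws) = prod_list (map (reg G) ws)"
  using word_prod_closed by (induction ws) (simp_all add: word_prod_def reg_one reg_mult)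

lemma gen_length_reg:
  assumes "A \<subseteq> carrier G" "w \<in> carrier G"
  shows "gen_length G A w = (LEAST n. \<exists>ws\<in>lists (reg G ` A). length ws = n \<and> prod_list ws = reg G w)"
proof -
  have "(\<exists>ws\<in>lists A. length ws = n \<and> word_prod G ws = w) \<longleftrightarrow>
      (\<exists>ws\<in>lists (reg G ` A). length ws = n \<and> prod_list ws = reg G w)" for n
  proof -
    have "word_prod G ws = w \<longleftrightarrow> prod_list (map (reg G) ws) = reg G w" if "ws \<in> lists A" for ws
    proof -
      have "set ws \<subseteq> carrier G" using that assms by auto
      then show ?thesis
        using reg_word_prod[of ws] reg_eq_iff[OF word_prod_closed assms(2), of ws] by simp
    qed
    then show ?thesis unfolding lists_image by auto
  qed
  then show ?thesis by (simp add: gen_length_def)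
qed

end

section \<open>Transfer to the given group\<close>

locale finite_coxeter_system =
  fixes W :: "('a, 'b) monoid_scheme" (structure) and S :: "'a set"
  assumes coxeter: "coxeter_system W S" and finite_carrier: "finite (carrier W)"
begin

sublocale group W
  using coxeter by (simp add: coxeter_system_def)

lemma S_carrier: "S \<subseteq> carrier W"
  using coxeter by (simp add: coxeter_system_def)

lemma S_invol: assumes "s \<in> S" shows "s \<otimes> s = \<one>" "inv s = s"
proof -
  have s: "s \<in> carrier W" "ord s = 2"
    using assms coxeter by (auto simp: coxeter_system_def)
  then have "s [^] (2::nat) = \<one>" using pow_ord_eq_1 by metis
  then show "s \<otimes> s = \<one>" using s by (simp add: numeral_2_eq_2)
  then show "inv s = s" using s by (simp add: inv_equality)
qed

definition mat :: "'a bijection \<Rightarrow> 'a bijection \<Rightarrow> nat" where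
  "mat a b = ord (inv_into (carrier W) (reg W) a \<otimes> inv_into (carrier W) (reg W) b)"

lemma mat_reg: "s \<in> S \<Longrightarrow> t \<in> S \<Longrightarrow> mat (reg W s) (reg W t) = ord (s \<otimes> t)"
  using S_carrier by (simp add: mat_def inv_into_f_f[OF inj_reg] subset_iff)

lemma par_reg_subset: "par (reg W ` S) \<subseteq> reg W ` carrier W"
proof
  fix x assume "x \<in> par (reg W ` S)"
  then obtain ws where "ws \<in> lists S" "x = prod_list (map (reg W) ws)"
    by (auto simp: par_def lists_image)
  moreover from this have "set ws \<subseteq> carrier W" using S_carrier by auto
  ultimately show "x \<in> reg W ` carrier W"
    using reg_word_prod[of ws] word_prod_closed[of ws] by (metis imageI)
qed

lemma relator_reg:
  assumes "relator_deletion W S us vs"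
  shows "delete_relator (reg W ` S) mat (map (reg W) us) (map (reg W) vs)"
  using assms
proof cases
  case (1 us vs s t)
  have "map (reg W) (concat (replicate (ord (s \<otimes> t)) [s, t])) =
      concat (replicate (mat (reg W s) (reg W t)) [reg W s, reg W t])"
    using mat_reg[OF 1(5,6)] by (simp add: map_concat)
  then show ?thesis
    using delete_relator.intros[of "map (reg W) us" "reg W ` S" "map (reg W) vs" "reg W s" "reg W t" mat] 1
    by (auto simp: lists_image)
qed

sublocale C: coxeter "reg W ` S" mat
proof
  show "s * s = 1" if "s \<in> reg W ` S" for s
    using that S_carrier S_invol by (auto simp flip: reg_mult simp: reg_one subset_iff)
  show "1 \<notin> reg W ` S"
  proof
    assume "1 \<in> reg W ` S"
    then obtain s where s: "s \<in> S" "reg W s = reg W \<one>" by (auto simp: reg_one)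
    then have "s = \<one>" using S_carrier reg_eq_iff by auto
    then show False using coxeter s by (auto simp: coxeter_system_def)
  qed
  show "finite (par (reg W ` S))"
    using finite_subset[OF par_reg_subset] finite_carrier by blast
  show "(s * t) ^ mat s t = 1" if st: "s \<in> reg W ` S" "t \<in> reg W ` S" for s t
  proof -
    obtain a b where ab: "a \<in> S" "b \<in> S" "s = reg W a" "t = reg W b" using st by auto
    have c: "a \<in> carrier W" "b \<in> carrier W" using ab S_carrier by auto
    have "(s * t) ^ mat s t = reg W (a \<otimes> b) ^ ord (a \<otimes> b)"
      using ab c by (simp add: mat_reg reg_mult)
    then show ?thesis using c reg_pow[of "a \<otimes> b" "ord (a \<otimes> b)"] by (simp add: reg_one)
  qed
  show "mat s s = 1" if "s \<in> reg W ` S" for s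
    using that S_invol by (auto simp: mat_reg)
  show "mat s t > 0" if st: "s \<in> reg W ` S" "t \<in> reg W ` S" for s t
  proof -
    obtain a b where ab: "a \<in> S" "b \<in> S" "s = reg W a" "t = reg W b" using st by auto
    then have "a \<otimes> b \<in> carrier W" using S_carrier by auto
    then show ?thesis using ord_ge_1[OF finite_carrier, of "a \<otimes> b"] ab by (simp add: mat_reg)
  qed
  show "mat s t = mat t s" if st: "s \<in> reg W ` S" "t \<in> reg W ` S" for s t
  proof -
    obtain a b where ab: "a \<in> S" "b \<in> S" "s = reg W a" "t = reg W b" using st by auto
    have c: "a \<in> carrier W" "b \<in> carrier W" using ab S_carrier by auto
    have "inv (a \<otimes> b) = b \<otimes> a" using c ab S_invol by (simp add: inv_mult_group)
    then show ?thesis using ord_inv[of "a \<otimes> b"] c ab by (simp add: mat_reg)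
  qed
  show "equivclp (delete_relator (reg W ` S) mat) us vs"
    if uv: "us \<in> lists (reg W ` S)" "vs \<in> lists (reg W ` S)" "prod_list us = prod_list vs" for us vs
  proof -
    obtain us' vs' where *: "us' \<in> lists S" "vs' \<in> lists S" "us = map (reg W) us'" "vs = map (reg W) vs'"
      using uv by (auto simp: lists_image)
    have c: "set us' \<subseteq> carrier W" "set vs' \<subseteq> carrier W" using * S_carrier by auto
    have "word_prod W us' = word_prod W vs'"
      using uv(3) * c reg_eq_iff[OF word_prod_closed[OF c(1)] word_prod_closed[OF c(2)]]
      by (simp add: reg_word_prod)
    then have "equivclp (relator_deletion W S) us' vs'"
      using coxeter * by (auto simp: coxeter_system_def)
    then have "equivclp (delete_relator (reg W ` S) mat) (map (reg W) us') (map (reg W) vs')"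
    proof (induction rule: equivclp_induct)
      case (step y z)
      then show ?case using relator_reg by (blast intro: equivclp_into_equivclp)
    qed simp
    then show ?thesis using * by simp
  qed
qed

lemma par_reg: "par (reg W ` S) = reg W ` carrier W"
proof
  show "reg W ` carrier W \<subseteq> par (reg W ` S)"
  proof safe
    fix w assume "w \<in> carrier W"
    then have "w \<in> generate W S" using coxeter by (simp add: coxeter_system_def)
    then show "reg W w \<in> par (reg W ` S)"
    proof induction
      case (eng h1 h2)
      then have "h1 \<in> carrier W" "h2 \<in> carrier W"
        using generate_in_carrier[OF S_carrier] by auto
      then show ?case using eng by (simp add: reg_mult)
    qed (auto simp: reg_one S_invol)
  qed
qed (rule par_reg_subset)

lemma reg_par: "w \<in> carrier W \<Longrightarrow> reg W w \<in> par (reg W ` S)"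
  by (simp add: par_reg)

lemma len_reg: "w \<in> carrier W \<Longrightarrow> C.len (reg W w) = length_S W S w"
  using gen_length_reg[OF S_carrier, of w] by (simp add: C.len_def)

lemma refl_carrier: "reflections W S \<subseteq> carrier W"
  using S_carrier by (auto simp: reflections_def)

lemma T_reg: "C.T = reg W ` reflections W S"
proof -
  have "reg W (w \<otimes> s \<otimes> inv w) = reg W w * reg W s * inverse (reg W w)"
    if "w \<in> carrier W" "s \<in> S" for w s
    using that S_carrier by (auto simp: reg_mult reg_inv subset_iff)
  then show ?thesis
    unfolding C.T_def reflections_def par_reg by (force simp: image_iff)
qed

lemma tlen_reg: "w \<in> carrier W \<Longrightarrow> C.tlen (reg W w) = length_T W S w"
  using gen_length_reg[OF refl_carrier, of w] by (simp add: C.tlen_def T_reg)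

abbreviation \<phi> :: "'a \<Rightarrow> 'a bijection" where "\<phi> \<equiv> reg W"

lemma reduced_word_reg:
  assumes "ws \<in> lists S" "w \<in> carrier W"
  shows "reduced_word W S w ws \<longleftrightarrow> C.reduced (map \<phi> ws) \<and> prod_list (map \<phi> ws) = \<phi> w"
proof -
  have c: "set ws \<subseteq> carrier W" using assms S_carrier by auto
  have "word_prod W ws = w \<longleftrightarrow> prod_list (map \<phi> ws) = \<phi> w"
    using reg_eq_iff[OF word_prod_closed[OF c] assms(2)] reg_word_prod[OF c] by simp
  then show ?thesis
    using assms len_reg[OF assms(2)] by (auto simp: reduced_word_def C.reduced_def)
qed

lemma ex_reduced_word:
  assumes "w \<in> carrier W" obtains ws where "reduced_word W S w ws"
proof -
  obtain us where us: "C.reduced us" "prod_list us = \<phi> w" using C.ex_reduced[OF reg_par[OF assms]] .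
  then have "us \<in> lists (\<phi> ` S)" by (simp add: C.reduced_def)
  then obtain ws where "ws \<in> lists S" "us = map \<phi> ws" by (auto simp: lists_image)
  then show ?thesis using that us reduced_word_reg[of ws w] assms by simp
qed

text \<open>A reduced word of \<open>v\<close> with suffix \<open>us\<close> leaves a prefix for
  \<open>v * inverse u\<close>. Conversely, reduced words for \<open>v * inverse u\<close> and
  \<open>u\<close> concatenate to a reduced word because the lengths add.\<close>

lemma left_weak_reg:
  assumes u: "u \<in> carrier W" and v: "v \<in> carrier W"
  shows "left_weak_le W S u v \<longleftrightarrow> C.wle (\<phi> u) (\<phi> v)"
proof
  have "\<phi> v * inverse (\<phi> u) * \<phi> u = \<phi> v" by (simp add: mult.assoc mult_group_class.left_inv)
  then have le: "C.len (\<phi> v) \<le> C.len (\<phi> v * inverse (\<phi> u)) + C.len (\<phi> u)"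
    using C.len_mult_le[of "\<phi> v * inverse (\<phi> u)" "\<phi> u"] reg_par[OF u] reg_par[OF v] by simp
  assume "left_weak_le W S u v"
  then obtain us ps where *: "reduced_word W S u us" "reduced_word W S v (ps @ us)"
    by (auto simp: left_weak_le_def suffix_def)
  have l: "us \<in> lists S" "ps \<in> lists S" using * by (auto simp: reduced_word_def)
  have us: "C.reduced (map \<phi> us)" "prod_list (map \<phi> us) = \<phi> u"
    using * reduced_word_reg[OF l(1) u] by auto
  have vs: "C.reduced (map \<phi> (ps @ us))" "prod_list (map \<phi> (ps @ us)) = \<phi> v"
    using * l reduced_word_reg[of "ps @ us" v] v by auto
  have "\<phi> v * inverse (\<phi> u) = prod_list (map \<phi> ps)"
    using us(2) vs(2) by (simp add: mult.assoc mult_group_class.right_inv flip: vs(2) us(2))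
  moreover have "map \<phi> ps \<in> lists (\<phi> ` S)" using l by auto
  ultimately have "C.len (\<phi> v * inverse (\<phi> u)) \<le> length ps" using C.len_le by fastforce
  moreover have "C.len (\<phi> v) = length ps + C.len (\<phi> u)"
    using us vs by (simp add: C.reduced_def)
  ultimately show "C.wle (\<phi> u) (\<phi> v)" using le by (simp add: C.wle_def)
next
  assume w: "C.wle (\<phi> u) (\<phi> v)"
  have vu: "v \<otimes> inv u \<in> carrier W" using u v by simp
  obtain ps where ps: "reduced_word W S (v \<otimes> inv u) ps" by (rule ex_reduced_word[OF vu])
  obtain us where us: "reduced_word W S u us" by (rule ex_reduced_word[OF u])
  have l: "ps \<in> lists S" "us \<in> lists S" using ps us by (auto simp: reduced_word_def)
  have eq: "\<phi> (v \<otimes> inv u) = \<phi> v * inverse (\<phi> u)" using u v by (simp add: reg_mult reg_inv)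
  have "C.reduced (map \<phi> ps)" "prod_list (map \<phi> ps) = \<phi> v * inverse (\<phi> u)"
    "C.reduced (map \<phi> us)" "prod_list (map \<phi> us) = \<phi> u"
    using reduced_word_reg[OF l(1) vu] reduced_word_reg[OF l(2) u] ps us eq by auto
  moreover from this have "prod_list (map \<phi> (ps @ us)) = \<phi> v"
    by (simp add: mult.assoc mult_group_class.left_inv)
  ultimately have "C.reduced (map \<phi> (ps @ us))" "prod_list (map \<phi> (ps @ us)) = \<phi> v"
    using w by (auto simp: C.reduced_def C.wle_def)
  then have "reduced_word W S v (ps @ us)" using reduced_word_reg[of "ps @ us" v] l v by simp
  then show "left_weak_le W S u v" using us by (auto simp: left_weak_le_def suffix_def)
qed

definition represents :: "'a list \<Rightarrow> 'a bijection list \<Rightarrow> bool" where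
  "represents \<pi> ts \<longleftrightarrow> length \<pi> = Suc (length ts) \<and> set \<pi> \<subseteq> carrier W \<and>
    (\<forall>i\<le>length ts. \<phi> (\<pi> ! i) = prod_list (take i ts))"

lemma abs_le_reg:
  assumes "u \<in> carrier W" "v \<in> carrier W"
  shows "abs_le W S u v \<longleftrightarrow> C.tlen (\<phi> u) + C.tlen (inverse (\<phi> u) * \<phi> v) = C.tlen (\<phi> v)"
proof -
  have "\<phi> (inv u \<otimes> v) = inverse (\<phi> u) * \<phi> v" using assms by (simp add: reg_mult reg_inv)
  then show ?thesis
    using assms tlen_reg[of "inv u \<otimes> v"] tlen_reg[of u] tlen_reg[of v] by (simp add: abs_le_def)
qed

lemma length_coxeter_word:
  assumes "C.coxeter_word cs" "set cs = \<phi> ` S" shows "length cs = card S"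
proof -
  have "inj_on \<phi> S" using inj_reg S_carrier inj_on_subset by blast
  then show ?thesis
    using assms distinct_card[of cs] card_image[of \<phi> S] by (simp add: C.coxeter_word_def)
qed

lemma ex_bij_carrier: "x \<in> par (\<phi> ` S) \<Longrightarrow> \<exists>w\<in>carrier W. x = \<phi> w"
  by (auto simp: par_reg)

text \<open>By \<open>cover_refl\<close> the quotients of consecutive entries are reflections; their
  partial products telescope to the entries.\<close>

lemma max_chain_represents:
  assumes cs: "C.coxeter_word cs" "set cs = \<phi> ` S" "\<phi> c = prod_list cs"
    and \<pi>: "\<pi> \<in> max_chains W S c"
  shows "\<exists>ts. C.chain cs ts \<and> represents \<pi> ts"
proof -
  have len: "length cs = card S" by (rule length_coxeter_word[OF cs(1,2)])
  have carr: "\<pi> ! i \<in> carrier W" if "i \<le> card S" for i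
  proof -
    have "\<pi> ! i \<in> set \<pi>" using \<pi> that by (auto simp: max_chains_def)
    then show ?thesis using \<pi> by (auto simp: max_chains_def abs_le_def)
  qed
  define ts where "ts = map (\<lambda>i. inverse (\<phi> (\<pi> ! i)) * \<phi> (\<pi> ! Suc i)) [0..<card S]"
  have "inverse (\<phi> (\<pi> ! i)) * \<phi> (\<pi> ! Suc i) \<in> C.T" if i: "i < card S" for i
  proof (rule C.cover_refl)
    have cov: "abs_cover W S (\<pi> ! i) (\<pi> ! Suc i)" using \<pi> i by (simp add: max_chains_def)
    have ci: "\<pi> ! i \<in> carrier W" "\<pi> ! Suc i \<in> carrier W" using carr i by auto
    show "\<phi> (\<pi> ! i) \<in> par (\<phi> ` S)" "\<phi> (\<pi> ! Suc i) \<in> par (\<phi> ` S)" using ci reg_par by auto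
    show "\<phi> (\<pi> ! i) \<noteq> \<phi> (\<pi> ! Suc i)" using cov ci reg_eq_iff by (simp add: abs_cover_def)
    show "C.tlen (\<phi> (\<pi> ! i)) + C.tlen (inverse (\<phi> (\<pi> ! i)) * \<phi> (\<pi> ! Suc i)) = C.tlen (\<phi> (\<pi> ! Suc i))"
      using cov abs_le_reg[OF ci] by (simp add: abs_cover_def)
    fix x assume x: "x \<in> par (\<phi> ` S)"
      "C.tlen (\<phi> (\<pi> ! i)) + C.tlen (inverse (\<phi> (\<pi> ! i)) * x) = C.tlen x"
      "C.tlen x + C.tlen (inverse x * \<phi> (\<pi> ! Suc i)) = C.tlen (\<phi> (\<pi> ! Suc i))"
    then obtain w where w: "w \<in> carrier W" "x = \<phi> w" using ex_bij_carrier by blast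
    then have "abs_le W S (\<pi> ! i) w" "abs_le W S w (\<pi> ! Suc i)"
      using x(2,3) abs_le_reg ci by auto
    then have "w = \<pi> ! i \<or> w = \<pi> ! Suc i" using cov by (simp add: abs_cover_def)
    then show "x = \<phi> (\<pi> ! i) \<or> x = \<phi> (\<pi> ! Suc i)" using w by auto
  qed
  then have T: "set ts \<subseteq> C.T" by (auto simp: ts_def)
  have lts: "length ts = card S" by (simp add: ts_def)
  have take: "prod_list (take i ts) = \<phi> (\<pi> ! i)" if "i \<le> card S" for i
    using that
  proof (induction i)
    case 0
    then show ?case using \<pi> by (simp add: max_chains_def reg_one)
  next
    case (Suc i)
    then have "take (Suc i) ts = take i ts @ [inverse (\<phi> (\<pi> ! i)) * \<phi> (\<pi> ! Suc i)]"
      by (simp add: take_Suc_conv_app_nth lts) (simp add: ts_def)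
    then show ?case using Suc by (simp add: mult_group_class.cancel_inv_left)
  qed
  have "prod_list ts = prod_list cs"
    using take[of "card S"] lts \<pi> cs(3) by (simp add: max_chains_def)
  then have "C.chain cs ts" using T lts len by (simp add: C.chain_def)
  moreover have "set \<pi> \<subseteq> carrier W" using \<pi> by (auto simp: max_chains_def abs_le_def)
  then have "represents \<pi> ts"
    using take lts \<pi> by (simp add: represents_def max_chains_def)
  ultimately show ?thesis by blast
qed

text \<open>The entries are the partial products. Every segment of \<open>ts\<close> has as many
  steps as its reflection length, so the order relations reduce to \<open>i + (r - i) = r\<close>
  and \<open>i + 1 = Suc i\<close>, and \<open>chain_cover\<close> excludes anything in
  between.\<close>

lemma ex_max_chain:
  assumes cs: "C.coxeter_word cs" "set cs = \<phi> ` S" "\<phi> c = prod_list cs" "c \<in> carrier W"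
    and ts: "C.chain cs ts"
  shows "\<exists>\<pi>\<in>max_chains W S c. represents \<pi> ts"
proof -
  have len: "length cs = card S" by (rule length_coxeter_word[OF cs(1,2)])
  then have lts: "length ts = card S" using ts by (simp add: C.chain_def)
  have T: "set ts \<subseteq> C.T" using ts by (simp add: C.chain_def)
  have "prod_list (take i ts) \<in> par (\<phi> ` S)" for i
    using T set_take_subset[of i ts] by (intro C.prod_refls_par) blast
  then have "\<forall>i. \<exists>w. w \<in> carrier W \<and> prod_list (take i ts) = \<phi> w" using ex_bij_carrier by blast
  then obtain p where p: "\<And>i. p i \<in> carrier W" "\<And>i. prod_list (take i ts) = \<phi> (p i)" by metis
  define \<pi> where "\<pi> = map p [0..<Suc (card S)]"
  have nth: "\<pi> ! i = p i" if "i \<le> card S" for i using that by (simp add: \<pi>_def del: upt_Suc)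
  have rep: "represents \<pi> ts"
    using p nth lts by (auto simp: represents_def \<pi>_def simp del: upt_Suc)
  have tl: "C.tlen (\<phi> (p i)) = i" if "i \<le> card S" for i
    using C.chain_tlen[OF cs(1) ts, of "[]" "take i ts" "drop i ts"] that lts p by simp
  have p0: "p 0 = \<one>"
    using p(1)[of 0] p(2)[of 0] reg_eq_iff[of "p 0" \<one>] by (simp add: reg_one)
  have pr: "p (card S) = c"
  proof -
    have "prod_list ts = \<phi> (p (card S))" using p(2)[of "card S"] lts by simp
    then have "\<phi> (p (card S)) = \<phi> c" using ts unfolding C.chain_def cs(3) by metis
    then show ?thesis using reg_eq_iff p(1) cs(4) by blast
  qed
  have below: "abs_le W S \<one> x \<and> abs_le W S x c" if x: "x \<in> set \<pi>" for x
  proof -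
    obtain i where i: "i \<le> card S" "x = p i" using x by (auto simp: \<pi>_def less_Suc_eq_le simp del: upt_Suc)
    have "\<phi> (p i) * prod_list (drop i ts) = \<phi> c"
      using prod_list.append[of "take i ts" "drop i ts"] ts p(2)[of i] cs(3) by (simp add: C.chain_def)
    then have "inverse (\<phi> (p i)) * \<phi> c = prod_list (drop i ts)"
      by (metis mult_group_class.inv_cancel_left)
    then have "C.tlen (inverse (\<phi> (p i)) * \<phi> c) = card S - i"
      using C.chain_tlen[OF cs(1) ts, of "take i ts" "drop i ts" "[]"] lts by simp
    then show ?thesis
      using i p(1) cs(4) tl[of i] tl[of "card S"] pr abs_le_reg[of "p i" c] abs_le_reg[of \<one> "p i"]
      by (simp add: reg_one mult_group_class.inv_one C.tlen_one)
  qed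
  have cover: "abs_cover W S (p i) (p (Suc i))" if i: "i < card S" for i
  proof -
    have "p i \<noteq> p (Suc i)" using tl[of i] tl[of "Suc i"] i by auto
    moreover have "prod_list (take (Suc i) ts) = prod_list (take i ts) * ts ! i"
      using i lts by (simp add: take_Suc_conv_app_nth)
    then have "\<phi> (p (Suc i)) = \<phi> (p i) * ts ! i" by (simp only: p(2))
    then have "inverse (\<phi> (p i)) * \<phi> (p (Suc i)) = ts ! i"
      by (simp only: mult_group_class.inv_cancel_left)
    then have "C.tlen (inverse (\<phi> (p i)) * \<phi> (p (Suc i))) = 1"
      using C.chain_tlen[OF cs(1) ts, of "take i ts" "[ts ! i]" "drop (Suc i) ts"] i lts
      by (simp add: id_take_nth_drop[symmetric])
    then have "abs_le W S (p i) (p (Suc i))"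
      using abs_le_reg[OF p(1) p(1)] tl[of i] tl[of "Suc i"] i by simp
    moreover have "x = p i \<or> x = p (Suc i)" if "abs_le W S (p i) x" "abs_le W S x (p (Suc i))" for x
    proof -
      have xc: "x \<in> carrier W" using that by (simp add: abs_le_def)
      have "\<phi> x = prod_list (take i ts) \<or> \<phi> x = prod_list (take (Suc i) ts)"
        using C.chain_cover[OF cs(1) ts, of i "\<phi> x"] i lts reg_par[OF xc] that
          abs_le_reg[OF p(1) xc] abs_le_reg[OF xc p(1)] p(2) by simp
      then show ?thesis using p reg_eq_iff[OF xc p(1)] by simp
    qed
    ultimately show ?thesis by (auto simp: abs_cover_def)
  qed
  have "\<pi> \<in> max_chains W S c"
    using below cover nth p0 pr by (simp add: max_chains_def) (simp add: \<pi>_def)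
  then show ?thesis using rep by blast
qed

lemma bruhat_le_length:
  "bruhat_le W S u v \<Longrightarrow> length_S W S u \<le> length_S W S v"
  unfolding bruhat_le_def by (induction rule: rtranclp_induct) (auto simp: bruhat_cover_def)

text \<open>The Bruhat relation yields only weak growth of lengths, which is strict because
  neighbours differ by a reflection. Conversely, ascents rise by exactly one and are Bruhat covers,
  and \<open>chain_len\<close> gives membership in \<open>Wc_plus\<close>.\<close>

lemma concordant_set_reg:
  assumes cs: "C.coxeter_word cs" "set cs = \<phi> ` S" "\<phi> c = prod_list cs" "c \<in> carrier W"
    and ts: "C.chain cs ts" and rep: "represents \<pi> ts" and u: "u \<in> carrier W"
  shows "u \<in> concordant_set W S c \<pi> \<longleftrightarrow> \<phi> u \<in> C.conc cs ts"
proof -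
  have len: "length cs = card S" by (rule length_coxeter_word[OF cs(1,2)])
  then have lts: "length ts = card S" using ts by (simp add: C.chain_def)
  have T: "set ts \<subseteq> C.T" using ts by (simp add: C.chain_def)
  have carr: "\<pi> ! i \<in> carrier W" if "i \<le> card S" for i
    using rep that lts nth_mem[of i \<pi>] by (auto simp: represents_def)
  have x: "\<phi> (u \<otimes> \<pi> ! i) = \<phi> u * prod_list (take i ts)" if "i \<le> card S" for i
    using that carr u rep lts by (simp add: reg_mult represents_def)
  have xS: "\<phi> u * prod_list (take i ts) \<in> par (\<phi> ` S)" if "i \<le> card S" for i
    using x[OF that] reg_par[of "u \<otimes> \<pi> ! i"] carr[OF that] u by simp
  have step: "\<phi> (u \<otimes> \<pi> ! Suc i) = \<phi> u * prod_list (take i ts) * ts ! i" if "i < card S" for i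
    using x[of "Suc i"] that lts by (simp add: take_Suc_conv_app_nth mult.assoc)
  have tT: "ts ! i \<in> C.T" if "i < card S" for i using that lts T by auto
  have iff: "ts ! i \<notin> C.N (\<phi> u * prod_list (take i ts)) \<longleftrightarrow>
      length_S W S (u \<otimes> \<pi> ! i) < length_S W S (u \<otimes> \<pi> ! Suc i)" if i: "i < card S" for i
    using C.not_N_iff[OF tT[OF i] xS, of i] i step[OF i] x[of i] len_reg[of "u \<otimes> \<pi> ! i"]
      len_reg[of "u \<otimes> \<pi> ! Suc i"] carr[of i] carr[of "Suc i"] u by simp
  have par: "\<phi> u \<in> par (set cs)" using reg_par[OF u] cs(2) by simp
  show ?thesis
  proof
    assume "u \<in> concordant_set W S c \<pi>"
    then have "bruhat_le W S (u \<otimes> \<pi> ! i) (u \<otimes> \<pi> ! Suc i)" if "i < card S" for i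
      using that by (simp add: concordant_set_def concordant_def)
    then have le: "length_S W S (u \<otimes> \<pi> ! i) \<le> length_S W S (u \<otimes> \<pi> ! Suc i)" if "i < card S" for i
      using bruhat_le_length that by blast
    have "length_S W S (u \<otimes> \<pi> ! i) \<noteq> length_S W S (u \<otimes> \<pi> ! Suc i)" if i: "i < card S" for i
      using C.len_refl_neq[OF tT[OF i] xS, of i] i step[OF i] x[of i] len_reg[of "u \<otimes> \<pi> ! i"]
        len_reg[of "u \<otimes> \<pi> ! Suc i"] carr[of i] carr[of "Suc i"] u by simp
    then have "C.ups (\<phi> u) ts"
      unfolding C.ups_iff_nth using iff le lts by (simp add: order_less_le)
    then show "\<phi> u \<in> C.conc cs ts" using par by (simp add: C.conc_def)
  next
    assume "\<phi> u \<in> C.conc cs ts"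
    then have ups: "C.ups (\<phi> u) ts" by (simp add: C.conc_def)
    have "C.len (\<phi> u * prod_list cs) = C.len (\<phi> u) + length cs"
      by (rule C.chain_len[OF cs(1) ts reg_par[OF u] ups])
    then have plus: "length_S W S (u \<otimes> c) = length_S W S u + card S"
      using len_reg[of "u \<otimes> c"] len_reg[OF u] u cs(3,4) len by (simp add: reg_mult)
    have "bruhat_cover W S (u \<otimes> \<pi> ! i) (u \<otimes> \<pi> ! Suc i)" if i: "i < card S" for i
    proof -
      have "ts = take i ts @ ts ! i # drop (Suc i) ts" using i lts by (simp add: id_take_nth_drop[symmetric])
      then have "C.len (\<phi> u * prod_list (take i ts) * ts ! i) = C.len (\<phi> u * prod_list (take i ts)) + 1"
        using C.ups_exact[of "\<phi> u" "take i ts" "ts ! i" "drop (Suc i) ts"] reg_par[OF u] T ups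
          \<open>C.len (\<phi> u * prod_list cs) = C.len (\<phi> u) + length cs\<close> ts by (simp add: C.chain_def)
      then have "length_S W S (u \<otimes> \<pi> ! Suc i) = length_S W S (u \<otimes> \<pi> ! i) + 1"
        using step[OF i] x[of i] i len_reg[of "u \<otimes> \<pi> ! i"] len_reg[of "u \<otimes> \<pi> ! Suc i"]
          carr[of i] carr[of "Suc i"] u by simp
      moreover obtain t where t: "t \<in> reflections W S" "ts ! i = \<phi> t"
        using tT[OF i] by (auto simp: T_reg)
      moreover have "u \<otimes> \<pi> ! Suc i = u \<otimes> \<pi> ! i \<otimes> t"
      proof -
        have tc: "t \<in> carrier W" using t refl_carrier by blast
        then have "\<phi> (u \<otimes> \<pi> ! Suc i) = \<phi> (u \<otimes> \<pi> ! i \<otimes> t)"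
          using step[OF i] x[of i] i t carr[of i] u by (simp add: reg_mult)
        then show ?thesis
          using reg_eq_iff[of "u \<otimes> \<pi> ! Suc i" "u \<otimes> \<pi> ! i \<otimes> t"] carr[of i] carr[of "Suc i"] i u tc by simp
      qed
      ultimately show ?thesis using u carr[of i] i by (auto simp: bruhat_cover_def)
    qed
    then have "concordant W S u \<pi>" by (auto simp: concordant_def bruhat_le_def)
    then show "u \<in> concordant_set W S c \<pi>" using plus u by (simp add: concordant_set_def Wc_plus_def)
  qed
qed

lemma omega_down_reg:
  assumes cs: "C.coxeter_word cs" "set cs = \<phi> ` S" "\<phi> c = prod_list cs" "c \<in> carrier W"
    and ts: "C.chain cs ts" and rep: "represents \<pi> ts" and u: "u \<in> carrier W"
    and min: "C.is_min cs ts (\<phi> u)"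
  shows "omega_down W S c \<pi> = u"
  unfolding omega_down_def
proof (rule the_equality)
  note conc = concordant_set_reg[OF cs ts rep]
  have sub: "concordant_set W S c \<pi> \<subseteq> carrier W" by (auto simp: concordant_set_def Wc_plus_def)
  have "C.wle (\<phi> u) (\<phi> v)" if "v \<in> concordant_set W S c \<pi>" for v
    using that sub conc min by (auto simp: C.is_min_def)
  then show *: "u \<in> concordant_set W S c \<pi> \<and> (\<forall>v\<in>concordant_set W S c \<pi>. left_weak_le W S u v)"
    using min conc[OF u] left_weak_reg[OF u] sub by (auto simp: C.is_min_def)
  fix v assume v: "v \<in> concordant_set W S c \<pi> \<and> (\<forall>w\<in>concordant_set W S c \<pi>. left_weak_le W S v w)"
  then have vc: "v \<in> carrier W" using sub by blast
  have "C.wle (\<phi> v) (\<phi> u)" "C.wle (\<phi> u) (\<phi> v)"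
    using v * left_weak_reg u vc by auto
  then have "\<phi> v = \<phi> u" by (rule C.wle_antisym[OF reg_par[OF vc] reg_par[OF u]])
  then show "v = u" using reg_eq_iff[OF vc u] by simp
qed

lemma sortable_reg:
  assumes cw: "C.coxeter_word (map \<phi> cw)" "set cw = S" and x: "x \<in> carrier W"
  shows "sortable W S cw x \<longleftrightarrow> C.srt (map \<phi> cw) (\<phi> x)"
proof (cases "cw = []")
  case True
  \<comment> \<open>In rank 0 the letters \<open>cw ! (i mod length cw)\<close> are unspecified, so
    this case is separate; no nonempty word over \<open>S\<close> exists.\<close>
  then have S: "S = {}" using cw by simp
  have "{\<phi> x} \<subseteq> par (\<phi> ` S)" using reg_par[OF x] by simp
  then have x1: "\<phi> x = 1" using S by simp
  have "C.reduced []" by (simp add: C.reduced_def)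
  then have "reduced_word W S x []" using reduced_word_reg[of "[]" x] x x1 by simp
  then have rs: "reduced_subword W S cw x ps \<longleftrightarrow> ps = []" for ps
    using S by (auto simp: reduced_subword_def reduced_word_def)
  have "sorting_positions W S cw x = []"
    unfolding sorting_positions_def by (rule the_equality) (auto simp: rs)
  then have "sortable W S cw x" by (simp add: sortable_def copy_letters_def)
  then show ?thesis using True x1 C.srt_Nil by simp
next
  case False
  let ?r = "length cw" and ?cw = "map \<phi> cw"
  have pos: "?r > 0" using False by simp
  have dist: "distinct cw" using cw by (auto simp: C.coxeter_word_def distinct_map)
  have letter: "cw ! (i mod ?r) \<in> S" for i using cw(2) pos by auto
  have sub: "reduced_subword W S cw x ps \<longleftrightarrow> C.stream_reduced (C.cyc ?cw) (\<phi> x) ps" for ps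
  proof -
    have "map \<phi> (map (\<lambda>i. cw ! (i mod ?r)) ps) = map (C.cyc ?cw) ps"
      using pos by (simp add: C.cyc_def)
    moreover have "map (\<lambda>i. cw ! (i mod ?r)) ps \<in> lists S" using letter by auto
    ultimately show ?thesis
      using reduced_word_reg[of "map (\<lambda>i. cw ! (i mod ?r)) ps" x] x
      by (simp only: reduced_subword_def C.stream_reduced_def)
  qed
  have "\<phi> x \<in> par (set ?cw)" using reg_par[OF x] cw(2) by simp
  then obtain ps where ps: "set ps = {i. C.used (C.cyc ?cw) (\<phi> x) i}"
    "C.stream_reduced (C.cyc ?cw) (\<phi> x) ps"
    "\<And>qs. C.stream_reduced (C.cyc ?cw) (\<phi> x) qs \<Longrightarrow> ps = qs \<or> (ps, qs) \<in> lexord less_than"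
    using C.greedy_sorting_cyc[OF cw(1)] False by blast
  have asym: "asym less_than" by (auto intro: asymI)
  have sp: "sorting_positions W S cw x = ps"
    unfolding sorting_positions_def
  proof (rule the_equality)
    fix qs assume "reduced_subword W S cw x qs \<and>
      (\<forall>rs. reduced_subword W S cw x rs \<longrightarrow> qs = rs \<or> (qs, rs) \<in> lexord less_than)"
    then show "qs = ps" using ps(2,3) sub lexord_asymmetric[OF asym] by blast
  qed (use ps sub in auto)
  have copy: "cw ! j \<in> copy_letters W S cw x k \<longleftrightarrow> C.used (C.cyc ?cw) (\<phi> x) (j + k * ?r)"
    if j: "j < ?r" for j k
  proof
    assume "cw ! j \<in> copy_letters W S cw x k"
    then obtain i where i: "cw ! j = cw ! (i mod ?r)" "i \<in> set ps" "i div ?r = k"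
      by (auto simp: copy_letters_def sp)
    then have "j = i mod ?r"
      using nth_eq_iff_index_eq[OF dist j mod_less_divisor[OF pos]] by blast
    then have "i = j + k * ?r" using i(3) mod_div_mult_eq[of i ?r] by simp
    then show "C.used (C.cyc ?cw) (\<phi> x) (j + k * ?r)" using i(2) ps(1) by simp
  next
    assume "C.used (C.cyc ?cw) (\<phi> x) (j + k * ?r)"
    then have "j + k * ?r \<in> set ps" "(j + k * ?r) mod ?r = j" "(j + k * ?r) div ?r = k"
      using ps(1) j pos by auto
    then show "cw ! j \<in> copy_letters W S cw x k"
      unfolding copy_letters_def sp by (intro CollectI exI[of _ "j + k * ?r"]) simp
  qed
  have letters: "copy_letters W S cw x k \<subseteq> {cw ! j | j. j < ?r}" for k
    using pos by (auto simp: copy_letters_def)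
  have "sortable W S cw x \<longleftrightarrow> (\<forall>k. \<forall>j<?r. C.used (C.cyc ?cw) (\<phi> x) (j + Suc k * ?r) \<longrightarrow>
      C.used (C.cyc ?cw) (\<phi> x) (j + k * ?r))"
  proof -
    have "copy_letters W S cw x (Suc k) \<subseteq> copy_letters W S cw x k \<longleftrightarrow>
        (\<forall>j<?r. cw ! j \<in> copy_letters W S cw x (Suc k) \<longrightarrow> cw ! j \<in> copy_letters W S cw x k)" for k
      using letters[of "Suc k"] by blast
    then show ?thesis unfolding sortable_def using copy by simp
  qed
  also have "\<dots> \<longleftrightarrow> C.nested ?cw (\<phi> x)"
    unfolding C.nested_rounds using C.used_rounds[of _ ?cw "\<phi> x"] by (simp del: funpow.simps mult_Suc)
  also have "\<dots> \<longleftrightarrow> C.srt ?cw (\<phi> x)"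
    using C.nested_iff_srt[OF cw(1)] reg_par[OF x] cw(2) by simp
  finally show ?thesis .
qed

text \<open>Any reduced word of the inverse of \<open>c\<close> uses each generator once. The
  letters of a Coxeter word form a shortest factorization of \<open>c\<close>, which lies in the
  parabolic subgroup of the letters of \<open>cw\<close>; so by \<open>tmin_par\<close> all of
  \<open>S\<close> occurs in \<open>cw\<close>, and the length leaves no room for
  repetitions.\<close>

lemma coxeter_element_word:
  assumes "standard_coxeter_element W S c" "reduced_word W S (inv c) cw"
  shows "C.coxeter_word (map \<phi> cw)" "set cw = S" "\<phi> c = prod_list (rev (map \<phi> cw))" "c \<in> carrier W"
proof -
  obtain ws where ws: "distinct ws" "set ws = S" "word_prod W ws = c"
    using assms by (auto simp: standard_coxeter_element_def)
  have wc: "set ws \<subseteq> carrier W" using ws S_carrier by simp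
  show c: "c \<in> carrier W" using word_prod_closed[OF wc] ws by simp
  have cwS: "cw \<in> lists S" using assms by (simp add: reduced_word_def)
  let ?ws = "map \<phi> ws" and ?cw = "map \<phi> cw"
  have inj: "inj_on \<phi> S" using inj_reg S_carrier inj_on_subset by blast
  have dw: "C.coxeter_word ?ws" "C.coxeter_word (rev ?ws)" using ws inj by (auto simp: C.coxeter_word_def distinct_map)
  have pw: "prod_list ?ws = \<phi> c" using reg_word_prod[OF wc] ws by simp
  have pcw: "prod_list ?cw = inverse (\<phi> c)" and red: "C.reduced ?cw"
    using reduced_word_reg[OF cwS, of "inv c"] assms(2) c by (simp_all add: reg_inv)
  have cwl: "?cw \<in> lists (\<phi> ` S)" using red by (simp add: C.reduced_def)
  have prev: "prod_list (rev ?cw) = \<phi> c"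
    using C.inverse_prod_list[OF cwl] pcw by (simp add: mult_group_class.inv_inv)
  then show "\<phi> c = prod_list (rev (map \<phi> cw))" by simp
  have T: "set ?cw \<subseteq> C.T" "set ?ws \<subseteq> C.T" using cwl ws C.S_T by auto
  have "length ?cw = length ?ws"
  proof -
    have "length ?cw = C.len (inverse (\<phi> c))" using red pcw by (simp add: C.reduced_def)
    also have "\<dots> = C.len (prod_list ?ws)" using C.len_inv[of "\<phi> c"] reg_par[OF c] pw by simp
    also have "\<dots> = length ?ws" using C.distinct_word_reduced[of ?ws] dw by (simp add: C.coxeter_word_def)
    finally show ?thesis .
  qed
  then have lc: "length cw = card S" using ws distinct_card[of ws] by simp
  have ch: "C.chain ?ws ?ws" using T by (simp add: C.chain_def)
  have "S \<subseteq> set cw"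
  proof
    fix s assume s: "s \<in> S"
    have "set ?cw \<subseteq> \<phi> ` S" using cwl by auto
    moreover have "prod_list ?ws \<in> par (set ?cw)"
      using prod_list_in_par[of "rev ?cw" "set ?cw"] prev pw by simp
    ultimately have "set ?ws \<subseteq> par (set ?cw)"
      using C.tmin_par[OF _ C.chain_tmin[OF dw(1) ch], of "set ?cw"] by simp
    then have "\<phi> s \<in> par (set ?cw)" using s ws by auto
    then have "\<phi> s \<in> set ?cw" using C.par_Int_S[of "set ?cw" "\<phi> s"] s \<open>set ?cw \<subseteq> \<phi> ` S\<close> by simp
    then obtain t where "t \<in> set cw" "\<phi> s = \<phi> t" by auto
    then show "s \<in> set cw" using inj s cwS by (auto dest: inj_onD)
  qed
  then show S: "set cw = S" using cwS by auto
  then have "distinct cw" using lc by (simp add: card_distinct)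
  then show "C.coxeter_word ?cw" using S inj by (simp add: C.coxeter_word_def distinct_map)
qed

text \<open>Sortability runs on the given word for the inverse of \<open>c\<close>, the chains on
  its reverse. An entry of the chain is a partial product after \<open>i\<close> steps, with
  \<open>i\<close> from 0 up to the rank.\<close>

theorem sortable_iff_max_chain:
  assumes c: "standard_coxeter_element W S c" and cw: "reduced_word W S (inv c) cw"
    and w: "w \<in> carrier W"
  shows "(\<exists>\<pi>\<in>max_chains W S c. w \<in> omega_down W S c \<pi> <# set \<pi>) \<longleftrightarrow> sortable W S cw (inv w)"
proof -
  let ?cw = "map \<phi> cw" and ?cs = "rev (map \<phi> cw)"
  note word = coxeter_element_word[OF c cw]
  have cs: "C.coxeter_word ?cs" "set ?cs = \<phi> ` S"
    using word(1,2) by (simp_all add: C.coxeter_word_def)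
  have sort: "sortable W S cw (inv w) \<longleftrightarrow> C.srt ?cw (inverse (\<phi> w))"
    using sortable_reg[OF word(1,2), of "inv w"] w by (simp add: reg_inv)
  show ?thesis
    unfolding sort
  proof
    assume "\<exists>\<pi>\<in>max_chains W S c. w \<in> omega_down W S c \<pi> <# set \<pi>"
    then obtain \<pi> where \<pi>: "\<pi> \<in> max_chains W S c" "w \<in> omega_down W S c \<pi> <# set \<pi>" by blast
    obtain ts where ts: "C.chain ?cs ts" "represents \<pi> ts"
      using max_chain_represents[OF cs word(3) \<pi>(1)] by blast
    obtain x where x: "C.is_min ?cs ts x" using C.ex_min[OF cs(1) ts(1)] by blast
    have "x \<in> par (\<phi> ` S)" using x C.conc_par[OF cs(1)] by (auto simp: C.is_min_def)
    then obtain u where u: "u \<in> carrier W" "x = \<phi> u" using ex_bij_carrier by blast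
    have "omega_down W S c \<pi> = u" using omega_down_reg[OF cs word(3,4) ts u(1)] x u by simp
    then obtain i where i: "i < length \<pi>" "w = u \<otimes> \<pi> ! i"
      using \<pi>(2) by (auto simp: l_coset_def in_set_conv_nth)
    then have "\<pi> ! i \<in> carrier W" "\<phi> (\<pi> ! i) = prod_list (take i ts)"
      using ts(2) nth_mem[OF i(1)] by (auto simp: represents_def)
    then have "\<phi> w = x * prod_list (take i ts)" using i u by (simp add: reg_mult)
    then show "C.srt ?cw (inverse (\<phi> w))" using C.min_imp_srt[OF word(1) ts(1) x] by simp
  next
    assume "C.srt ?cw (inverse (\<phi> w))"
    from C.srt_imp_min[OF this word(1)] obtain ts x i where *: "C.chain ?cs ts" "C.is_min ?cs ts x" "i \<le> length ?cw"
      "\<phi> w = x * prod_list (take i ts)"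
      unfolding mult_group_class.inv_inv by blast
    obtain \<pi> where \<pi>: "\<pi> \<in> max_chains W S c" "represents \<pi> ts"
      using ex_max_chain[OF cs word(3,4) *(1)] by blast
    have "x \<in> par (\<phi> ` S)" using *(2) C.conc_par[OF cs(1)] by (auto simp: C.is_min_def)
    then obtain u where u: "u \<in> carrier W" "x = \<phi> u" using ex_bij_carrier by blast
    have om: "omega_down W S c \<pi> = u" using omega_down_reg[OF cs word(3,4) *(1) \<pi>(2) u(1)] * u by simp
    have i: "i \<le> length ts" "i < length \<pi>" using *(1,3) \<pi>(2) by (auto simp: C.chain_def represents_def)
    then have p: "\<pi> ! i \<in> carrier W" "\<phi> (\<pi> ! i) = prod_list (take i ts)"
      using \<pi>(2) nth_mem[OF i(2)] by (auto simp: represents_def)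
    then have "\<phi> w = \<phi> (u \<otimes> \<pi> ! i)" using *(4) u by (simp add: reg_mult)
    then have "w = u \<otimes> \<pi> ! i" using reg_eq_iff[of w "u \<otimes> \<pi> ! i"] w u p by simp
    then have "w \<in> omega_down W S c \<pi> <# set \<pi>"
      using om i(2) by (auto simp: l_coset_def)
    then show "\<exists>\<pi>\<in>max_chains W S c. w \<in> omega_down W S c \<pi> <# set \<pi>" using \<pi>(1) by blast
  qed
qed

end

theorem theorem5p12:
  fixes W :: "('a, 'b) monoid_scheme" and S :: "'a set" and c w :: 'a and cw' :: "'a list"
  assumes "coxeter_system W S"
    and "finite (carrier W)"
    and "standard_coxeter_element W S c"
    and "reduced_word W S (inv\<^bsub>W\<^esub> c) cw'"
    and "w \<in> carrier W"
  shows "(\<exists>\<pi>\<in>max_chains W S c. w \<in> omega_down W S c \<pi> <#\<^bsub>W\<^esub> set \<pi>)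
     \<longleftrightarrow> sortable W S cw' (inv\<^bsub>W\<^esub> w)"
proof -
  interpret finite_coxeter_system W S
    using assms(1,2) by (rule finite_coxeter_system.intro)
  show ?thesis using assms(3-5) by (rule sortable_iff_max_chain)
qed

end
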